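(* Let $1<p<\infty$, let $a_j\in GL^\infty$, $j=1,2,3,4$, and let $A:H^p\to H^p$ refer to one of the four operators $$T(a_1)-H(a_1t^{-1}),\quad T(a_2)+H(a_2t),\quad T(a_3)+H(a_3),\quad T(a_4)-H(a_4).$$ Then $\ker A=\{0\}$ or $\operatorname{coker}A=\{0\}$.
   Context: $\mathbb{T}$ is the unit circle, $L^p=L^p(\mathbb{T})$, $H^p=\{f\in L^p:\widehat f_n=0 \text{ for } n<0\}$, $P$ is the Riesz projection of $L^p$ onto $H^p$, $Q=I-P$, and $(Jf)(t)=\overline{t}f(\overline{t})$. $GL^\infty$ is the group of invertible elements of $L^\infty=L^\infty(\mathbb T)$. For $a\in L^\infty$, on $H^p$: $T(a)f=P(af)$ (Toeplitz operator), $H(a)f=PaQJf$ (Hankel operator). $t$ denotes the identity function on $\mathbb{T}$. For a bounded operator $A$, $\operatorname{coker}A:=\ker A^*$, where $A^*$ is the adjoint. *)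

theory Defs
  imports "HOL-Analysis.Analysis"
begin

(* Normalised arc length on the unit circle. *)
definition circle :: "complex measure" where
  "circle = distr (uniform_measure lborel {-pi..pi}) (restrict_space borel (sphere 0 1)) cis"

lemma space_circle [simp]: "space circle = sphere 0 1"
  by (simp add: circle_def space_restrict_space)

lemma sets_circle [measurable_cong]: "sets circle = sets (restrict_space borel (sphere 0 1))"
  by (simp add: circle_def)

lemma cis_measurable_circle [measurable]: "cis \<in> borel \<rightarrow>\<^sub>M restrict_space borel (sphere 0 1)"
  by (rule measurable_restrict_space2)
    (auto intro!: borel_measurable_continuous_onI continuous_intros simp: cis_conv_exp)

lemma emeasure_circle_space: "emeasure circle (space circle) = 1"
proof -
  have "cis -` sphere 0 1 = UNIV" by auto
  moreover have "sphere 0 1 \<in> sets (restrict_space borel (sphere (0::complex) 1))"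
    using sets.top[of "restrict_space borel (sphere (0::complex) 1)"]
    by (simp add: space_restrict_space)
  ultimately show ?thesis
    unfolding circle_def
    by (subst emeasure_distr) (auto simp: space_restrict_space divide_ennreal)
qed

lemma borel_measurable_circleI [measurable (raw)]:
  "f \<in> borel \<rightarrow>\<^sub>M borel \<Longrightarrow> f \<in> circle \<rightarrow>\<^sub>M borel"
  unfolding measurable_cong_sets[OF sets_circle refl] by (rule measurable_restrict_space1)

lemma cnj_measurable_circle: "cnj \<in> circle \<rightarrow>\<^sub>M circle"
  unfolding measurable_cong_sets[OF sets_circle sets_circle]
  by (rule measurable_restrict_space3)
    (auto intro!: borel_measurable_continuous_onI continuous_intros)

lemma distr_circle_cnj: "distr circle circle cnj = circle"
proof -
  let ?U = "uniform_measure lborel {-pi..pi}"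
  let ?R = "restrict_space borel (sphere 0 1) :: complex measure"
  have U: "distr ?U borel uminus = ?U"
  proof (rule measure_eqI)
    fix A :: "real set" assume "A \<in> sets (distr ?U borel uminus)"
    then have A [measurable]: "A \<in> sets borel" by simp
    have m: "uminus -` A \<in> sets (borel :: real measure)"
      using measurable_sets[of "uminus :: real \<Rightarrow> real" borel borel A] A by simp
    have "emeasure lborel ({-pi..pi} \<inter> uminus -` A) = emeasure lborel (uminus -` ({-pi..pi} \<inter> A))"
      by (rule arg_cong[where f = "emeasure lborel"]) auto
    also have "\<dots> = emeasure (distr lborel borel uminus) ({-pi..pi} \<inter> A)"
      by (subst emeasure_distr) auto
    also have "\<dots> = emeasure lborel ({-pi..pi} \<inter> A)"
      by (simp add: lborel_distr_uminus)
    finally show "emeasure (distr ?U borel uminus) A = emeasure ?U A"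
      using m by (simp add: emeasure_distr)
  qed simp
  have "distr circle circle cnj = distr circle ?R cnj"
    by (rule distr_cong) (auto simp: sets_circle)
  also have "\<dots> = distr ?U ?R (cnj \<circ> cis)"
    unfolding circle_def
    by (rule distr_distr) (use cnj_measurable_circle in
        \<open>auto simp: measurable_cong_sets[OF sets_circle sets_circle]\<close>)
  also have "cnj \<circ> cis = cis \<circ> uminus"
    by (auto simp: cis_cnj)
  also have "distr ?U ?R (cis \<circ> uminus) = distr (distr ?U borel uminus) ?R cis"
    by (rule distr_distr[symmetric]) auto
  also have "\<dots> = circle"
    by (simp add: U circle_def)
  finally show ?thesis .
qed

lemma AE_circle_cnj: "(AE t in circle. Q t) \<Longrightarrow> (AE t in circle. Q (cnj t))"
  by (rule AE_distrD[OF cnj_measurable_circle]) (simp only: distr_circle_cnj)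

(* The commutative ring of all measurable functions on the circle modulo equality almost
   everywhere; the spaces L^p and H^p are subsets of this type. *)
quotient_type circle_fun = "complex \<Rightarrow> complex" / partial:
  "\<lambda>f g. f \<in> borel_measurable circle \<and> g \<in> borel_measurable circle \<and> (AE t in circle. f t = g t)"
proof (rule part_equivpI)
  show "\<exists>f::complex \<Rightarrow> complex. f \<in> borel_measurable circle \<and> f \<in> borel_measurable circle \<and>
      (AE t in circle. f t = f t)"
    by (intro exI[of _ "\<lambda>_. 0"]) auto
qed (auto intro!: sympI transpI elim: AE_mp)

instantiation circle_fun :: comm_ring_1
begin

lift_definition zero_circle_fun :: circle_fun is "\<lambda>_. 0" by auto
lift_definition one_circle_fun :: circle_fun is "\<lambda>_. 1" by auto
lift_definition plus_circle_fun :: "circle_fun \<Rightarrow> circle_fun \<Rightarrow> circle_fun" is "\<lambda>f g t. f t + g t"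
  by (auto elim: AE_mp)
lift_definition minus_circle_fun :: "circle_fun \<Rightarrow> circle_fun \<Rightarrow> circle_fun" is "\<lambda>f g t. f t - g t"
  by (auto elim: AE_mp)
lift_definition uminus_circle_fun :: "circle_fun \<Rightarrow> circle_fun" is "\<lambda>f t. - f t"
  by (auto elim: AE_mp)
lift_definition times_circle_fun :: "circle_fun \<Rightarrow> circle_fun \<Rightarrow> circle_fun" is "\<lambda>f g t. f t * g t"
  by (auto elim: AE_mp)

instance
proof
  have "\<not> (AE t in circle. False)"
    using emeasure_circle_space AE_iff_measurable[OF sets.top, of circle "\<lambda>_. False"]
    by (auto simp: sphere_def)
  then show "(0::circle_fun) \<noteq> 1"
    by transfer auto
qed (transfer, auto simp: algebra_simps)+

end

lift_definition scaleC :: "complex \<Rightarrow> circle_fun \<Rightarrow> circle_fun" (infixr "*\<^sub>C" 75) is "\<lambda>c f t. c * f t"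
  by (auto elim: AE_mp)

(* The function t ^ n, for an integer n. *)
lift_definition monomial :: "int \<Rightarrow> circle_fun" is "\<lambda>n t. t powi n"
  by (auto simp: power_int_def)

lift_definition flip :: "circle_fun \<Rightarrow> circle_fun" is "\<lambda>f t. cnj t * f (cnj t)"
proof (elim conjE, intro conjI)
  fix f g :: "complex \<Rightarrow> complex"
  assume m: "f \<in> borel_measurable circle" "g \<in> borel_measurable circle"
  assume "AE t in circle. f t = g t"
  from AE_circle_cnj[OF this]
  show "AE t in circle. cnj t * f (cnj t) = cnj t * g (cnj t)"
    by eventually_elim simp
  have "cnj \<in> borel_measurable circle"
    by (intro borel_measurable_circleI borel_measurable_continuous_onI continuous_intros)
  then show "(\<lambda>t. cnj t * f (cnj t)) \<in> borel_measurable circle"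
    and "(\<lambda>t. cnj t * g (cnj t)) \<in> borel_measurable circle"
    by (intro borel_measurable_times measurable_compose[OF cnj_measurable_circle] m; simp)+
qed

lift_definition circle_integral :: "circle_fun \<Rightarrow> complex" is "\<lambda>f. integral\<^sup>L circle f"
  by (auto intro: integral_cong_AE)

definition fourier_coeff :: "circle_fun \<Rightarrow> int \<Rightarrow> complex" where
  "fourier_coeff f n = circle_integral (f * monomial (- n))"

lift_definition abs_powr_integrable :: "real \<Rightarrow> circle_fun \<Rightarrow> bool" is
  "\<lambda>p f. integrable circle (\<lambda>t. norm (f t) powr p)"
  by (intro integrable_cong_AE) (auto elim: AE_mp)

lift_definition Lp_norm :: "real \<Rightarrow> circle_fun \<Rightarrow> real" is
  "\<lambda>p f. (\<integral>t. norm (f t) powr p \<partial>circle) powr (1 / p)"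
  by (intro arg_cong[where f = "\<lambda>x. x powr _"] integral_cong_AE) (auto elim: AE_mp)

lift_definition essentially_bounded :: "circle_fun \<Rightarrow> bool" is
  "\<lambda>f. \<exists>C. AE t in circle. norm (f t) \<le> C"
  by (intro iff_exI) (auto elim: AE_mp)

definition Lp :: "real \<Rightarrow> circle_fun set" where
  "Lp p = {f. abs_powr_integrable p f}"

definition Linf :: "circle_fun set" where
  "Linf = {f. essentially_bounded f}"

definition GLinf :: "circle_fun set" where
  "GLinf = {a \<in> Linf. \<exists>b\<in>Linf. a * b = 1}"

definition Hp :: "real \<Rightarrow> circle_fun set" where
  "Hp p = {f \<in> Lp p. \<forall>n<0. fourier_coeff f n = 0}"

(* The projection that cuts off the negative Fourier coefficients. For 1 < p < \<infinity> and f in L^p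
   the described element exists by M. Riesz's theorem, and it is unique because a function is
   determined by its Fourier coefficients. The value is meaningless outside L^p. *)
definition riesz_proj :: "real \<Rightarrow> circle_fun \<Rightarrow> circle_fun" where
  "riesz_proj p f = (THE g. g \<in> Hp p \<and> (\<forall>n\<ge>0. fourier_coeff g n = fourier_coeff f n))"

definition riesz_coproj :: "real \<Rightarrow> circle_fun \<Rightarrow> circle_fun" where
  "riesz_coproj p f = f - riesz_proj p f"

definition toeplitz :: "real \<Rightarrow> circle_fun \<Rightarrow> circle_fun \<Rightarrow> circle_fun" where
  "toeplitz p a f = riesz_proj p (a * f)"

definition hankel :: "real \<Rightarrow> circle_fun \<Rightarrow> circle_fun \<Rightarrow> circle_fun" where
  "hankel p a f = riesz_proj p (a * riesz_coproj p (flip f))"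

(* Operators on H^p are represented by maps on circle_fun of which only the restriction to H^p
   matters; elements of the dual space of H^p are extensional, so that equality of functionals
   is equality on H^p. *)
definition Hp_kernel :: "real \<Rightarrow> (circle_fun \<Rightarrow> circle_fun) \<Rightarrow> circle_fun set" where
  "Hp_kernel p A = {f \<in> Hp p. A f = 0}"

definition Hp_dual :: "real \<Rightarrow> (circle_fun \<Rightarrow> complex) set" where
  "Hp_dual p = {\<phi> \<in> extensional (Hp p).
     (\<forall>f\<in>Hp p. \<forall>g\<in>Hp p. \<phi> (f + g) = \<phi> f + \<phi> g) \<and>
     (\<forall>c. \<forall>f\<in>Hp p. \<phi> (c *\<^sub>C f) = c * \<phi> f) \<and>
     (\<exists>C. \<forall>f\<in>Hp p. norm (\<phi> f) \<le> C * Lp_norm p f)}"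

definition zero_functional :: "real \<Rightarrow> circle_fun \<Rightarrow> complex" where
  "zero_functional p = (\<lambda>f\<in>Hp p. 0)"

definition Hp_adjoint ::
  "real \<Rightarrow> (circle_fun \<Rightarrow> circle_fun) \<Rightarrow> (circle_fun \<Rightarrow> complex) \<Rightarrow> (circle_fun \<Rightarrow> complex)" where
  "Hp_adjoint p A \<phi> = (\<lambda>f\<in>Hp p. \<phi> (A f))"

definition Hp_coker :: "real \<Rightarrow> (circle_fun \<Rightarrow> circle_fun) \<Rightarrow> (circle_fun \<Rightarrow> complex) set" where
  "Hp_coker p A = {\<phi> \<in> Hp_dual p. Hp_adjoint p A \<phi> = zero_functional p}"

end

theory Submission
  imports Defs "HOL-Complex_Analysis.Conformal_Mappings"
begin

text \<open>Each of the operators has the form \<open>A f = P a (f + V f)\<close> with an involution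
  \<open>(V f)(t) = \<epsilon> * t\<^sup>k * (J f)(t)\<close>. If \<open>f\<close> is a nonzero element of the kernel, then
  \<open>h = a * (f + V f)\<close> is a nonzero function with only negative frequencies, hence nonzero almost
  everywhere (F. and M. Riesz). A functional \<open>\<phi>\<close> in the cokernel satisfies \<open>\<phi> (P (h * t\<^sup>n)) = 0\<close>
  for all \<open>n\<close>, and the products of \<open>h\<close> with trigonometric polynomials are dense in \<open>L\<^sup>p\<close>, so
  \<open>\<phi> = 0\<close>. No description of the dual space is needed, only the boundedness of \<open>P\<close> (M. Riesz). That
  is proved for positive functions and \<open>p \<le> 2\<close> by taking the mean of the \<open>p\<close>-th power of an analytic
  polynomial with positive real part, and for larger \<open>p\<close> by repeated doubling.\<close>

section \<open>Integration over the circle\<close>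

text \<open>Two points decide which operators are covered. Membership in the cokernel makes
  \<open>\<phi>\<close> vanish on \<open>P (a * (w + V w))\<close> only for \<open>w\<close> in
  \<open>Hp p\<close>, while the argument uses it with \<open>x = g * t^n\<close>, which need not be
  analytic; and \<open>h\<close> is nonzero only if \<open>f + V f = 0\<close> forces
  \<open>f = 0\<close>. On Fourier coefficients \<open>V\<close> is the reflection of
  \<open>n\<close> to \<open>k - 1 - n\<close> with the sign \<open>\<epsilon>\<close>. An orbit
  with exactly one nonnegative frequency causes no trouble when it has two elements: an analytic
  \<open>w\<close> can be read off from \<open>x + V x\<close>, and it is unique. For
  \<open>k = 0\<close> all orbits are of this kind, so both signs are possible. For
  \<open>k = 1\<close> the frequency 0 is fixed, and with \<open>\<epsilon> = 1\<close> the equation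
  \<open>f + V f = 0\<close> still gives twice the mean of \<open>f\<close> equal to 0. For
  \<open>k = -1\<close> the frequency -1 is fixed and out of reach of analytic functions, but with
  \<open>\<epsilon> = -1\<close> the sum \<open>x + V x\<close> has no such term. These are the four
  operators.\<close>

lemma circle_eq_distr_density:
  "circle = distr (density lborel (\<lambda>x. ennreal (indicator {-pi..pi} x / (2 * pi))))
     (restrict_space borel (sphere 0 1)) cis"
proof -
  have "uniform_measure lborel {-pi..pi} = density lborel (\<lambda>x. ennreal (indicator {-pi..pi} x / (2 * pi)))"
    unfolding uniform_measure_def
    by (rule density_cong) (auto split: split_indicator simp: divide_ennreal[symmetric] ennreal_1[symmetric] simp del: ennreal_1)
  then show ?thesis
    by (simp add: circle_def)
qed

lemma integral_circle:
  fixes f :: "complex \<Rightarrow> 'b :: {banach, second_countable_topology}"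
  assumes f [measurable]: "f \<in> borel_measurable circle"
  shows "integral\<^sup>L circle f = (1 / (2 * pi)) *\<^sub>R (LINT x:{-pi..pi}|lborel. f (cis x))"
proof -
  have f' [measurable]: "f \<in> borel_measurable (restrict_space borel (sphere 0 1))"
    using f measurable_cong_sets[OF sets_circle refl] by blast
  have "integral\<^sup>L circle f = (LINT x|density lborel (\<lambda>x. ennreal (indicator {-pi..pi} x / (2 * pi))). f (cis x))"
    unfolding circle_eq_distr_density by (subst integral_distr) auto
  also have "\<dots> = (LINT x|lborel. (indicator {-pi..pi} x / (2 * pi)) *\<^sub>R f (cis x))"
    by (subst integral_density) auto
  also have "\<dots> = (LINT x|lborel. (1 / (2 * pi)) *\<^sub>R (indicator {-pi..pi} x *\<^sub>R f (cis x)))"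
    by (rule Bochner_Integration.integral_cong) auto
  finally show ?thesis
    unfolding set_lebesgue_integral_def by (metis integral_scaleR_right)
qed

lemma AE_circle_iff:
  assumes P: "{z \<in> space circle. P z} \<in> sets circle"
  shows "(AE z in circle. P z) \<longleftrightarrow> (AE x in lborel. x \<in> {-pi..pi} \<longrightarrow> P (cis x))"
proof -
  have "(AE z in circle. P z) \<longleftrightarrow>
      (AE x in density lborel (\<lambda>x. ennreal (indicator {-pi..pi} x / (2 * pi))). P (cis x))"
    using P unfolding circle_eq_distr_density by (subst AE_distr_iff) auto
  also have "\<dots> \<longleftrightarrow> (AE x in lborel. x \<in> {-pi..pi} \<longrightarrow> P (cis x))"
    by (subst AE_density) (auto simp: indicator_def)
  finally show ?thesis .
qed

lemma AE_circle_sphere: "AE z in circle. norm z = 1"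
  using AE_space[of circle] by (rule AE_mp) (auto intro!: AE_I2)

interpretation circle: finite_measure circle
  by (rule finite_measureI) (simp only: emeasure_circle_space, simp)

lemma measure_circle_space: "measure circle (space circle) = 1"
  by (simp only: measure_def emeasure_circle_space) simp

text \<open>Cauchy's integral formula at the centre. Both the orthogonality relations and the M.
  Riesz estimate rest on this evaluation.\<close>

lemma integral_circle_mean_value:
  assumes cont: "continuous_on (cball 0 1) f" and hol: "f holomorphic_on ball 0 1"
  shows "integral\<^sup>L circle f = f 0"
proof -
  have mf: "f \<in> borel_measurable circle"
    unfolding measurable_cong_sets[OF sets_circle refl]
    by (rule borel_measurable_continuous_on_restrict) (rule continuous_on_subset[OF cont], auto)
  have contc: "continuous_on UNIV (\<lambda>x. f (cis x))"
    by (rule continuous_on_compose2[OF cont]) (auto intro!: continuous_intros)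
  \<comment> \<open>\<open>circlepath\<close> runs over angles from 0 to 2 pi, whereas
    \<open>circle\<close> is built on the interval from -pi to pi. Since
    \<open>cis (t - pi) = - cis t\<close>, the formula for the reflected function matches after a
    shift by pi.\<close>
  let ?g = "\<lambda>z. f (- z)"
  have "((\<lambda>u. ?g u / (u - 0)) has_contour_integral 2 * of_real pi * \<i> * ?g 0) (circlepath 0 1)"
  proof (rule Cauchy_integral_circlepath)
    show "continuous_on (cball 0 1) ?g"
      by (rule continuous_on_compose2[OF cont]) (auto intro!: continuous_intros)
    have "(f \<circ> uminus) holomorphic_on ball 0 1"
      by (rule holomorphic_on_compose_gen[OF _ hol]) (auto intro!: holomorphic_intros)
    then show "?g holomorphic_on ball 0 1"
      by (simp add: o_def)
  qed auto
  then have "((\<lambda>t. f (- cis t) * \<i>) has_integral 2 * of_real pi * \<i> * f 0) {0..2 * pi}"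
    unfolding circlepath_def by (subst (asm) has_contour_integral_part_circlepath_iff) auto
  from has_integral_mult_right[OF this, of "- \<i>"]
  have "((\<lambda>t. f (- cis t)) has_integral 2 * of_real pi * f 0) {0..2 * pi}"
    by (simp add: algebra_simps)
  moreover have "cis (t + (-pi)) = - cis t" for t
    by (simp add: cis.ctr complex_eq_iff)
  ultimately have "((\<lambda>t. f (cis (t + (-pi)))) has_integral 2 * of_real pi * f 0) {0..2 * pi}"
    by simp
  then have "((\<lambda>t. f (cis t)) has_integral 2 * of_real pi * f 0) {-pi..pi}"
    using has_integral_shift_Icc_real[of "\<lambda>t. f (cis t)" "-pi" _ 0 "2 * pi"]
    by (simp add: o_def add.commute)
  then have "integral {-pi..pi} (\<lambda>t. f (cis t)) = 2 * of_real pi * f 0"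
    by (rule integral_unique)
  moreover have "set_integrable lborel {-pi..pi} (\<lambda>t. f (cis t))"
    by (rule borel_integrable_atLeastAtMost') (rule continuous_on_subset[OF contc], auto)
  ultimately have "(LINT x:{-pi..pi}|lborel. f (cis x)) = 2 * of_real pi * f 0"
    by (simp add: set_borel_integral_eq_integral(2))
  then show ?thesis
    by (simp add: integral_circle[OF mf] scaleR_conv_of_real)
qed

section \<open>Trigonometric polynomials\<close>

text \<open>On the circle \<open>cnj z\<close> is the inverse of \<open>z\<close>, so this is a
  trigonometric polynomial. The extra factor \<open>cnj z\<close> keeps the constant term out of
  \<open>r\<close>: \<open>q\<close> carries the frequencies from 0 upwards and \<open>r\<close>
  those from -1 downwards, so the analytic part can be read off as \<open>poly q\<close>.\<close>

definition trig :: "complex poly \<Rightarrow> complex poly \<Rightarrow> complex \<Rightarrow> complex" where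
  "trig q r z = poly q z + cnj z * poly r (cnj z)"

lemma cnj_mult_self: "norm z = 1 \<Longrightarrow> cnj z * z = 1"
  by (metis complex_norm_square mult.commute of_real_1 power_one)

lemma trig_add: "trig q r z + trig q' r' z = trig (q + q') (r + r') z"
  by (simp add: trig_def algebra_simps)

lemma trig_const_mult: "c * trig q r z = trig (smult c q) (smult c r) z"
  by (simp add: trig_def algebra_simps)

text \<open>Induction on \<open>q\<close>, one factor \<open>z\<close> at a time; such a factor
  raises every frequency by one.\<close>

lemma mixed_product_trig:
  "\<exists>q' r'. \<forall>z. norm z = 1 \<longrightarrow> poly q z * (cnj z * poly r (cnj z)) = trig q' r' z"
proof (induction q)
  case 0
  show ?case by (intro exI[of _ 0]) (simp add: trig_def)
next
  case (pCons a q)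
  then obtain q' r' where *: "\<And>z. norm z = 1 \<Longrightarrow> poly q z * (cnj z * poly r (cnj z)) = trig q' r' z"
    by blast
  \<comment> \<open>\<open>b\<close> sits at frequency -1. After multiplication by \<open>z\<close>
    it is the only coefficient that crosses over, and it becomes the constant term of the analytic
    part.\<close>
  obtain b s where r': "r' = pCons b s" by (cases r')
  have "poly (pCons a q) z * (cnj z * poly r (cnj z)) = trig (pCons b q') (smult a r + s) z"
    if z: "norm z = 1" for z
  proof -
    have "poly (pCons a q) z * (cnj z * poly r (cnj z)) =
        a * (cnj z * poly r (cnj z)) + z * (poly q z * (cnj z * poly r (cnj z)))"
      by (simp add: algebra_simps)
    also have "poly q z * (cnj z * poly r (cnj z)) = trig q' r' z"
      by (rule *[OF z])
    also have "z * trig q' r' z = z * poly q' z + (cnj z * z) * poly r' (cnj z)"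
      by (simp add: trig_def algebra_simps)
    also have "\<dots> = z * poly q' z + b + cnj z * poly s (cnj z)"
      using cnj_mult_self[OF z] by (simp add: r')
    finally show ?thesis by (simp add: trig_def algebra_simps)
  qed
  then show ?case by blast
qed

lemma trig_mult:
  "\<exists>q'' r''. \<forall>z. norm z = 1 \<longrightarrow> trig q r z * trig q' r' z = trig q'' r'' z"
proof -
  obtain q1 r1 where 1: "\<And>z. norm z = 1 \<Longrightarrow> poly q z * (cnj z * poly r' (cnj z)) = trig q1 r1 z"
    using mixed_product_trig by blast
  obtain q2 r2 where 2: "\<And>z. norm z = 1 \<Longrightarrow> poly q' z * (cnj z * poly r (cnj z)) = trig q2 r2 z"
    using mixed_product_trig by blast
  have "trig q r z * trig q' r' z = trig (q * q' + q1 + q2) (r1 + r2 + pCons 0 (r * r')) z"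
    if z: "norm z = 1" for z
  proof -
    have "trig q r z * trig q' r' z = poly q z * poly q' z + poly q z * (cnj z * poly r' (cnj z)) +
        poly q' z * (cnj z * poly r (cnj z)) + cnj z * (cnj z * (poly r (cnj z) * poly r' (cnj z)))"
      unfolding trig_def by (simp add: algebra_simps)
    then show ?thesis
      unfolding 1[OF z] 2[OF z] by (simp add: trig_def algebra_simps)
  qed
  then show ?thesis by blast
qed

lemma cnj_poly_trig: "\<exists>q r. \<forall>z. cnj (poly s z) = trig q r z"
proof (cases s)
  case (pCons a s')
  then have "cnj (poly s z) = trig [:cnj a:] (map_poly cnj s') z" for z
    by (simp add: trig_def)
  then show ?thesis by blast
qed

text \<open>Conjugating the second summand of \<open>trig\<close> leaves its real part unchanged and
  makes it a polynomial in \<open>z\<close>.\<close>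

lemma Re_trig: "Re (trig q r z) = Re (poly (q + pCons 0 (map_poly cnj r)) z)"
  by (simp add: trig_def)

lemma Re_poly_trig: "\<exists>q r. \<forall>z. of_real (Re (poly s z)) = trig q r z"
proof -
  obtain q r where "\<And>z. cnj (poly s z) = trig q r z"
    using cnj_poly_trig by blast
  then have "of_real (2 * Re (poly s z)) = trig (s + q) r z" for z
    using complex_add_cnj[of "poly s z"] by (simp add: trig_def algebra_simps)
  then have "of_real (Re (poly s z)) = trig (smult (1/2) (s + q)) (smult (1/2) r) z" for z
    by (simp add: mult.commute flip: trig_const_mult)
  then show ?thesis by blast
qed

text \<open>Closure under products is the point: a product of real parts is a product of two
  \<open>trig\<close> functions, hence again a \<open>trig\<close> function on the circle, and
  \<open>Re_trig\<close> returns it to the form \<open>Re (poly s z)\<close>.\<close>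

lemma real_polynomial_function_circle:
  assumes "real_polynomial_function f"
  shows "\<exists>s. \<forall>z. norm z = 1 \<longrightarrow> f z = Re (poly s z)"
  using assms
proof induction
  case (linear f)
  \<comment> \<open>A real linear functional is \<open>f 1 * Re z + f \<i> * Im z\<close>, which is
    the real part of \<open>(f 1 - \<i> * f \<i>) * z\<close>.\<close>
  have "f z = Re (poly [:0, Complex (f 1) (- f \<i>):] z)" for z
  proof -
    interpret bounded_linear f by fact
    have "f z = f (Re z *\<^sub>R 1 + Im z *\<^sub>R \<i>)"
      by (rule arg_cong[of _ _ f]) (simp add: complex_eq_iff)
    then show ?thesis by (simp add: add scale)
  qed
  then show ?case by blast
next
  case (const c)
  show ?case by (intro exI[of _ "[:of_real c:]"]) simp
next
  case (add f g)
  then obtain s s' where "\<And>z. norm z = 1 \<Longrightarrow> f z = Re (poly s z)" "\<And>z. norm z = 1 \<Longrightarrow> g z = Re (poly s' z)"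
    by blast
  then show ?case by (intro exI[of _ "s + s'"]) simp
next
  case (mult f g)
  then obtain s s' where s: "\<And>z. norm z = 1 \<Longrightarrow> f z = Re (poly s z)" "\<And>z. norm z = 1 \<Longrightarrow> g z = Re (poly s' z)"
    by blast
  obtain q r where "\<And>z. of_real (Re (poly s z)) = trig q r z"
    using Re_poly_trig by blast
  moreover obtain q' r' where "\<And>z. of_real (Re (poly s' z)) = trig q' r' z"
    using Re_poly_trig by blast
  moreover obtain q'' r'' where "\<And>z. norm z = 1 \<Longrightarrow> trig q r z * trig q' r' z = trig q'' r'' z"
    using trig_mult by blast
  ultimately have "of_real (f z * g z) = trig q'' r'' z" if "norm z = 1" for z
    using s that by (metis of_real_mult)
  then have "f z * g z = Re (trig q'' r'' z)" if "norm z = 1" for z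
    using that by (metis Re_complex_of_real)
  then show ?case unfolding Re_trig by blast
qed

lemma continuous_circle_approx:
  fixes f :: "complex \<Rightarrow> real"
  assumes "continuous_on (sphere 0 1) f" "0 < e"
  obtains s where "\<And>z. norm z = 1 \<Longrightarrow> \<bar>f z - Re (poly s z)\<bar> < e"
proof -
  obtain g where g: "real_polynomial_function g" "\<And>z. z \<in> sphere 0 1 \<Longrightarrow> \<bar>f z - g z\<bar> < e"
    using Stone_Weierstrass_real_polynomial_function[OF _ assms] by auto
  with real_polynomial_function_circle[OF g(1)] show ?thesis
    using that by fastforce
qed

text \<open>Measurability on the line supplies continuous functions of the angle that converge
  almost everywhere. They are truncated, made continuous on the circle and then approximated
  uniformly by Stone-Weierstrass. The uniform bound is what later makes dominated convergence
  available.\<close>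

lemma bounded_measurable_circle_approx:
  fixes v :: "complex \<Rightarrow> real"
  assumes [measurable]: "v \<in> borel_measurable circle" and bound: "\<And>z. \<bar>v z\<bar> \<le> 1"
  obtains s where "\<And>n z. norm z = 1 \<Longrightarrow> \<bar>Re (poly (s n) z)\<bar> \<le> 2"
    "AE z in circle. (\<lambda>n. Re (poly (s n) z)) \<longlonglongrightarrow> v z"
proof -
  have v' [measurable]: "v \<in> borel_measurable (restrict_space borel (sphere 0 1))"
    using assms(1) measurable_cong_sets[OF sets_circle refl] by blast
  have "(\<lambda>x. v (cis x)) \<in> borel_measurable lborel"
    by measurable
  then have "(\<lambda>x. v (cis x)) \<in> borel_measurable (lebesgue_on UNIV)"
    by (simp add: lebesgue_on_UNIV_eq measurable_completion)
  then have "(\<lambda>x. v (cis x)) measurable_on UNIV"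
    by (subst measurable_on_iff_borel_measurable) auto
  then obtain N and g :: "nat \<Rightarrow> real \<Rightarrow> real" where N: "negligible N" and cg: "\<And>n. continuous_on UNIV (g n)"
    and lim: "\<And>x. x \<notin> N \<Longrightarrow> (\<lambda>n. g n x) \<longlonglongrightarrow> v (cis x)"
    unfolding measurable_on_def by auto
  \<comment> \<open>\<open>Arg\<close> jumps at -1. The first factor vanishes there, which restores
    continuity, and at every other point of the circle it equals 1 for large \<open>n\<close>. The
    second factor truncates to the range of \<open>v\<close>.\<close>
  define c where "c = (\<lambda>n z. min 1 (real n * (1 + Re z)) * max (-1) (min 1 (g n (Arg z))))"
  have c_le: "\<bar>c n z\<bar> \<le> min 1 (real n * (1 + Re z))" if "norm z = 1" for n z
  proof -
    have "Re z \<ge> -1"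
      using abs_Re_le_cmod[of z] that by auto
    then have "0 \<le> min 1 (real n * (1 + Re z))"
      by simp
    then have "\<bar>min 1 (real n * (1 + Re z))\<bar> = min 1 (real n * (1 + Re z))"
      by (rule abs_of_nonneg)
    moreover have "\<bar>max (-1) (min 1 (g n (Arg z)))\<bar> \<le> 1"
      by auto
    ultimately show ?thesis
      using \<open>0 \<le> min 1 _\<close> unfolding c_def abs_mult by (simp only: mult_left_le)
  qed
  have cont: "continuous_on (sphere 0 1) (c n)" for n
    unfolding continuous_on_eq_continuous_within
  proof
    fix z :: complex assume z: "z \<in> sphere 0 1"
    show "continuous (at z within sphere 0 1) (c n)"
    proof (cases "z \<in> \<real>\<^sub>\<le>\<^sub>0")
      case False
      have "isCont (g n) (Arg z)"
        using cg[of n] continuous_on_eq_continuous_at[OF open_UNIV] by blast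
      then have "isCont (\<lambda>z. g n (Arg z)) z"
        by (rule isCont_o2[OF continuous_at_Arg[OF False]])
      moreover have "isCont Re z"
        by (rule bounded_linear.isCont[OF bounded_linear_Re]) simp
      moreover have "c n = (\<lambda>z. min 1 (real n * (1 + Re z)) * max (-1) (min 1 (g n (Arg z))))"
        by (simp add: c_def)
      ultimately have "isCont (c n) z"
        by (auto intro!: continuous_intros)
      then show ?thesis
        by (rule continuous_at_imp_continuous_within)
    next
      case True
      then have "z = -1"
        using z by (auto simp: complex_nonpos_Reals_iff complex_eq_iff cmod_def)
      have "((c n) \<longlongrightarrow> 0) (at z within sphere 0 1)"
      proof (rule Lim_null_comparison)
        show "\<forall>\<^sub>F x in at z within sphere 0 1. norm (c n x) \<le> min 1 (real n * (1 + Re x))"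
          unfolding eventually_at_filter
          by (rule always_eventually) (use c_le in auto)
        have "((\<lambda>x. min 1 (real n * (1 + Re x))) \<longlongrightarrow> min 1 (real n * (1 + Re z))) (at z within sphere 0 1)"
          by (intro tendsto_intros)
        then show "((\<lambda>x. min 1 (real n * (1 + Re x))) \<longlongrightarrow> 0) (at z within sphere 0 1)"
          by (simp add: \<open>z = -1\<close>)
      qed
      moreover have "c n z = 0"
        by (simp add: c_def \<open>z = -1\<close>)
      ultimately show ?thesis
        by (simp add: continuous_within)
    qed
  qed
  \<comment> \<open>The error tends to 0; being at most 1, it adds to the bound 1 for
    \<open>c n\<close> and gives the bound 2 of the conclusion.\<close>
  have "\<exists>s. \<forall>z. norm z = 1 \<longrightarrow> \<bar>c n z - Re (poly s z)\<bar> < 1 / real (Suc n)" for n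
    by (rule continuous_circle_approx[OF cont, of "1 / real (Suc n)" n]) auto
  then obtain s where s: "\<And>n z. norm z = 1 \<Longrightarrow> \<bar>c n z - Re (poly (s n) z)\<bar> < 1 / real (Suc n)"
    by metis
  show thesis
  proof (rule that)
    fix n and z :: complex assume z: "norm z = 1"
    have "1 / real (Suc n) \<le> 1" by simp
    with s[OF z, of n] c_le[OF z, of n] show "\<bar>Re (poly (s n) z)\<bar> \<le> 2"
      by linarith
  next
    have *: "(\<lambda>n. Re (poly (s n) (cis x))) \<longlonglongrightarrow> v (cis x)" if x: "x \<in> {-pi<..<pi}" "x \<notin> N" for x
    proof -
      have "cis x \<noteq> -1"
        using x Arg_cis[of x] Arg_cis[of pi] by auto
      then have Re: "0 < 1 + Re (cis x)"
      proof -
        have "-1 \<le> cos x" by simp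
        moreover have "cos x \<noteq> -1"
        proof
          assume *: "cos x = -1"
          then have "sin x = 0" using sin_cos_squared_add[of x] by simp
          with * \<open>cis x \<noteq> -1\<close> show False by (simp add: complex_eq_iff)
        qed
        ultimately have "-1 < cos x" by linarith
        then show ?thesis by simp
      qed
      have "filterlim (\<lambda>n. real n * (1 + Re (cis x))) at_top sequentially"
        by (rule filterlim_at_top_mult_tendsto_pos[OF tendsto_const Re filterlim_real_sequentially])
      then have "\<forall>\<^sub>F n in sequentially. 1 \<le> real n * (1 + Re (cis x))"
        by (simp add: filterlim_at_top)
      then have "\<forall>\<^sub>F n in sequentially. c n (cis x) = max (-1) (min 1 (g n x))"
        by eventually_elim (use x in \<open>simp add: c_def Arg_cis min_absorb1\<close>)
      moreover have "(\<lambda>n. max (-1) (min 1 (g n x))) \<longlonglongrightarrow> max (-1) (min 1 (v (cis x)))"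
        by (intro tendsto_intros lim x)
      moreover have "max (-1) (min 1 (v (cis x))) = v (cis x)"
        using bound[of "cis x"] by (auto simp: abs_le_iff)
      ultimately have 1: "(\<lambda>n. c n (cis x)) \<longlonglongrightarrow> v (cis x)"
        by (simp add: tendsto_cong)
      have "(\<lambda>n. Re (poly (s n) (cis x)) - c n (cis x)) \<longlonglongrightarrow> 0"
      proof (rule Lim_null_comparison)
        show "\<forall>\<^sub>F n in sequentially. norm (Re (poly (s n) (cis x)) - c n (cis x)) \<le> 1 / real (Suc n)"
          using s[of "cis x"] by (intro always_eventually) (simp add: abs_minus_commute less_imp_le)
      qed (rule LIMSEQ_Suc[OF lim_1_over_n])
      from tendsto_add[OF this 1] show ?thesis by simp
    qed
    have [measurable]: "(\<lambda>z. Re (poly (s n) z)) \<in> borel_measurable circle" for n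
      by (intro borel_measurable_circleI borel_measurable_continuous_onI continuous_intros)
    have "AE x in lebesgue. x \<notin> N"
      using N by (intro AE_not_in) (simp add: negligible_iff_null_sets)
    then have "AE x in lborel. x \<notin> N"
      by (simp add: AE_completion_iff)
    moreover have "AE x in lborel. x \<noteq> pi" "AE x in lborel. x \<noteq> - pi"
      by (rule AE_lborel_singleton)+
    ultimately have "AE x in lborel. x \<in> {-pi..pi} \<longrightarrow> (\<lambda>n. Re (poly (s n) (cis x))) \<longlonglongrightarrow> v (cis x)"
      by eventually_elim (use * in auto)
    then show "AE z in circle. (\<lambda>n. Re (poly (s n) z)) \<longlonglongrightarrow> v z"
      by (subst AE_circle_iff) measurable
  qed
qed

section \<open>M. Riesz's inequality for trigonometric polynomials\<close>

lemma integrable_circle_continuous: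
  fixes f :: "complex \<Rightarrow> 'b :: {banach, second_countable_topology}"
  assumes f: "continuous_on (sphere 0 1) f"
  shows "integrable circle f"
proof -
  have "compact (f ` sphere 0 1)"
    by (rule compact_continuous_image[OF f]) auto
  then obtain B where "\<And>z. z \<in> sphere 0 1 \<Longrightarrow> norm (f z) \<le> B"
    by (meson bounded_iff compact_imp_bounded imageI)
  moreover have "f \<in> borel_measurable circle"
    unfolding measurable_cong_sets[OF sets_circle refl]
    by (rule borel_measurable_continuous_on_restrict[OF f])
  ultimately show ?thesis
    by (intro circle.integrable_const_bound[of f B]) (auto intro!: AE_I2)
qed

lemma continuous_on_norm_powr:
  fixes f :: "'a :: topological_space \<Rightarrow> 'b :: real_normed_vector"
  assumes "continuous_on S f" "0 < p"
  shows "continuous_on S (\<lambda>z. norm (f z) powr p)"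
  by (rule continuous_on_powr') (use assms in \<open>auto intro!: continuous_intros\<close>)

lemma continuous_on_trig: "continuous_on S (trig q r)"
  unfolding trig_def by (intro continuous_intros continuous_on_poly)

text \<open>From \<open>a + b \<le> 2 * max a b\<close>. Estimates below are made for p-th powers of
  norms with this factor \<open>2 powr p\<close> in place of Minkowski's inequality, since only the
  existence of constants matters.\<close>

lemma powr_add_le:
  fixes a b p :: real
  assumes "0 \<le> a" "0 \<le> b" "0 \<le> p"
  shows "(a + b) powr p \<le> 2 powr p * (a powr p + b powr p)"
proof -
  have "(a + b) powr p \<le> (2 * max a b) powr p"
    using assms by (intro powr_mono2) auto
  also have "\<dots> = 2 powr p * max a b powr p"
    using assms by (intro powr_mult)
  also have "max a b powr p \<le> a powr p + b powr p"
    by (auto simp: max_def)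
  finally show ?thesis by simp
qed

lemma norm_add_powr_le:
  fixes x y :: "'a :: real_normed_vector"
  assumes "0 \<le> p"
  shows "norm (x + y) powr p \<le> 2 powr p * (norm x powr p + norm y powr p)"
proof -
  have "norm (x + y) powr p \<le> (norm x + norm y) powr p"
    using assms by (intro powr_mono2 norm_triangle_ineq) auto
  also have "\<dots> \<le> 2 powr p * (norm x powr p + norm y powr p)"
    using assms by (intro powr_add_le) auto
  finally show ?thesis .
qed

lemma norm_diff_powr_le:
  fixes x y :: "'a :: real_normed_vector"
  assumes "0 \<le> p"
  shows "norm (x - y) powr p \<le> 2 powr p * (norm x powr p + norm y powr p)"
  using norm_add_powr_le[OF assms, of x "- y"] by simp

text \<open>Here \<open>exp (p * Ln z)\<close> is the p-th power of \<open>z\<close>, with real part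
  \<open>norm z powr p * cos (p * \<theta>)\<close>, where \<open>\<theta>\<close> is the absolute
  value of the argument. Near the imaginary axis this cosine is negative and the term with
  \<open>B\<close> pays for \<open>norm z powr p\<close>; in a smaller sector \<open>Re z\<close> is
  comparable to \<open>norm z\<close> and the term with \<open>A\<close> pays.\<close>

lemma exp_Ln_half_plane_bound:
  assumes p: "1 < p" "p \<le> 2"
  obtains A B where "0 < A" "0 < B"
    "\<And>z. 0 < Re z \<Longrightarrow> norm z powr p \<le> A * Re z powr p - B * Re (exp (of_real p * Ln z))"
proof -
  \<comment> \<open>The angle separating the two sectors, halfway between
    \<open>pi / (2 * p)\<close> and \<open>pi / 2\<close>, so that \<open>p * \<gamma>\<close> lies
    strictly between \<open>pi / 2\<close> and \<open>pi\<close>. The assumption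
    \<open>p \<le> 2\<close> keeps \<open>p * \<theta>\<close> below \<open>pi\<close>, where the
    cosine is decreasing.\<close>
  define \<gamma> where "\<gamma> = (pi / (2 * p) + pi / 2) / 2"
  have "pi / (2 * p) < pi / 2"
    using p by (intro divide_strict_left_mono) auto
  then have \<gamma>: "pi / (2 * p) < \<gamma>" "\<gamma> < pi / 2"
    by (auto simp: \<gamma>_def)
  then have p\<gamma>: "pi / 2 < p * \<gamma>"
    using p by (simp add: field_simps)
  have "p * \<gamma> < p * (pi / 2)"
    using p \<gamma> by (intro mult_strict_left_mono) auto
  also have p2: "p * (pi / 2) \<le> pi"
    using p by (simp add: field_simps)
  finally have "p * \<gamma> < pi" .
  have "0 < cos (p * \<gamma> - pi)"
    using p\<gamma> \<open>p * \<gamma> < pi\<close> by (intro cos_gt_zero_pi) auto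
  then have \<delta>: "0 < - cos (p * \<gamma>)"
    by (simp add: cos_diff)
  define B where "B = 1 / (- cos (p * \<gamma>))"
  have B: "0 < B" using \<delta> by (simp add: B_def)
  have "0 < pi / (2 * p)" using p by simp
  then have \<gamma>0: "0 < \<gamma>" using \<gamma> by linarith
  have cg: "0 < cos \<gamma>"
    using \<gamma> \<gamma>0 by (intro cos_gt_zero_pi) auto
  \<comment> \<open>In the inner sector the term with \<open>B\<close> may have the wrong sign and
    cost up to \<open>B * norm z powr p\<close>; \<open>A\<close> covers this and the required
    1.\<close>
  define A where "A = (1 + B) / cos \<gamma> powr p"
  have A: "0 < A" using B cg by (simp add: A_def)
  show thesis
  proof (rule that[OF A B])
    fix z :: complex assume z: "0 < Re z"
    then have z0: "z \<noteq> 0" by auto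
    define \<theta> where "\<theta> = \<bar>Im (Ln z)\<bar>"
    have \<theta>: "0 \<le> \<theta>" "\<theta> < pi / 2"
      using Re_Ln_pos_lt[OF z0] z by (auto simp: \<theta>_def)
    have "exp (Ln z) = z" using z0 by simp
    then have "Re z = exp (Re (Ln z)) * cos (Im (Ln z))"
      by (metis Re_exp)
    then have Rez: "Re z = norm z * cos \<theta>"
      using z0 by (auto simp: \<theta>_def abs_if)
    have "Re (exp (of_real p * Ln z)) = exp (p * ln (norm z)) * cos (p * Im (Ln z))"
      using z0 by (simp add: Re_exp)
    also have "\<dots> = norm z powr p * cos (p * \<theta>)"
      using z0 by (auto simp: \<theta>_def abs_if powr_def)
    finally have Re_powr: "Re (exp (of_real p * Ln z)) = norm z powr p * cos (p * \<theta>)" .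
    show "norm z powr p \<le> A * Re z powr p - B * Re (exp (of_real p * Ln z))"
    proof (cases "\<gamma> \<le> \<theta>")
      case True
      have "p * \<theta> \<le> p * (pi / 2)" "p * \<gamma> \<le> p * \<theta>"
        using p \<theta> True by (auto intro!: mult_left_mono)
      then have "cos (p * \<theta>) \<le> cos (p * \<gamma>)"
        using p2 \<gamma>0 p by (intro cos_monotone_0_pi_le) (linarith | simp)+
      then have "1 \<le> - B * cos (p * \<theta>)"
        using \<delta> by (simp add: B_def field_simps)
      then have "norm z powr p * 1 \<le> norm z powr p * (- B * cos (p * \<theta>))"
        by (intro mult_left_mono) auto
      moreover have "0 \<le> A * Re z powr p" using A by simp
      ultimately show ?thesis by (simp add: Re_powr algebra_simps)
    next
      case False
      then have "cos \<gamma> \<le> cos \<theta>"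
        using \<theta> \<gamma> by (intro cos_monotone_0_pi_le) auto
      then have "cos \<gamma> powr p \<le> cos \<theta> powr p"
        using cg p by (intro powr_mono2) auto
      then have "(1 + B) * cos \<gamma> powr p \<le> (1 + B) * cos \<theta> powr p"
        using B by (intro mult_left_mono) auto
      then have "1 + B \<le> A * cos \<theta> powr p"
        using cg by (simp add: A_def pos_le_divide_eq)
      moreover have "B * cos (p * \<theta>) \<le> B * 1"
        using B by (intro mult_left_mono) auto
      ultimately have "1 \<le> A * cos \<theta> powr p - B * cos (p * \<theta>)"
        by linarith
      then have "norm z powr p * 1 \<le> norm z powr p * (A * cos \<theta> powr p - B * cos (p * \<theta>))"
        by (intro mult_left_mono) auto
      moreover have "Re z powr p = norm z powr p * cos \<theta> powr p"
        using \<theta> by (simp add: Rez powr_mult cos_ge_zero)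
      ultimately show ?thesis by (simp add: Re_powr algebra_simps)
    qed
  qed
qed

lemma holomorphic_on_poly [holomorphic_intros]:
  assumes "f holomorphic_on S"
  shows "(\<lambda>z. poly s (f z)) holomorphic_on S"
proof -
  have "poly s holomorphic_on UNIV"
    unfolding holomorphic_on_def field_differentiable_def
    by (blast intro: poly_DERIV has_field_derivative_at_within)
  then show ?thesis
    using holomorphic_on_compose_gen[OF assms, of "poly s" UNIV] by (simp add: o_def)
qed

text \<open>Maximum principle for the real part of \<open>- poly s\<close>. Strictness survives
  because the minimum over the circle is attained.\<close>

lemma poly_Re_pos_disc:
  assumes "\<And>z. norm z = 1 \<Longrightarrow> 0 < Re (poly s z)" and w: "norm w \<le> 1"
  shows "0 < Re (poly s w)"
proof -
  have "continuous_on (sphere 0 1) (\<lambda>z. Re (poly s z))"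
    by (intro continuous_intros continuous_on_poly)
  moreover have "sphere 0 1 \<noteq> ({} :: complex set)" "compact (sphere 0 1 :: complex set)"
    by auto
  ultimately obtain z0 :: complex where z0: "z0 \<in> sphere 0 1"
      "\<And>z. z \<in> sphere 0 1 \<Longrightarrow> Re (poly s z0) \<le> Re (poly s z)"
    using continuous_attains_inf[of "sphere 0 1"] by metis
  have "Re (- poly s w) \<le> - Re (poly s z0)"
  proof (rule maximum_real_frontier[where S = "cball 0 1" and f = "\<lambda>z. - poly s z"])
    show "(\<lambda>z. - poly s z) holomorphic_on interior (cball 0 1)"
      by (intro holomorphic_intros)
    show "continuous_on (closure (cball 0 1)) (\<lambda>z. - poly s z)"
      by (intro continuous_intros continuous_on_poly)
  qed (use z0 w in auto)
  moreover have "0 < Re (poly s z0)" using assms z0 by auto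
  ultimately show ?thesis by simp
qed

text \<open>Integrate the pointwise bound with \<open>z\<close> replaced by \<open>poly s z\<close>.
  The p-th power of \<open>poly s\<close> is holomorphic on the disc, so its mean is its value at 0,
  which is the real number \<open>Re (poly s 0) powr p\<close> because the imaginary part at 0
  vanishes.\<close>

lemma riesz_pos_real_part:
  assumes p: "1 < p" "p \<le> 2"
  obtains C where "0 < C"
    "\<And>s. \<lbrakk>\<And>z. norm z = 1 \<Longrightarrow> 0 < Re (poly s z); Im (poly s 0) = 0\<rbrakk> \<Longrightarrow>
        (\<integral>z. norm (poly s z) powr p \<partial>circle) \<le> C * (\<integral>z. Re (poly s z) powr p \<partial>circle) \<and>
        Re (poly s 0) powr p \<le> C * (\<integral>z. Re (poly s z) powr p \<partial>circle)"
proof -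
  obtain A B where A: "0 < A" and B: "0 < B" and AB:
    "\<And>z. 0 < Re z \<Longrightarrow> norm z powr p \<le> A * Re z powr p - B * Re (exp (of_real p * Ln z))"
    using exp_Ln_half_plane_bound[OF p] by blast
  show thesis
  proof (rule that)
    \<comment> \<open>\<open>A\<close> serves the estimate of the norm, \<open>A / B\<close> that of
      the value at 0; the sum serves both.\<close>
    show "0 < A + A / B" using A B by (simp add: add_pos_pos)
    fix s :: "complex poly"
    assume pos: "\<And>z. norm z = 1 \<Longrightarrow> 0 < Re (poly s z)" and Im0: "Im (poly s 0) = 0"
    let ?X = "\<integral>z. norm (poly s z) powr p \<partial>circle" and ?Y = "\<integral>z. Re (poly s z) powr p \<partial>circle"
    define f where "f = (\<lambda>z. exp (of_real p * Ln (poly s z)))"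
    have pos': "0 < Re (poly s z)" if "norm z \<le> 1" for z
      using poly_Re_pos_disc[OF pos that] .
    then have slit: "poly s z \<notin> \<real>\<^sub>\<le>\<^sub>0" if "norm z \<le> 1" for z
      using that by (force simp: complex_nonpos_Reals_iff)
    have cf: "continuous_on (cball 0 1) f"
      unfolding f_def using slit
      by (intro continuous_intros continuous_on_poly) auto
    have hf: "f holomorphic_on ball 0 1"
      unfolding f_def using slit
      by (intro holomorphic_intros) auto
    have "integral\<^sup>L circle f = f 0"
      by (rule integral_circle_mean_value[OF cf hf])
    moreover have "poly s 0 = of_real (Re (poly s 0))"
      using Im0 by (simp add: complex_eq_iff)
    then have "f 0 = of_real (Re (poly s 0) powr p)"
      using pos'[of 0] unfolding f_def
      by (metis Ln_of_real exp_of_real less_numeral_extra(3) norm_zero of_real_mult powr_def zero_le_one)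
    ultimately have mean: "integral\<^sup>L circle f = of_real (Re (poly s 0) powr p)"
      by simp
    have int_f: "integrable circle f"
      by (rule integrable_circle_continuous) (rule continuous_on_subset[OF cf], auto)
    have cs: "continuous_on (sphere 0 1) (poly s)"
      by (intro continuous_intros continuous_on_poly)
    have int_X: "integrable circle (\<lambda>z. norm (poly s z) powr p)"
      using p by (intro integrable_circle_continuous continuous_on_norm_powr cs) auto
    have int_Y: "integrable circle (\<lambda>z. Re (poly s z) powr p)"
      using p pos by (intro integrable_circle_continuous continuous_on_powr' continuous_intros cs) force+
    have "?X \<le> (\<integral>z. A * Re (poly s z) powr p - B * Re (f z) \<partial>circle)"
      using int_X int_Y int_f
      by (intro integral_mono) (auto simp: f_def intro!: AB pos)
    also have "\<dots> = A * ?Y - B * Re (poly s 0) powr p"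
      using int_Y int_f mean by simp
    finally have 1: "?X \<le> A * ?Y - B * Re (poly s 0) powr p" .
    have X0: "0 \<le> ?X" and Y0: "0 \<le> ?Y" by (auto intro!: integral_nonneg_AE)
    have "?X \<le> A * ?Y" using 1 B by (smt (verit) mult_nonneg_nonneg powr_ge_zero)
    also have "\<dots> \<le> (A + A / B) * ?Y" using A B Y0 by (intro mult_right_mono) auto
    finally have 2: "?X \<le> (A + A / B) * ?Y" .
    have "B * Re (poly s 0) powr p \<le> A * ?Y"
      using 1 X0 by linarith
    then have "Re (poly s 0) powr p \<le> A / B * ?Y"
      using B by (simp add: field_simps)
    also have "\<dots> \<le> (A + A / B) * ?Y" using A B Y0 by (intro mult_right_mono) auto
    finally show "?X \<le> (A + A / B) * ?Y \<and> Re (poly s 0) powr p \<le> (A + A / B) * ?Y"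
      using 2 by simp
  qed
qed

text \<open>A real part \<open>u\<close> of arbitrary sign is the difference of the positive
  functions \<open>\<bar>u\<bar>\<close> and \<open>\<bar>u\<bar> - u\<close>, up to a small
  perturbation that makes them real parts of polynomials. Subtracting the imaginary part at 0
  normalises the conjugate function.\<close>

lemma riesz_real_part:
  assumes p: "1 < p" "p \<le> 2"
  obtains C where "0 < C"
    "\<And>s. (\<integral>z. norm (poly s z - \<i> * Im (poly s 0)) powr p \<partial>circle) \<le> C * (\<integral>z. \<bar>Re (poly s z)\<bar> powr p \<partial>circle) \<and>
        \<bar>Re (poly s 0)\<bar> powr p \<le> C * (\<integral>z. \<bar>Re (poly s z)\<bar> powr p \<partial>circle)"
proof -
  obtain C where C: "0 < C" and riesz:
    "\<And>s. \<lbrakk>\<And>z. norm z = 1 \<Longrightarrow> 0 < Re (poly s z); Im (poly s 0) = 0\<rbrakk> \<Longrightarrow>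
        (\<integral>z. norm (poly s z) powr p \<partial>circle) \<le> C * (\<integral>z. Re (poly s z) powr p \<partial>circle) \<and>
        Re (poly s 0) powr p \<le> C * (\<integral>z. Re (poly s z) powr p \<partial>circle)"
    using riesz_pos_real_part[OF p] by metis
  define K where "K = 2 powr p * (2 * C * 2 powr p)"
  have K: "0 < K" using C by (simp add: K_def)
  have main: "(\<integral>z. norm (poly s z - \<i> * Im (poly s 0)) powr p \<partial>circle)
        \<le> K * (2 powr p * (\<integral>z. \<bar>Re (poly s z)\<bar> powr p \<partial>circle) + e) \<and>
      \<bar>Re (poly s 0)\<bar> powr p \<le> K * (2 powr p * (\<integral>z. \<bar>Re (poly s z)\<bar> powr p \<partial>circle) + e)"
    if e: "0 < e" for s e
  proof -
    \<comment> \<open>\<open>G\<close> will have real part between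
      \<open>\<bar>u\<bar> + \<delta>\<close> and \<open>\<bar>u\<bar> + 3 * \<delta>\<close>; the
      choice makes \<open>(3 * \<delta>) powr p\<close> equal to \<open>e\<close>.\<close>
    define \<delta> where "\<delta> = e powr (1 / p) / 3"
    have \<delta>: "0 < \<delta>" "(3 * \<delta>) powr p = e"
      using e p by (auto simp: \<delta>_def powr_powr)
    have cs: "continuous_on S (poly s)" for s :: "complex poly" and S
      by (intro continuous_intros continuous_on_poly)
    obtain G where G: "\<And>z. norm z = 1 \<Longrightarrow> \<bar>(\<bar>Re (poly s z)\<bar> + 2 * \<delta>) - Re (poly G z)\<bar> < \<delta>"
      by (rule continuous_circle_approx[of "\<lambda>z. \<bar>Re (poly s z)\<bar> + 2 * \<delta>" \<delta>])
        (use \<delta> in \<open>auto intro!: continuous_intros cs\<close>)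
    define g1 where "g1 = G - [:\<i> * Im (poly G 0):]"
    \<comment> \<open>Chosen so that \<open>g1 - g2\<close> is the normalised \<open>s\<close>, with
      both real parts positive on the circle and both imaginary parts zero at 0.\<close>
    define g2 where "g2 = g1 - (s - [:\<i> * Im (poly s 0):])"
    have Re1: "Re (poly g1 z) = Re (poly G z)" for z by (simp add: g1_def)
    have Re2: "Re (poly g2 z) = Re (poly G z) - Re (poly s z)" for z by (simp add: g2_def Re1)
    have Im0: "Im (poly g1 0) = 0" "Im (poly g2 0) = 0"
      by (simp_all add: g1_def g2_def)
    have pos: "0 < Re (poly g1 z)" "0 < Re (poly g2 z)"
      and up: "Re (poly g1 z) \<le> 2 * \<bar>Re (poly s z)\<bar> + 3 * \<delta>" "Re (poly g2 z) \<le> 2 * \<bar>Re (poly s z)\<bar> + 3 * \<delta>"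
      if z: "norm z = 1" for z
      using G[OF z] \<delta> unfolding Re1 Re2 by linarith+
    let ?N = "\<integral>z. \<bar>Re (poly s z)\<bar> powr p \<partial>circle"
    have int_s: "integrable circle (\<lambda>z. \<bar>Re (poly s z)\<bar> powr p)"
      using p by (intro integrable_circle_continuous continuous_on_norm_powr[where f = "\<lambda>z. Re (poly s z)", simplified]
          continuous_intros cs) auto
    have Y: "(\<integral>z. Re (poly g z) powr p \<partial>circle) \<le> 2 powr p * (2 powr p * ?N + e)"
      if g: "\<And>z. norm z = 1 \<Longrightarrow> 0 < Re (poly g z)"
        "\<And>z. norm z = 1 \<Longrightarrow> Re (poly g z) \<le> 2 * \<bar>Re (poly s z)\<bar> + 3 * \<delta>" for g
    proof -
      have "(\<integral>z. Re (poly g z) powr p \<partial>circle)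
          \<le> (\<integral>z. 2 powr p * (2 powr p * \<bar>Re (poly s z)\<bar> powr p + e) \<partial>circle)"
      proof (rule integral_mono)
        show "integrable circle (\<lambda>z. Re (poly g z) powr p)"
          using p g(1) by (intro integrable_circle_continuous continuous_on_powr' continuous_intros cs) force+
        show "integrable circle (\<lambda>z. 2 powr p * (2 powr p * \<bar>Re (poly s z)\<bar> powr p + e))"
          using int_s by simp
        fix z assume "z \<in> space circle"
        then have z: "norm z = 1" by simp
        have "Re (poly g z) powr p \<le> (2 * \<bar>Re (poly s z)\<bar> + 3 * \<delta>) powr p"
          using g[OF z] p by (intro powr_mono2) auto
        also have "\<dots> \<le> 2 powr p * ((2 * \<bar>Re (poly s z)\<bar>) powr p + (3 * \<delta>) powr p)"
          using p \<delta> by (intro powr_add_le) auto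
        finally show "Re (poly g z) powr p \<le> 2 powr p * (2 powr p * \<bar>Re (poly s z)\<bar> powr p + e)"
          unfolding \<delta>(2) by (simp add: powr_mult)
      qed
      also have "\<dots> = 2 powr p * (2 powr p * ?N + e)"
        using int_s measure_circle_space by simp
      finally show ?thesis .
    qed
    define D where "D = 2 powr p * (2 powr p * ?N + e)"
    have R1: "(\<integral>z. norm (poly g1 z) powr p \<partial>circle) \<le> C * D" "Re (poly g1 0) powr p \<le> C * D"
      using riesz[of g1, OF pos(1) Im0(1)] Y[of g1, OF pos(1) up(1)] C unfolding D_def
      by (meson mult_left_mono less_imp_le order_trans)+
    have R2: "(\<integral>z. norm (poly g2 z) powr p \<partial>circle) \<le> C * D" "Re (poly g2 0) powr p \<le> C * D"
      using riesz[of g2, OF pos(2) Im0(2)] Y[of g2, OF pos(2) up(2)] C unfolding D_def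
      by (meson mult_left_mono less_imp_le order_trans)+
    have int_g: "integrable circle (\<lambda>z. norm (poly g z) powr p)" for g :: "complex poly"
      using p by (intro integrable_circle_continuous continuous_on_norm_powr cs) auto
    have "(\<integral>z. norm (poly s z - \<i> * Im (poly s 0)) powr p \<partial>circle)
        \<le> (\<integral>z. 2 powr p * (norm (poly g1 z) powr p + norm (poly g2 z) powr p) \<partial>circle)"
    proof (rule integral_mono)
      show "integrable circle (\<lambda>z. norm (poly s z - \<i> * Im (poly s 0)) powr p)"
        using int_g[of "s - [:\<i> * Im (poly s 0):]"] by simp
      show "integrable circle (\<lambda>z. 2 powr p * (norm (poly g1 z) powr p + norm (poly g2 z) powr p))"
        using int_g by simp
      show "norm (poly s z - \<i> * Im (poly s 0)) powr p
          \<le> 2 powr p * (norm (poly g1 z) powr p + norm (poly g2 z) powr p)" for z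
        using norm_diff_powr_le[of p "poly g1 z" "poly g2 z"] p by (simp add: g2_def)
    qed
    also have "\<dots> = 2 powr p * ((\<integral>z. norm (poly g1 z) powr p \<partial>circle) + (\<integral>z. norm (poly g2 z) powr p \<partial>circle))"
      using int_g by simp
    also have "\<dots> \<le> 2 powr p * (C * D + C * D)"
      using R1 R2 by (intro mult_left_mono add_mono) auto
    finally have 1: "(\<integral>z. norm (poly s z - \<i> * Im (poly s 0)) powr p \<partial>circle) \<le> 2 powr p * (C * D + C * D)" .
    have "\<bar>Re (poly s 0)\<bar> powr p = norm (Re (poly g1 0) - Re (poly g2 0)) powr p"
      by (simp add: Re1 Re2)
    also have "\<dots> \<le> 2 powr p * (norm (Re (poly g1 0)) powr p + norm (Re (poly g2 0)) powr p)"
      using p by (intro norm_diff_powr_le) auto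
    also have "norm (Re (poly g1 0)) = Re (poly g1 0)"
      using poly_Re_pos_disc[of g1 0] pos(1) by simp
    also have "norm (Re (poly g2 0)) = Re (poly g2 0)"
      using poly_Re_pos_disc[of g2 0] pos(2) by simp
    also have "2 powr p * (Re (poly g1 0) powr p + Re (poly g2 0) powr p) \<le> 2 powr p * (C * D + C * D)"
      using R1 R2 by (intro mult_left_mono add_mono) auto
    finally show ?thesis
      using 1 by (simp add: D_def K_def algebra_simps)
  qed
  show thesis
  proof (rule that)
    show "0 < K * 2 powr p" using K by simp
    fix s :: "complex poly"
    have lim: "X \<le> K * 2 powr p * Y" if "\<And>e. 0 < e \<Longrightarrow> X \<le> K * (2 powr p * Y + e)" for X Y
    proof (rule field_le_epsilon)
      fix e :: real assume "0 < e"
      moreover have "K * (2 powr p * Y + e / K) = K * 2 powr p * Y + e"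
        using K by (simp add: field_simps)
      ultimately show "X \<le> K * 2 powr p * Y + e"
        using that[of "e / K"] K by simp
    qed
    show "(\<integral>z. norm (poly s z - \<i> * Im (poly s 0)) powr p \<partial>circle)
        \<le> K * 2 powr p * (\<integral>z. \<bar>Re (poly s z)\<bar> powr p \<partial>circle) \<and>
      \<bar>Re (poly s 0)\<bar> powr p \<le> K * 2 powr p * (\<integral>z. \<bar>Re (poly s z)\<bar> powr p \<partial>circle)"
      using main[of _ s] by (blast intro: lim)
  qed
qed

text \<open>The real and imaginary parts of \<open>trig q r\<close> are real parts of analytic
  polynomials \<open>s1\<close> and \<open>s2\<close>, and \<open>s1 + \<i> * s2 = 2 * q\<close>. So
  the estimate for real parts bounds \<open>q\<close>.\<close>

lemma riesz_trig_le_2: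
  assumes p: "1 < p" "p \<le> 2"
  shows "\<exists>C>0. \<forall>q r. (\<integral>z. norm (poly q z) powr p \<partial>circle) \<le> C * (\<integral>z. norm (trig q r z) powr p \<partial>circle)"
proof -
  obtain C where C: "0 < C" and riesz:
    "\<And>s. (\<integral>z. norm (poly s z - \<i> * Im (poly s 0)) powr p \<partial>circle) \<le> C * (\<integral>z. \<bar>Re (poly s z)\<bar> powr p \<partial>circle) \<and>
        \<bar>Re (poly s 0)\<bar> powr p \<le> C * (\<integral>z. \<bar>Re (poly s z)\<bar> powr p \<partial>circle)"
    using riesz_real_part[OF p] by metis
  have "(\<integral>z. norm (poly q z) powr p \<partial>circle)
      \<le> 2 powr p * (2 powr p * (4 * C)) * (\<integral>z. norm (trig q r z) powr p \<partial>circle)" for q r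
  proof -
    define s1 where "s1 = q + pCons 0 (map_poly cnj r)"
    define s2 where "s2 = smult (- \<i>) q + pCons 0 (map_poly cnj (smult (- \<i>) r))"
    have Re1: "Re (poly s1 z) = Re (trig q r z)" for z
      unfolding s1_def Re_trig ..
    have Re2: "Re (poly s2 z) = Im (trig q r z)" for z
    proof -
      have "Re (poly s2 z) = Re (- \<i> * trig q r z)"
        unfolding s2_def trig_const_mult Re_trig ..
      then show ?thesis by simp
    qed
    let ?N = "\<integral>z. norm (trig q r z) powr p \<partial>circle"
    have cs: "continuous_on S (poly s)" for s :: "complex poly" and S
      by (intro continuous_intros continuous_on_poly)
    have int_g: "integrable circle (\<lambda>z. norm (poly g z) powr p)" for g :: "complex poly"
      using p by (intro integrable_circle_continuous continuous_on_norm_powr cs) auto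
    have int_R: "integrable circle (\<lambda>z. \<bar>Re (poly g z)\<bar> powr p)" for g :: "complex poly"
      using p by (intro integrable_circle_continuous continuous_on_norm_powr[where f = "\<lambda>z. Re (poly g z)", simplified]
          continuous_intros cs) auto
    have int_t: "integrable circle (\<lambda>z. norm (trig q r z) powr p)"
      using p by (intro integrable_circle_continuous continuous_on_norm_powr continuous_on_trig) auto
    have "(\<integral>z. \<bar>Re (poly s1 z)\<bar> powr p \<partial>circle) \<le> ?N" "(\<integral>z. \<bar>Re (poly s2 z)\<bar> powr p \<partial>circle) \<le> ?N"
      using int_R[of s1] int_R[of s2] int_t p
      by (auto intro!: integral_mono powr_mono2 abs_Re_le_cmod abs_Im_le_cmod simp: Re1 Re2)
    then have N: "C * (\<integral>z. \<bar>Re (poly s1 z)\<bar> powr p \<partial>circle) \<le> C * ?N" "C * (\<integral>z. \<bar>Re (poly s2 z)\<bar> powr p \<partial>circle) \<le> C * ?N"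
      using C by auto
    define t where "t s = s - [:\<i> * Im (poly s 0):]" for s :: "complex poly"
    have b1: "(\<integral>z. norm (poly (t s1) z) powr p \<partial>circle) \<le> C * ?N" "\<bar>Re (poly s1 0)\<bar> powr p \<le> C * ?N"
      using riesz[of s1] N by (auto simp: t_def)
    have b2: "(\<integral>z. norm (poly (t s2) z) powr p \<partial>circle) \<le> C * ?N" "\<bar>Re (poly s2 0)\<bar> powr p \<le> C * ?N"
      using riesz[of s2] N by (auto simp: t_def)
    \<comment> \<open>The normalisation \<open>t\<close> loses
      \<open>\<i> * Im (poly s1 0) - Im (poly s2 0)\<close>. Since \<open>s2\<close> equals
      \<open>- \<i> * s1\<close> at 0, this is expressed by the real parts at 0, for which
      \<open>riesz_real_part\<close> has its second estimate.\<close>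
    have dec: "2 * poly q z = (poly (t s1) z + \<i> * poly (t s2) z) + (of_real (Re (poly s1 0)) + \<i> * of_real (Re (poly s2 0)))" for z
      by (simp add: t_def s1_def s2_def complex_eq_iff)
    have pt: "norm (poly q z) powr p \<le> 2 powr p * (2 powr p * (norm (poly (t s1) z) powr p + norm (poly (t s2) z) powr p) +
        2 powr p * (\<bar>Re (poly s1 0)\<bar> powr p + \<bar>Re (poly s2 0)\<bar> powr p))" for z
    proof -
      have "norm (poly q z) powr p \<le> norm (2 * poly q z) powr p"
        using p by (intro powr_mono2) (auto simp: norm_mult)
      also have "\<dots> \<le> 2 powr p * (norm (poly (t s1) z + \<i> * poly (t s2) z) powr p +
          norm (of_real (Re (poly s1 0)) + \<i> * of_real (Re (poly s2 0))) powr p)"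
        unfolding dec using p by (intro norm_add_powr_le) auto
      also have "\<dots> \<le> 2 powr p * (2 powr p * (norm (poly (t s1) z) powr p + norm (\<i> * poly (t s2) z) powr p) +
          2 powr p * (norm (of_real (Re (poly s1 0)) :: complex) powr p + norm (\<i> * of_real (Re (poly s2 0))) powr p))"
        using p by (intro mult_left_mono add_mono norm_add_powr_le) auto
      finally show ?thesis
        by (simp add: norm_mult)
    qed
    have "(\<integral>z. norm (poly q z) powr p \<partial>circle) \<le> (\<integral>z. 2 powr p * (2 powr p * (norm (poly (t s1) z) powr p + norm (poly (t s2) z) powr p) +
        2 powr p * (\<bar>Re (poly s1 0)\<bar> powr p + \<bar>Re (poly s2 0)\<bar> powr p)) \<partial>circle)"
      using int_g by (intro integral_mono pt) auto
    also have "\<dots> = 2 powr p * (2 powr p * ((\<integral>z. norm (poly (t s1) z) powr p \<partial>circle) + (\<integral>z. norm (poly (t s2) z) powr p \<partial>circle)) +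
        2 powr p * (\<bar>Re (poly s1 0)\<bar> powr p + \<bar>Re (poly s2 0)\<bar> powr p))"
      using int_g measure_circle_space by simp
    also have "\<dots> \<le> 2 powr p * (2 powr p * (C * ?N + C * ?N) + 2 powr p * (C * ?N + C * ?N))"
      using b1 b2 by (intro mult_left_mono add_mono) auto
    finally show ?thesis by (simp add: algebra_simps)
  qed
  then show ?thesis
    using C by (intro exI[of _ "2 powr p * (2 powr p * (4 * C))"]) auto
qed

text \<open>Cotlar's identity: if \<open>u\<close> is the analytic part of \<open>f\<close>, then \<open>u\<^sup>2\<close> is the analytic part
  of \<open>2 * f * u - f\<^sup>2\<close>. It carries the estimate from the exponent \<open>p\<close> to \<open>2 * p\<close>.\<close>

lemma riesz_trig_double:
  assumes p: "1 < p" and C: "0 < C"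
    and riesz: "\<And>q r. (\<integral>z. norm (poly q z) powr p \<partial>circle) \<le> C * (\<integral>z. norm (trig q r z) powr p \<partial>circle)"
  shows "\<exists>C>0. \<forall>q r. (\<integral>z. norm (poly q z) powr (2 * p) \<partial>circle) \<le> C * (\<integral>z. norm (trig q r z) powr (2 * p) \<partial>circle)"
proof -
  define K where "K = 2 powr p * (2 powr p * C)"
  have K: "0 < K" using C by (simp add: K_def)
  have "(\<integral>z. norm (poly q z) powr (2 * p) \<partial>circle) \<le> (K ^ 2 + 2 * K) * (\<integral>z. norm (trig q r z) powr (2 * p) \<partial>circle)" for q r
  proof -
    let ?f = "trig q r"
    obtain q' r' where mix: "\<And>z. norm z = 1 \<Longrightarrow> poly q z * (cnj z * poly r (cnj z)) = trig q' r' z"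
      using mixed_product_trig by blast
    \<comment> \<open>\<open>h1\<close> and \<open>h2\<close> are the analytic parts of
      \<open>?f * poly q\<close> and of the square of \<open>?f\<close>; Cotlar's identity is
      \<open>2 * h1 - h2 = q ^ 2\<close>.\<close>
    define h1 where "h1 = q ^ 2 + q'"
    define h2 where "h2 = q ^ 2 + smult 2 q'"
    have t1: "trig h1 r' z = ?f z * poly q z" if z: "norm z = 1" for z
      using mix[OF z] by (simp add: h1_def trig_def algebra_simps power2_eq_square)
    have t2: "trig h2 (smult 2 r' + pCons 0 (r ^ 2)) z = ?f z * ?f z" if z: "norm z = 1" for z
      using mix[OF z] by (simp add: h2_def trig_def algebra_simps power2_eq_square)
    have cs: "continuous_on S (poly s)" for s :: "complex poly" and S
      by (intro continuous_intros continuous_on_poly)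
    have int_g: "integrable circle (\<lambda>z. norm (poly g z) powr a)" if "0 < a" for a and g :: "complex poly"
      using that by (intro integrable_circle_continuous continuous_on_norm_powr cs)
    have int_t: "integrable circle (\<lambda>z. norm (?f z) powr a)" if "0 < a" for a
      using that by (intro integrable_circle_continuous continuous_on_norm_powr continuous_on_trig)
    have int_m: "integrable circle (\<lambda>z. norm (?f z * poly q z) powr p)"
      using p by (intro integrable_circle_continuous continuous_on_norm_powr continuous_intros continuous_on_trig cs) auto
    have sq: "norm (x * x) powr p = norm x powr (2 * p)" for x :: complex
      by (simp add: norm_mult powr_mult powr_add[symmetric])
    let ?X = "\<integral>z. norm (poly q z) powr (2 * p) \<partial>circle" and ?Y = "\<integral>z. norm (?f z) powr (2 * p) \<partial>circle"
    let ?M = "\<integral>z. norm (?f z * poly q z) powr p \<partial>circle"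
    have 1: "(\<integral>z. norm (poly h1 z) powr p \<partial>circle) \<le> C * ?M"
    proof -
      have "(\<integral>z. norm (trig h1 r' z) powr p \<partial>circle) = ?M"
        by (rule Bochner_Integration.integral_cong) (auto simp: t1)
      with riesz[of h1 r'] show ?thesis by simp
    qed
    have 2: "(\<integral>z. norm (poly h2 z) powr p \<partial>circle) \<le> C * ?Y"
    proof -
      have "(\<integral>z. norm (trig h2 (smult 2 r' + pCons 0 (r ^ 2)) z) powr p \<partial>circle) = ?Y"
        by (rule Bochner_Integration.integral_cong) (auto simp: t2 sq)
      with riesz[of h2 "smult 2 r' + pCons 0 (r ^ 2)"] show ?thesis by simp
    qed
    have pt: "norm (poly q z) powr (2 * p) \<le> 2 powr p * (2 powr p * norm (poly h1 z) powr p + norm (poly h2 z) powr p)" for z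
    proof -
      have "norm (poly q z) powr (2 * p) = norm (2 * poly h1 z - poly h2 z) powr p"
        unfolding sq[symmetric] by (simp add: h1_def h2_def power2_eq_square)
      also have "\<dots> \<le> 2 powr p * (norm (2 * poly h1 z) powr p + norm (poly h2 z) powr p)"
        using p by (intro norm_diff_powr_le) auto
      finally show ?thesis by (simp add: norm_mult powr_mult)
    qed
    have "?X \<le> (\<integral>z. 2 powr p * (2 powr p * norm (poly h1 z) powr p + norm (poly h2 z) powr p) \<partial>circle)"
      using int_g p by (intro integral_mono pt) auto
    also have "\<dots> = 2 powr p * (2 powr p * (\<integral>z. norm (poly h1 z) powr p \<partial>circle) + (\<integral>z. norm (poly h2 z) powr p \<partial>circle))"
      using int_g p by simp
    also have "\<dots> \<le> 2 powr p * (2 powr p * (C * ?M) + C * ?Y)"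
      using 1 2 by (intro mult_left_mono add_mono) auto
    \<comment> \<open>Enlarging the second summand gives both the common factor
      \<open>K\<close>.\<close>
    also have "\<dots> \<le> 2 powr p * (2 powr p * (C * ?M) + 2 powr p * (C * ?Y))"
    proof -
      have "0 \<le> C * ?Y" using C by (auto intro!: mult_nonneg_nonneg integral_nonneg_AE)
      moreover have "1 \<le> 2 powr p" using p by (intro ge_one_powr_ge_zero) auto
      ultimately have "1 * (C * ?Y) \<le> 2 powr p * (C * ?Y)" by (intro mult_right_mono)
      then show ?thesis by simp
    qed
    finally have X1: "?X \<le> K * ?M + K * ?Y" by (simp add: K_def algebra_simps)
    \<comment> \<open>Weighted arithmetic-geometric mean inequality for the mixed term. After
      multiplication by \<open>K\<close> the first part is \<open>?X / 2\<close>, which the left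
      side of \<open>X1\<close> absorbs.\<close>
    have "?M \<le> (\<integral>z. norm (poly q z) powr (2 * p) / (2 * K) + K / 2 * norm (?f z) powr (2 * p) \<partial>circle)"
    proof (rule integral_mono)
      show "integrable circle (\<lambda>z. norm (poly q z) powr (2 * p) / (2 * K) + K / 2 * norm (?f z) powr (2 * p))"
        using int_g int_t p by auto
      fix z
      define a b where "a = norm (?f z) powr p" and "b = norm (poly q z) powr p"
      have sqs: "norm (?f z) powr (2 * p) = a ^ 2" "norm (poly q z) powr (2 * p) = b ^ 2"
        unfolding a_def b_def by (simp_all add: power2_eq_square powr_add[symmetric])
      have "0 \<le> (b - K * a) ^ 2 / (2 * K)" using K by simp
      also have "\<dots> = b ^ 2 / (2 * K) + K / 2 * a ^ 2 - a * b"
        using K by (simp add: field_simps power2_eq_square)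
      finally show "norm (?f z * poly q z) powr p \<le> norm (poly q z) powr (2 * p) / (2 * K) + K / 2 * norm (?f z) powr (2 * p)"
        unfolding sqs by (simp add: norm_mult powr_mult a_def b_def)
    qed (rule int_m)
    also have "\<dots> = ?X / (2 * K) + K / 2 * ?Y"
      using int_g int_t p by simp
    finally have "K * ?M \<le> K * (?X / (2 * K) + K / 2 * ?Y)"
      using K by (intro mult_left_mono) auto
    also have "\<dots> = ?X / 2 + K ^ 2 / 2 * ?Y"
      using K by (simp add: field_simps power2_eq_square)
    finally show ?thesis using X1 by (simp add: algebra_simps)
  qed
  then show ?thesis
    using K by (intro exI[of _ "K ^ 2 + 2 * K"]) (auto intro: add_pos_pos)
qed

text \<open>Halving \<open>p\<close> finitely often leads into the range from 1 to 2. Every exponent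
  is reached exactly, so no interpolation between exponents enters.\<close>

lemma riesz_trig:
  assumes p: "1 < p"
  shows "\<exists>C>0. \<forall>q r. (\<integral>z. norm (poly q z) powr p \<partial>circle) \<le> C * (\<integral>z. norm (trig q r z) powr p \<partial>circle)"
proof -
  have "\<exists>C>0. \<forall>q r. (\<integral>z. norm (poly q z) powr p \<partial>circle) \<le> C * (\<integral>z. norm (trig q r z) powr p \<partial>circle)"
    if "1 < p" "p \<le> 2 ^ Suc n" for n p
    using that
  proof (induction n arbitrary: p)
    case 0
    then show ?case by (intro riesz_trig_le_2) auto
  next
    case (Suc n)
    show ?case
    proof (cases "p \<le> 2")
      case True
      with Suc.prems show ?thesis by (intro riesz_trig_le_2)
    next
      case False
      with Suc.prems have "1 < p / 2" "p / 2 \<le> 2 ^ Suc n" by auto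
      with Suc.IH[OF this] riesz_trig_double[of "p / 2"] show ?thesis by auto
    qed
  qed
  moreover obtain n where "p < 2 ^ n"
    using real_arch_pow[of 2 p] by auto
  then have "p \<le> 2 ^ Suc n" using p by simp
  ultimately show ?thesis using p by blast
qed

section \<open>Functions with integrable powers\<close>

text \<open>Limits and truncations are pointwise constructions, so the analysis is done with
  functions and carried over to the classes of \<open>circle_fun\<close> afterwards.\<close>

definition Lp_fun :: "real \<Rightarrow> (complex \<Rightarrow> complex) set" where
  "Lp_fun p = {f \<in> borel_measurable circle. integrable circle (\<lambda>z. norm (f z) powr p)}"

definition power_integral :: "real \<Rightarrow> (complex \<Rightarrow> complex) \<Rightarrow> real" where
  "power_integral p f = (\<integral>z. norm (f z) powr p \<partial>circle)"

lemma Lp_funD [measurable_dest]: "f \<in> Lp_fun p \<Longrightarrow> f \<in> borel_measurable circle"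
  by (simp add: Lp_fun_def)

lemma Lp_fun_integrable_powr: "f \<in> Lp_fun p \<Longrightarrow> integrable circle (\<lambda>z. norm (f z) powr p)"
  by (simp add: Lp_fun_def)

lemma power_integral_nonneg: "0 \<le> power_integral p f"
  unfolding power_integral_def by (rule integral_nonneg_AE) auto

lemma Lp_fun_dominated:
  assumes [measurable]: "f \<in> borel_measurable circle" and g: "integrable circle g"
    and le: "AE z in circle. norm (f z) powr p \<le> g z"
  shows "f \<in> Lp_fun p"
  unfolding Lp_fun_def
proof (intro CollectI conjI)
  show "integrable circle (\<lambda>z. norm (f z) powr p)"
    by (rule Bochner_Integration.integrable_bound[OF g]) (use le in auto)
qed fact

lemma Lp_fun_continuous:
  assumes "continuous_on (sphere 0 1) f" "0 < p"
  shows "f \<in> Lp_fun p"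
  unfolding Lp_fun_def
  using assms by (auto intro!: integrable_circle_continuous continuous_on_norm_powr
      borel_measurable_integrable)

lemma Lp_fun_add: "f \<in> Lp_fun p \<Longrightarrow> g \<in> Lp_fun p \<Longrightarrow> 0 \<le> p \<Longrightarrow> (\<lambda>z. f z + g z) \<in> Lp_fun p"
  by (rule Lp_fun_dominated[where g = "\<lambda>z. 2 powr p * (norm (f z) powr p + norm (g z) powr p)"])
    (auto intro!: Lp_fun_integrable_powr norm_add_powr_le intro: Lp_funD)

lemma Lp_fun_diff: "f \<in> Lp_fun p \<Longrightarrow> g \<in> Lp_fun p \<Longrightarrow> 0 \<le> p \<Longrightarrow> (\<lambda>z. f z - g z) \<in> Lp_fun p"
  by (rule Lp_fun_dominated[where g = "\<lambda>z. 2 powr p * (norm (f z) powr p + norm (g z) powr p)"])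
    (auto intro!: Lp_fun_integrable_powr norm_diff_powr_le intro: Lp_funD)

lemma power_integral_add_le:
  assumes "f \<in> Lp_fun p" "g \<in> Lp_fun p" "0 \<le> p"
  shows "power_integral p (\<lambda>z. f z + g z) \<le> 2 powr p * (power_integral p f + power_integral p g)"
proof -
  have "power_integral p (\<lambda>z. f z + g z) \<le> (\<integral>z. 2 powr p * (norm (f z) powr p + norm (g z) powr p) \<partial>circle)"
    unfolding power_integral_def using assms Lp_fun_add[OF assms]
    by (intro integral_mono norm_add_powr_le) (auto intro!: Lp_fun_integrable_powr)
  also have "\<dots> = 2 powr p * (power_integral p f + power_integral p g)"
    unfolding power_integral_def using assms by (simp add: Lp_fun_integrable_powr)
  finally show ?thesis .
qed

lemma power_integral_diff_le:
  assumes "f \<in> Lp_fun p" "g \<in> Lp_fun p" "0 \<le> p"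
  shows "power_integral p (\<lambda>z. f z - g z) \<le> 2 powr p * (power_integral p f + power_integral p g)"
proof -
  have "power_integral p (\<lambda>z. f z - g z) \<le> (\<integral>z. 2 powr p * (norm (f z) powr p + norm (g z) powr p) \<partial>circle)"
    unfolding power_integral_def using assms Lp_fun_diff[OF assms]
    by (intro integral_mono norm_diff_powr_le) (auto intro!: Lp_fun_integrable_powr)
  also have "\<dots> = 2 powr p * (power_integral p f + power_integral p g)"
    unfolding power_integral_def using assms by (simp add: Lp_fun_integrable_powr)
  finally show ?thesis .
qed

lemma power_integral_diff_commute: "power_integral p (\<lambda>z. f z - g z) = power_integral p (\<lambda>z. g z - f z)"
  by (simp add: power_integral_def norm_minus_commute)

lemma Lp_fun_mult_bounded:
  assumes f: "f \<in> Lp_fun p" and a [measurable]: "a \<in> borel_measurable circle"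
    and B: "AE z in circle. norm (a z) \<le> B" and p: "0 \<le> p"
  shows "(\<lambda>z. a z * f z) \<in> Lp_fun p"
proof (rule Lp_fun_dominated[where g = "\<lambda>z. B powr p * norm (f z) powr p"])
  show "AE z in circle. norm (a z * f z) powr p \<le> B powr p * norm (f z) powr p"
    using B by eventually_elim (auto simp: norm_mult powr_mult intro!: mult_right_mono powr_mono2 p)
qed (use f in \<open>auto intro!: Lp_fun_integrable_powr\<close>)

lemma Lp_fun_integrable:
  assumes f: "f \<in> Lp_fun p" and p: "1 \<le> p"
  shows "integrable circle f"
proof (rule Bochner_Integration.integrable_bound[where f = "\<lambda>z. 1 + norm (f z) powr p"])
  have "norm x \<le> 1 + norm x powr p" for x :: complex
  proof (cases "norm x \<le> 1")
    case False
    then have "norm x powr 1 \<le> norm x powr p" using p by (intro powr_mono) auto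
    with False show ?thesis by (simp add: powr_one)
  qed (simp add: add_increasing2)
  then show "AE z in circle. norm (f z) \<le> norm (1 + norm (f z) powr p)"
    by (simp add: add_nonneg_nonneg)
qed (use f in \<open>auto intro: Lp_fun_integrable_powr\<close>)

text \<open>A substitute for Hoelder's inequality: a value above \<open>\<delta>\<close> is at most
  \<open>\<delta> powr (1 - p)\<close> times its p-th power. The free \<open>\<delta>\<close> lets
  convergence of \<open>power_integral\<close> to 0 imply convergence of the integral of the
  norm.\<close>

lemma integral_norm_le_power_integral:
  assumes f: "f \<in> Lp_fun p" and p: "1 \<le> p" and \<delta>: "0 < \<delta>"
  shows "(\<integral>z. norm (f z) \<partial>circle) \<le> \<delta> + \<delta> powr (1 - p) * power_integral p f"
proof -
  have "norm x \<le> \<delta> + \<delta> powr (1 - p) * norm x powr p" for x :: complex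
  proof (cases "norm x \<le> \<delta>")
    case False
    then have "\<delta> powr (p - 1) \<le> norm x powr (p - 1)"
      using p \<delta> by (intro powr_mono2) auto
    then have "\<delta> powr (1 - p) * (norm x * \<delta> powr (p - 1)) \<le> \<delta> powr (1 - p) * (norm x * norm x powr (p - 1))"
      by (intro mult_left_mono) auto
    moreover have "\<delta> powr (1 - p) * \<delta> powr (p - 1) = 1"
      using \<delta> by (simp flip: powr_add)
    moreover have "norm x * norm x powr (p - 1) = norm x powr p"
      using False \<delta> by (simp add: powr_mult_base)
    ultimately have "norm x \<le> \<delta> powr (1 - p) * norm x powr p"
      by (simp add: algebra_simps)
    with \<delta> show ?thesis by simp
  qed (simp add: add_increasing2)
  then have "(\<integral>z. norm (f z) \<partial>circle) \<le> (\<integral>z. \<delta> + \<delta> powr (1 - p) * norm (f z) powr p \<partial>circle)"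
    using f p by (intro integral_mono) (auto intro!: Lp_fun_integrable_powr Lp_fun_integrable integrable_norm)
  also have "\<dots> = \<delta> + \<delta> powr (1 - p) * power_integral p f"
    using f measure_circle_space by (simp add: power_integral_def Lp_fun_integrable_powr)
  finally show ?thesis .
qed

text \<open>Used with \<open>a\<close> an integer power of \<open>z\<close>, to pass to the limit in
  Fourier coefficients.\<close>

lemma tendsto_integral_Lp_fun:
  assumes f: "f \<in> Lp_fun p" and g: "\<And>n. g n \<in> Lp_fun p" and p: "1 \<le> p"
    and lim: "(\<lambda>n. power_integral p (\<lambda>z. g n z - f z)) \<longlonglongrightarrow> 0"
    and a [measurable]: "a \<in> borel_measurable circle" and a1: "AE z in circle. norm (a z) \<le> 1"
  shows "(\<lambda>n. \<integral>z. g n z * a z \<partial>circle) \<longlonglongrightarrow> (\<integral>z. f z * a z \<partial>circle)"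
proof -
  have d: "(\<lambda>z. g n z - f z) \<in> Lp_fun p" for n
    using f g p by (intro Lp_fun_diff) auto
  have L1: "(\<lambda>n. \<integral>z. norm (g n z - f z) \<partial>circle) \<longlonglongrightarrow> 0"
  proof (rule LIMSEQ_I)
    fix e :: real assume e: "0 < e"
    \<comment> \<open>The threshold that brings the second summand of the preceding estimate, taken
      with \<open>\<delta> = e / 2\<close>, below \<open>e / 2\<close>.\<close>
    have "0 < e / 2 / (e / 2) powr (1 - p)" using e by simp
    from LIMSEQ_D[OF lim this] obtain N where
      N: "\<And>n. N \<le> n \<Longrightarrow> power_integral p (\<lambda>z. g n z - f z) < e / 2 / (e / 2) powr (1 - p)"
      using power_integral_nonneg by (auto simp: abs_of_nonneg)
    show "\<exists>N. \<forall>n\<ge>N. norm ((\<integral>z. norm (g n z - f z) \<partial>circle) - 0) < e"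
    proof (intro exI[of _ N] allI impI)
      fix n assume "N \<le> n"
      have "(\<integral>z. norm (g n z - f z) \<partial>circle) \<le> e / 2 + (e / 2) powr (1 - p) * power_integral p (\<lambda>z. g n z - f z)"
        using integral_norm_le_power_integral[OF d p, of "e / 2"] e by auto
      also have "\<dots> < e / 2 + e / 2"
        using N[OF \<open>N \<le> n\<close>] e by (simp add: field_simps)
      finally show "norm ((\<integral>z. norm (g n z - f z) \<partial>circle) - 0) < e"
        by (simp add: abs_of_nonneg integral_nonneg_AE)
    qed
  qed
  have int: "integrable circle (\<lambda>z. h z * a z)" if h: "h \<in> Lp_fun p" for h
    by (rule Bochner_Integration.integrable_bound[OF Lp_fun_integrable[OF h p]])
      (use h a1 in \<open>auto simp: norm_mult mult_left_le elim!: AE_mp\<close>)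
  have "(\<lambda>n. (\<integral>z. g n z * a z \<partial>circle) - (\<integral>z. f z * a z \<partial>circle)) \<longlonglongrightarrow> 0"
  proof (rule Lim_null_comparison[OF _ L1], rule always_eventually, rule allI)
    fix n
    have "norm ((\<integral>z. g n z * a z \<partial>circle) - (\<integral>z. f z * a z \<partial>circle)) = norm (\<integral>z. (g n z - f z) * a z \<partial>circle)"
      using int[OF f] int[OF g] by (simp add: algebra_simps)
    also have "\<dots> \<le> (\<integral>z. norm ((g n z - f z) * a z) \<partial>circle)"
      by (rule integral_norm_bound)
    also have "\<dots> \<le> (\<integral>z. norm (g n z - f z) \<partial>circle)"
    proof (rule integral_mono_AE)
      show "integrable circle (\<lambda>z. norm ((g n z - f z) * a z))"
        by (intro integrable_norm int d)
      show "integrable circle (\<lambda>z. norm (g n z - f z))"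
        by (intro integrable_norm Lp_fun_integrable[OF d p])
      show "AE z in circle. norm ((g n z - f z) * a z) \<le> norm (g n z - f z)"
        using a1 by eventually_elim (simp add: norm_mult mult_left_le)
    qed
    finally show "norm ((\<integral>z. g n z * a z \<partial>circle) - (\<integral>z. f z * a z \<partial>circle)) \<le> (\<integral>z. norm (g n z - f z) \<partial>circle)" .
  qed
  then show ?thesis
    by (simp add: LIM_zero_iff)
qed

text \<open>Real and imaginary part are divided by \<open>B\<close> and approximated separately,
  each with bound 2, whence the factor 4. The case \<open>B = 0\<close> is split off because of the
  division.\<close>

lemma bounded_measurable_trig_approx:
  assumes v [measurable]: "v \<in> borel_measurable circle" and bound: "\<And>z. norm (v z) \<le> B"
  obtains w where "\<And>n. \<exists>q r. w n = trig q r" "\<And>n z. norm z = 1 \<Longrightarrow> norm (w n z) \<le> 4 * B"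
    "AE z in circle. (\<lambda>n. w n z) \<longlonglongrightarrow> v z"
proof (cases "B = 0")
  case True
  then have "v = (\<lambda>_. 0)" using bound by auto
  moreover have "\<exists>q r. (\<lambda>_. 0) = trig q r"
    by (intro exI[of _ 0]) (simp add: trig_def fun_eq_iff)
  ultimately show ?thesis
    by (intro that[of "\<lambda>_ _. 0"]) (auto simp: True)
next
  case False
  have "0 \<le> B" using bound[of 0] norm_ge_zero order_trans by blast
  with False have B: "0 < B" by simp
  have b: "\<bar>Re (v z) / B\<bar> \<le> 1" "\<bar>Im (v z) / B\<bar> \<le> 1" for z
    using B bound[of z] abs_Re_le_cmod[of "v z"] abs_Im_le_cmod[of "v z"] by auto
  obtain s1 where s1: "\<And>n z. norm z = 1 \<Longrightarrow> \<bar>Re (poly (s1 n) z)\<bar> \<le> 2"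
    "AE z in circle. (\<lambda>n. Re (poly (s1 n) z)) \<longlonglongrightarrow> Re (v z) / B"
    by (rule bounded_measurable_circle_approx[of "\<lambda>z. Re (v z) / B", OF _ b(1)]) auto
  obtain s2 where s2: "\<And>n z. norm z = 1 \<Longrightarrow> \<bar>Re (poly (s2 n) z)\<bar> \<le> 2"
    "AE z in circle. (\<lambda>n. Re (poly (s2 n) z)) \<longlonglongrightarrow> Im (v z) / B"
    by (rule bounded_measurable_circle_approx[of "\<lambda>z. Im (v z) / B", OF _ b(2)]) auto
  define w where "w n z = of_real B * (of_real (Re (poly (s1 n) z)) + \<i> * of_real (Re (poly (s2 n) z)))" for n z
  show thesis
  proof (rule that)
    fix n
    obtain q1 r1 where "\<And>z. of_real (Re (poly (s1 n) z)) = trig q1 r1 z"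
      using Re_poly_trig by blast
    moreover obtain q2 r2 where "\<And>z. of_real (Re (poly (s2 n) z)) = trig q2 r2 z"
      using Re_poly_trig by blast
    ultimately have "w n z = trig (smult (of_real B) (q1 + smult \<i> q2)) (smult (of_real B) (r1 + smult \<i> r2)) z" for z
      by (simp only: w_def trig_add trig_const_mult)
    then show "\<exists>q r. w n = trig q r" by blast
  next
    fix n and z :: complex assume z: "norm z = 1"
    have "norm (w n z) \<le> B * (\<bar>Re (poly (s1 n) z)\<bar> + \<bar>Re (poly (s2 n) z)\<bar>)"
      using B norm_triangle_ineq[of "of_real (Re (poly (s1 n) z))" "\<i> * of_real (Re (poly (s2 n) z))"]
      by (simp add: w_def norm_mult)
    also have "\<dots> \<le> B * (2 + 2)"
      using B s1(1)[OF z] s2(1)[OF z] by (intro mult_left_mono add_mono) auto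
    finally show "norm (w n z) \<le> 4 * B" by simp
  next
    show "AE z in circle. (\<lambda>n. w n z) \<longlonglongrightarrow> v z"
      using s1(2) s2(2)
    proof eventually_elim
      case (elim z)
      have "(\<lambda>n. w n z) \<longlonglongrightarrow> of_real B * (of_real (Re (v z) / B) + \<i> * of_real (Im (v z) / B))"
        unfolding w_def by (intro tendsto_intros elim)
      also have "of_real B * (of_real (Re (v z) / B) + \<i> * of_real (Im (v z) / B)) = v z"
        using B by (simp add: complex_eq_iff)
      finally show ?case .
    qed
  qed
qed

lemma tendsto_power_integral_dominated:
  assumes f: "\<And>n. f n \<in> borel_measurable circle" and g: "integrable circle g" and p: "0 < p"
    and le: "\<And>n. AE z in circle. norm (f n z) powr p \<le> g z"
    and lim: "AE z in circle. (\<lambda>n. f n z) \<longlonglongrightarrow> 0"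
  shows "(\<lambda>n. power_integral p (f n)) \<longlonglongrightarrow> 0"
proof -
  have "(\<lambda>n. power_integral p (f n)) \<longlonglongrightarrow> (\<integral>z. 0 \<partial>circle)"
    unfolding power_integral_def
  proof (rule integral_dominated_convergence[OF _ _ g])
    show "AE z in circle. (\<lambda>n. norm (f n z) powr p) \<longlonglongrightarrow> 0"
      using lim
    proof eventually_elim
      case (elim z)
      then have "(\<lambda>n. norm (f n z)) \<longlonglongrightarrow> 0" by (rule tendsto_norm_zero)
      from tendsto_powr'[OF this tendsto_const[of p]] p show ?case by simp
    qed
  qed (use f le in auto)
  then show ?thesis by simp
qed

text \<open>If \<open>h\<close> is almost nowhere zero, \<open>f\<close> is \<open>h\<close> times
  the quotient \<open>f / h\<close>. Truncations of the quotient are bounded and hence boundedly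
  approximable by trigonometric polynomials. The case of constant \<open>h\<close> is the density of
  these polynomials themselves.\<close>

lemma dense_multiples_trig:
  assumes p: "1 < p" and f: "f \<in> Lp_fun p" and h: "h \<in> Lp_fun p"
    and h0: "AE z in circle. h z \<noteq> 0" and e: "0 < e"
  shows "\<exists>q r. power_integral p (\<lambda>z. f z - h z * trig q r z) < e"
proof -
  have [measurable]: "f \<in> borel_measurable circle" "h \<in> borel_measurable circle"
    using f h by (auto dest: Lp_funD)
  have pos: "0 < e / (2 * 2 powr p)" using e by simp
  define v where "v n z = (if 1 < real n * norm (h z) \<and> norm (f z) \<le> real n then f z / h z else 0)" for n z
  have [measurable]: "v n \<in> borel_measurable circle" for n
    unfolding v_def by measurable
  have le: "norm (f z - h z * v n z) \<le> norm (f z)" for n z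
    by (auto simp: v_def)
  have lp1: "(\<lambda>z. f z - h z * v n z) \<in> Lp_fun p" for n
    using le p by (intro Lp_fun_dominated[OF _ Lp_fun_integrable_powr[OF f]]) (auto intro!: powr_mono2)
  have "(\<lambda>n. power_integral p (\<lambda>z. f z - h z * v n z)) \<longlonglongrightarrow> 0"
  proof (rule tendsto_power_integral_dominated)
    show "integrable circle (\<lambda>z. norm (f z) powr p)"
      by (rule Lp_fun_integrable_powr[OF f])
    show "AE z in circle. (\<lambda>n. f z - h z * v n z) \<longlonglongrightarrow> 0"
      using h0
    proof eventually_elim
      case (elim z)
      have "filterlim (\<lambda>n. real n * norm (h z)) at_top sequentially"
        using elim by (intro filterlim_at_top_mult_tendsto_pos[OF tendsto_const _ filterlim_real_sequentially]) auto
      then have "\<forall>\<^sub>F n in sequentially. 1 < real n * norm (h z)"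
        by (simp add: filterlim_at_top_dense)
      moreover have "\<forall>\<^sub>F n in sequentially. norm (f z) \<le> real n"
        using filterlim_real_sequentially by (simp add: filterlim_at_top)
      ultimately have "\<forall>\<^sub>F n in sequentially. f z - h z * v n z = 0"
        by eventually_elim (use elim in \<open>simp add: v_def\<close>)
      then show ?case by (rule tendsto_eventually)
    qed
  qed (use le p in \<open>auto intro!: powr_mono2\<close>)
  from LIMSEQ_D[OF this pos] obtain k where k: "power_integral p (\<lambda>z. f z - h z * v k z) < e / (2 * 2 powr p)"
    using power_integral_nonneg by (force simp: abs_of_nonneg)
  \<comment> \<open>Where \<open>v k\<close> is nonzero, \<open>norm (f z) \<le> k\<close> and
    \<open>norm (h z)\<close> exceeds \<open>1 / k\<close>.\<close>
  define B where "B = real k * real k"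
  have "norm (v k z) \<le> B" for z
  proof (cases "1 < real k * norm (h z) \<and> norm (f z) \<le> real k")
    case True
    then have hz: "0 < norm (h z)" by (cases "h z = 0") auto
    have "norm (f z) * 1 \<le> real k * (real k * norm (h z))"
      using True by (intro mult_mono) auto
    with hz True show ?thesis by (simp add: v_def B_def norm_divide field_simps)
  qed (auto simp: v_def B_def)
  then obtain w where w1: "\<And>n. \<exists>q r. w n = trig q r" and w2: "\<And>n z. norm z = 1 \<Longrightarrow> norm (w n z) \<le> 4 * B"
    and w3: "AE z in circle. (\<lambda>n. w n z) \<longlonglongrightarrow> v k z"
    using bounded_measurable_trig_approx[of "v k" B] by auto
  have [measurable]: "w n \<in> borel_measurable circle" for n
    using w1[of n] by (metis borel_measurable_circleI borel_measurable_continuous_onI continuous_on_trig)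
  \<comment> \<open>\<open>5 * B\<close> is the bound \<open>B\<close> for \<open>v k\<close> plus
    the bound \<open>4 * B\<close> for \<open>w n\<close>.\<close>
  have le2: "AE z in circle. norm (h z * v k z - h z * w n z) powr p \<le> (5 * B) powr p * norm (h z) powr p" for n
    using AE_circle_sphere
  proof eventually_elim
    case (elim z)
    have "norm (v k z - w n z) \<le> 5 * B"
      using norm_triangle_ineq4[of "v k z" "w n z"] w2[OF elim, of n] \<open>norm (v k z) \<le> B\<close> by simp
    then have "norm (h z * v k z - h z * w n z) \<le> 5 * B * norm (h z)"
      by (simp add: norm_mult mult.commute mult_left_mono flip: right_diff_distrib)
    then have "norm (h z * v k z - h z * w n z) powr p \<le> (5 * B * norm (h z)) powr p"
      using p by (intro powr_mono2) auto
    then show ?case by (simp add: powr_mult B_def)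
  qed
  have int2: "integrable circle (\<lambda>z. (5 * B) powr p * norm (h z) powr p)"
    by (intro integrable_mult_right Lp_fun_integrable_powr[OF h])
  have lp2: "(\<lambda>z. h z * v k z - h z * w n z) \<in> Lp_fun p" for n
    by (rule Lp_fun_dominated[OF _ int2 le2]) simp
  have "(\<lambda>n. power_integral p (\<lambda>z. h z * v k z - h z * w n z)) \<longlonglongrightarrow> 0"
  proof (rule tendsto_power_integral_dominated[OF _ int2 _ le2])
    show "AE z in circle. (\<lambda>n. h z * v k z - h z * w n z) \<longlonglongrightarrow> 0"
      using w3
    proof eventually_elim
      case (elim z)
      have "(\<lambda>n. h z * v k z - h z * w n z) \<longlonglongrightarrow> h z * v k z - h z * v k z"
        by (intro tendsto_intros elim)
      then show ?case by simp
    qed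
  qed (use p in auto)
  from LIMSEQ_D[OF this pos] obtain m where m: "power_integral p (\<lambda>z. h z * v k z - h z * w m z) < e / (2 * 2 powr p)"
    using power_integral_nonneg by (force simp: abs_of_nonneg)
  have "power_integral p (\<lambda>z. f z - h z * w m z) = power_integral p (\<lambda>z. (f z - h z * v k z) + (h z * v k z - h z * w m z))"
    by simp
  also have "\<dots> \<le> 2 powr p * (power_integral p (\<lambda>z. f z - h z * v k z) + power_integral p (\<lambda>z. h z * v k z - h z * w m z))"
    using p by (intro power_integral_add_le lp1 lp2) auto
  also have "\<dots> < 2 powr p * (e / (2 * 2 powr p) + e / (2 * 2 powr p))"
    using k m by (intro mult_strict_left_mono add_strict_mono) auto
  also have "\<dots> = e" by simp
  finally have "power_integral p (\<lambda>z. f z - h z * w m z) < e" .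
  then show ?thesis using w1[of m] by metis
qed

section \<open>Fourier coefficients of trigonometric polynomials\<close>

lemma borel_measurable_power_int_circle [measurable]: "(\<lambda>z. z powi n) \<in> borel_measurable circle"
  by (intro borel_measurable_circleI) (auto simp: power_int_def)

lemma norm_power_int_circle: "norm (z::complex) = 1 \<Longrightarrow> norm (z powi n) = 1"
  by (simp add: norm_power_int)

lemma powi_minus_circle: "norm (z::complex) = 1 \<Longrightarrow> z powi (- int n) = cnj z ^ n"
  using inverse_unique[of z "cnj z"] cnj_mult_self[of z]
  by (simp add: power_int_minus mult.commute flip: power_inverse)

lemma integral_poly_powi_0:
  assumes "n < 0"
  shows "(\<integral>z. poly q z * z powi (- n) \<partial>circle) = 0"
proof -
  obtain m where n: "- n = int (Suc m)"
    using assms by (metis Suc_pred' neg_0_less_iff_less nat_0_iff not_le_imp_less pos_int_cases zero_less_nat_eq)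
  have "(\<integral>z. poly q z * z powi (- n) \<partial>circle) = (\<integral>z. poly q z * z ^ Suc m \<partial>circle)"
    unfolding n by (simp only: power_int_of_nat)
  also have "\<dots> = poly q 0 * 0 ^ Suc m"
    by (rule integral_circle_mean_value) (intro continuous_intros continuous_on_poly holomorphic_intros)+
  finally show ?thesis by simp
qed

text \<open>The integrand is conjugate to an analytic polynomial whose factor \<open>z\<close> makes
  it vanish at 0; this factor covers the borderline case \<open>n = 0\<close>.\<close>

lemma integral_antipoly_powi_0:
  assumes "0 \<le> n"
  shows "(\<integral>z. cnj z * poly r (cnj z) * z powi (- n) \<partial>circle) = 0"
proof -
  obtain m where n: "n = int m"
    using assms nonneg_int_cases by blast
  have "(\<integral>z. cnj z * poly r (cnj z) * z powi (- n) \<partial>circle)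
      = (\<integral>z. cnj (z * poly (map_poly cnj r) z * z ^ m) \<partial>circle)"
    unfolding n by (rule Bochner_Integration.integral_cong) (auto simp: powi_minus_circle)
  also have "\<dots> = cnj (\<integral>z. z * poly (map_poly cnj r) z * z ^ m \<partial>circle)"
    by (rule Bochner_Integration.integral_cnj)
  also have "(\<integral>z. z * poly (map_poly cnj r) z * z ^ m \<partial>circle) = 0 * poly (map_poly cnj r) 0 * 0 ^ m"
    by (rule integral_circle_mean_value[of "\<lambda>z. z * poly (map_poly cnj r) z * z ^ m"])
      (intro continuous_intros continuous_on_poly holomorphic_intros)+
  finally show ?thesis by simp
qed

lemma integral_trig_powi:
  assumes "0 \<le> n"
  shows "(\<integral>z. trig q r z * z powi (- n) \<partial>circle) = (\<integral>z. poly q z * z powi (- n) \<partial>circle)"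
proof -
  have c: "continuous_on (sphere 0 1) (\<lambda>z::complex. z powi (- n))"
    by (intro continuous_intros) auto
  have "(\<integral>z. trig q r z * z powi (- n) \<partial>circle)
      = (\<integral>z. poly q z * z powi (- n) + cnj z * poly r (cnj z) * z powi (- n) \<partial>circle)"
    by (simp add: trig_def algebra_simps)
  also have "\<dots> = (\<integral>z. poly q z * z powi (- n) \<partial>circle) + (\<integral>z. cnj z * poly r (cnj z) * z powi (- n) \<partial>circle)"
    by (intro Bochner_Integration.integral_add integrable_circle_continuous continuous_intros continuous_on_poly c)
  finally show ?thesis by (simp add: integral_antipoly_powi_0[OF assms])
qed

text \<open>Completeness in the form needed here. By Markov's inequality a step larger than
  \<open>1 / 2 ^ n\<close> occurs on a set of measure at most \<open>K * (1 / 2 powr p) ^ n\<close>,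
  since the rate \<open>4 powr p\<close> leaves one factor \<open>2 powr p\<close> to spare.
  Borel-Cantelli yields convergence almost everywhere, and Fatou's lemma the estimate for the
  limit.\<close>

lemma Lp_fun_cauchy_limit:
  assumes u: "\<And>n. u n \<in> Lp_fun p" and p: "1 \<le> p" and K: "0 \<le> K"
    and cauchy: "\<And>m n. m \<le> n \<Longrightarrow> power_integral p (\<lambda>z. u n z - u m z) \<le> K * (1 / 4 powr p) ^ m"
  obtains g where "g \<in> Lp_fun p" "\<And>n. power_integral p (\<lambda>z. u n z - g z) \<le> K * (1 / 4 powr p) ^ n"
proof -
  have um [measurable]: "u n \<in> borel_measurable circle" for n
    using u by (rule Lp_funD)
  have d: "(\<lambda>z. u n z - u m z) \<in> Lp_fun p" for m n
    using p by (intro Lp_fun_diff u) auto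
  define A where "A n = {z \<in> space circle. (1 / 2 ^ n) powr p \<le> norm (u (Suc n) z - u n z) powr p}" for n
  have [measurable]: "A n \<in> sets circle" for n
    unfolding A_def by measurable
  have A: "measure circle (A n) \<le> K * (1 / 2 powr p) ^ n" for n
  proof -
    have "measure circle (A n) \<le> power_integral p (\<lambda>z. u (Suc n) z - u n z) / (1 / 2 ^ n) powr p"
      unfolding A_def power_integral_def
      by (rule integral_Markov_inequality_measure[OF Lp_fun_integrable_powr[OF d] sets.top]) auto
    also have "\<dots> \<le> K * (1 / 4 powr p) ^ n / (1 / 2 ^ n) powr p"
      by (intro divide_right_mono cauchy) auto
    also have "(1 / 2 ^ n) powr p = (1 / 2 powr p) ^ n"
      by (simp add: powr_divide powr_power powr_powr mult.commute flip: powr_realpow)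
    also have "(4::real) powr p = 2 powr p * 2 powr p"
      by (simp flip: powr_mult)
    finally show ?thesis
      by (simp add: power_divide power_mult_distrib field_simps)
  qed
  have "1 / 2 powr p < (1::real)"
    using p by simp
  then have "summable (\<lambda>n. K * (1 / 2 powr p) ^ n)"
    by (intro summable_mult summable_geometric) auto
  then have "summable (\<lambda>n. measure circle (A n))"
    by (rule summable_comparison_test') (use A in auto)
  then have "AE z in circle. \<forall>\<^sub>F n in sequentially. z \<in> space circle - A n"
    by (intro borel_cantelli_AE1) (auto simp: circle.emeasure_finite less_top[symmetric])
  then have conv: "AE z in circle. convergent (\<lambda>n. u n z)"
  proof eventually_elim
    case (elim z)
    then have "\<forall>\<^sub>F n in sequentially. norm (u (Suc n) z - u n z) \<le> (1 / 2) ^ n"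
    proof eventually_elim
      case (elim n)
      then have "norm (u (Suc n) z - u n z) powr p < (1 / 2 ^ n) powr p"
        by (auto simp: A_def)
      then have "norm (u (Suc n) z - u n z) < 1 / 2 ^ n"
        using p powr_mono2[of p "1 / 2 ^ n" "norm (u (Suc n) z - u n z)"] by (force simp: not_le[symmetric])
      then show ?case by (simp add: power_divide)
    qed
    then have "summable (\<lambda>n. u (Suc n) z - u n z)"
      by (rule summable_comparison_test_ev) (simp add: summable_geometric)
    then have "convergent (\<lambda>n. \<Sum>k<n. u (Suc k) z - u k z)"
      by (simp add: summable_iff_convergent)
    then have "convergent (\<lambda>n. (u n z - u 0 z) + u 0 z)"
      using sum_lessThan_telescope[of "\<lambda>n. u n z"]
      by (intro convergent_add convergent_const) simp
    then show ?case by simp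
  qed
  define g where "g z = lim (\<lambda>n. u n z)" for z
  have lim: "AE z in circle. (\<lambda>n. u n z) \<longlonglongrightarrow> g z"
    using conv by eventually_elim (simp add: g_def convergent_LIMSEQ_iff)
  have [measurable]: "g \<in> borel_measurable circle"
    unfolding g_def by measurable
  have nn: "(\<integral>\<^sup>+z. ennreal (norm (u n z - g z) powr p) \<partial>circle) \<le> ennreal (K * (1 / 4 powr p) ^ n)" for n
  proof -
    have "(\<integral>\<^sup>+z. ennreal (norm (u n z - g z) powr p) \<partial>circle)
        = (\<integral>\<^sup>+z. liminf (\<lambda>k. ennreal (norm (u n z - u k z) powr p)) \<partial>circle)"
    proof (rule nn_integral_cong_AE)
      show "AE z in circle. ennreal (norm (u n z - g z) powr p) = liminf (\<lambda>k. ennreal (norm (u n z - u k z) powr p))"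
        using lim
      proof eventually_elim
        case (elim z)
        have "(\<lambda>k. norm (u n z - u k z)) \<longlonglongrightarrow> norm (u n z - g z)"
          by (intro tendsto_intros elim)
        from tendsto_powr'[OF this tendsto_const[of p]]
        have "(\<lambda>k. norm (u n z - u k z) powr p) \<longlonglongrightarrow> norm (u n z - g z) powr p"
          using p by auto
        then have "(\<lambda>k. ennreal (norm (u n z - u k z) powr p)) \<longlonglongrightarrow> ennreal (norm (u n z - g z) powr p)"
          by (rule tendsto_ennrealI)
        from lim_imp_Liminf[OF _ this] show ?case by simp
      qed
    qed
    also have "\<dots> \<le> liminf (\<lambda>k. \<integral>\<^sup>+z. ennreal (norm (u n z - u k z) powr p) \<partial>circle)"
      by (rule nn_integral_liminf) measurable
    also have "\<dots> \<le> limsup (\<lambda>k. \<integral>\<^sup>+z. ennreal (norm (u n z - u k z) powr p) \<partial>circle)"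
      by (rule Liminf_le_Limsup) simp
    also have "\<dots> \<le> ennreal (K * (1 / 4 powr p) ^ n)"
    proof (rule Limsup_bounded)
      show "\<forall>\<^sub>F k in sequentially. (\<integral>\<^sup>+z. ennreal (norm (u n z - u k z) powr p) \<partial>circle) \<le> ennreal (K * (1 / 4 powr p) ^ n)"
        using eventually_ge_at_top[of n]
      proof eventually_elim
        case (elim k)
        have "(\<integral>\<^sup>+z. ennreal (norm (u n z - u k z) powr p) \<partial>circle) = ennreal (power_integral p (\<lambda>z. u n z - u k z))"
          unfolding power_integral_def by (intro nn_integral_eq_integral Lp_fun_integrable_powr d) auto
        also have "\<dots> \<le> ennreal (K * (1 / 4 powr p) ^ n)"
          using cauchy[OF elim] power_integral_diff_commute[of p "u n" "u k"] by (intro ennreal_leI) simp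
        finally show ?case .
      qed
    qed
    finally show ?thesis .
  qed
  have diff: "(\<lambda>z. u n z - g z) \<in> Lp_fun p" for n
    unfolding Lp_fun_def
  proof (intro CollectI conjI)
    show "integrable circle (\<lambda>z. norm (u n z - g z) powr p)"
      by (rule integrableI_nonneg) (use nn[of n] in \<open>auto simp: less_top[symmetric] top_unique\<close>)
  qed measurable
  show thesis
  proof (rule that)
    have "(\<lambda>z. u 0 z - (u 0 z - g z)) \<in> Lp_fun p"
      using p by (intro Lp_fun_diff u diff) auto
    then show "g \<in> Lp_fun p" by simp
    fix n
    have "ennreal (power_integral p (\<lambda>z. u n z - g z)) \<le> ennreal (K * (1 / 4 powr p) ^ n)"
      using nn[of n] nn_integral_eq_integral[OF Lp_fun_integrable_powr[OF diff[of n]]] by (simp add: power_integral_def)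
    then show "power_integral p (\<lambda>z. u n z - g z) \<le> K * (1 / 4 powr p) ^ n"
      using K by (subst (asm) ennreal_le_iff) auto
  qed
qed

text \<open>Approximate \<open>f\<close> by trigonometric polynomials. By \<open>riesz_trig\<close>
  their analytic parts form a Cauchy sequence, whose limit is \<open>g\<close>; the relations
  between Fourier coefficients survive the limit.\<close>

lemma riesz_Lp_fun:
  assumes p: "1 < p"
  shows "\<exists>C>0. \<forall>f\<in>Lp_fun p. \<exists>g\<in>Lp_fun p. power_integral p g \<le> C * power_integral p f \<and>
    (\<forall>n\<ge>0. (\<integral>z. g z * z powi (- n) \<partial>circle) = (\<integral>z. f z * z powi (- n) \<partial>circle)) \<and>
    (\<forall>n<0. (\<integral>z. g z * z powi (- n) \<partial>circle) = 0)"
proof -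
  obtain C where C: "0 < C" and riesz: "\<And>q r. power_integral p (poly q) \<le> C * power_integral p (trig q r)"
    using riesz_trig[OF p] unfolding power_integral_def by blast
  \<comment> \<open>The rate required by \<open>Lp_fun_cauchy_limit\<close>.\<close>
  define \<epsilon> :: "nat \<Rightarrow> real" where "\<epsilon> n = (1 / 4 powr p) ^ n" for n
  have \<epsilon>: "0 < \<epsilon> n" for n by (simp add: \<epsilon>_def)
  have "1 / 4 powr p < (1::real)" using p by simp
  then have \<epsilon>_lim: "\<epsilon> \<longlonglongrightarrow> 0" unfolding \<epsilon>_def by (intro LIMSEQ_power_zero) simp
  have \<epsilon>_mono: "\<epsilon> n \<le> \<epsilon> m" if "m \<le> n" for m n
    unfolding \<epsilon>_def using that \<open>1 / 4 powr p < 1\<close> by (intro power_decreasing) auto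
  have "\<exists>g\<in>Lp_fun p. power_integral p g \<le> C * 2 powr p * 2 powr p * power_integral p f \<and>
    (\<forall>n\<ge>0. (\<integral>z. g z * z powi (- n) \<partial>circle) = (\<integral>z. f z * z powi (- n) \<partial>circle)) \<and>
    (\<forall>n<0. (\<integral>z. g z * z powi (- n) \<partial>circle) = 0)" if f: "f \<in> Lp_fun p" for f
  proof -
    have "(\<lambda>_. 1) \<in> Lp_fun p"
      using p by (intro Lp_fun_continuous continuous_on_const) auto
    then have "\<exists>q r. power_integral p (\<lambda>z. f z - trig q r z) < \<epsilon> n" for n
      using dense_multiples_trig[OF p f, of "\<lambda>_. 1" "\<epsilon> n"] \<epsilon> by simp
    then obtain q r where qr: "\<And>n. power_integral p (\<lambda>z. f z - trig (q n) (r n) z) < \<epsilon> n"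
      by metis
    have tl: "trig a b \<in> Lp_fun p" and ql: "poly a \<in> Lp_fun p" for a b
      using p by (auto intro!: Lp_fun_continuous continuous_on_trig continuous_intros continuous_on_poly)
    have ftl: "(\<lambda>z. f z - trig a b z) \<in> Lp_fun p" for a b
      using p by (intro Lp_fun_diff f tl) auto
    define K where "K = C * (2 powr p * 2)"
    have K: "0 < K" using C by (simp add: K_def)
    have cauchy: "power_integral p (\<lambda>z. poly (q n) z - poly (q m) z) \<le> K * \<epsilon> m" if "m \<le> n" for m n
    proof -
      have "power_integral p (\<lambda>z. poly (q n) z - poly (q m) z) = power_integral p (poly (q n - q m))"
        by (rule arg_cong[of _ _ "power_integral p"]) auto
      also have "\<dots> \<le> C * power_integral p (trig (q n - q m) (r n - r m))"
        by (rule riesz)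
      also have "trig (q n - q m) (r n - r m) = (\<lambda>z. (f z - trig (q m) (r m) z) - (f z - trig (q n) (r n) z))"
        by (auto simp: trig_def algebra_simps)
      also have "power_integral p (\<lambda>z. (f z - trig (q m) (r m) z) - (f z - trig (q n) (r n) z))
          \<le> 2 powr p * (power_integral p (\<lambda>z. f z - trig (q m) (r m) z) + power_integral p (\<lambda>z. f z - trig (q n) (r n) z))"
        using p by (intro power_integral_diff_le ftl) auto
      also have "\<dots> \<le> 2 powr p * (\<epsilon> m + \<epsilon> m)"
        using qr[of m] qr[of n] \<epsilon>_mono[OF that] by (intro mult_left_mono add_mono) auto
      finally show ?thesis
        using C by (simp add: K_def algebra_simps)
    qed
    obtain g where g: "g \<in> Lp_fun p" and gK: "\<And>n. power_integral p (\<lambda>z. poly (q n) z - g z) \<le> K * \<epsilon> n"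
      using Lp_fun_cauchy_limit[of "\<lambda>n. poly (q n)" p K] ql cauchy K p unfolding \<epsilon>_def by auto
    have lim_g: "(\<lambda>n. power_integral p (\<lambda>z. poly (q n) z - g z)) \<longlonglongrightarrow> 0"
      by (rule tendsto_sandwich[OF _ _ tendsto_const, where h = "\<lambda>n. K * \<epsilon> n"])
        (use gK power_integral_nonneg tendsto_mult_right_zero[OF \<epsilon>_lim] in auto)
    have lim_f: "(\<lambda>n. power_integral p (\<lambda>z. trig (q n) (r n) z - f z)) \<longlonglongrightarrow> 0"
      by (rule tendsto_sandwich[OF _ _ tendsto_const \<epsilon>_lim])
        (use qr power_integral_nonneg in \<open>auto simp: power_integral_diff_commute[of p _ f] less_imp_le\<close>)
    have unimod: "AE z in circle. norm (z powi n) \<le> 1" for n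
      using AE_circle_sphere by eventually_elim (simp add: norm_power_int_circle)
    have lim1: "(\<lambda>k. \<integral>z. poly (q k) z * z powi (- n) \<partial>circle) \<longlonglongrightarrow> (\<integral>z. g z * z powi (- n) \<partial>circle)" for n
      using p by (intro tendsto_integral_Lp_fun[OF g ql _ lim_g] unimod) auto
    have lim2: "(\<lambda>k. \<integral>z. trig (q k) (r k) z * z powi (- n) \<partial>circle) \<longlonglongrightarrow> (\<integral>z. f z * z powi (- n) \<partial>circle)" for n
      using p by (intro tendsto_integral_Lp_fun[OF f tl _ lim_f] unimod) auto
    show ?thesis
    proof (intro bexI[OF _ g] conjI allI impI)
      fix n :: int assume n: "0 \<le> n"
      show "(\<integral>z. g z * z powi (- n) \<partial>circle) = (\<integral>z. f z * z powi (- n) \<partial>circle)"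
        using LIMSEQ_unique[OF lim1 lim2[of n, unfolded integral_trig_powi[OF n]]] .
    next
      fix n :: int assume n: "n < 0"
      show "(\<integral>z. g z * z powi (- n) \<partial>circle) = 0"
        using LIMSEQ_unique[OF lim1[of n, unfolded integral_poly_powi_0[OF n]] tendsto_const] .
    next
      \<comment> \<open>Replacing \<open>g\<close> by \<open>poly (q n)\<close> and
        \<open>trig (q n) (r n)\<close> by \<open>f\<close> costs a factor \<open>2 powr p\<close>
        each; the errors disappear as \<open>n\<close> grows.\<close>
      have le: "power_integral p g \<le> 2 powr p * (C * (2 powr p * (power_integral p f + \<epsilon> n)) + K * \<epsilon> n)" for n
      proof -
        have "power_integral p g = power_integral p (\<lambda>z. poly (q n) z - (poly (q n) z - g z))"
          by simp
        also have "\<dots> \<le> 2 powr p * (power_integral p (poly (q n)) + power_integral p (\<lambda>z. poly (q n) z - g z))"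
          using p by (intro power_integral_diff_le Lp_fun_diff g ql) auto
        also have "\<dots> \<le> 2 powr p * (C * power_integral p (trig (q n) (r n)) + K * \<epsilon> n)"
          by (intro mult_left_mono add_mono riesz gK) auto
        also have "power_integral p (trig (q n) (r n)) = power_integral p (\<lambda>z. f z - (f z - trig (q n) (r n) z))"
          by simp
        also have "\<dots> \<le> 2 powr p * (power_integral p f + power_integral p (\<lambda>z. f z - trig (q n) (r n) z))"
          using p by (intro power_integral_diff_le Lp_fun_diff f tl) auto
        also have "power_integral p (\<lambda>z. f z - trig (q n) (r n) z) \<le> \<epsilon> n"
          using qr by (simp add: less_imp_le)
        finally show ?thesis
          using C by simp
      qed
      have "(\<lambda>n. 2 powr p * (C * (2 powr p * (power_integral p f + \<epsilon> n)) + K * \<epsilon> n))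
          \<longlonglongrightarrow> 2 powr p * (C * (2 powr p * (power_integral p f + 0)) + K * 0)"
        by (intro tendsto_intros \<epsilon>_lim)
      from LIMSEQ_le_const[OF this, of "power_integral p g"] le
      show "power_integral p g \<le> C * 2 powr p * 2 powr p * power_integral p f"
        by (auto simp: algebra_simps)
    qed
  qed
  then show ?thesis
    using C by (intro exI[of _ "C * 2 powr p * 2 powr p"]) auto
qed

section \<open>Analytic functions that vanish on a set of positive measure\<close>

lemma integrable_mult_bounded:
  fixes f :: "complex \<Rightarrow> complex"
  assumes f: "integrable circle f" and a [measurable]: "a \<in> borel_measurable circle"
    and B: "AE z in circle. norm (a z) \<le> B"
  shows "integrable circle (\<lambda>z. f z * a z)"
proof (rule Bochner_Integration.integrable_bound)
  show "integrable circle (\<lambda>z. B * norm (f z))"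
    using f by simp
  show "AE z in circle. norm (f z * a z) \<le> norm (B * norm (f z))"
    using B
  proof eventually_elim
    case (elim z)
    then have "norm (a z) \<le> \<bar>B\<bar>" by simp
    then have "norm (a z) * norm (f z) \<le> \<bar>B\<bar> * norm (f z)" by (intro mult_right_mono) auto
    then show ?case by (simp add: norm_mult abs_mult mult.commute)
  qed
qed (use f in auto)

lemma integrable_mult_continuous:
  fixes f :: "complex \<Rightarrow> complex"
  assumes f: "integrable circle f" and a: "continuous_on (sphere 0 1) a"
  shows "integrable circle (\<lambda>z. f z * a z)"
proof -
  have "compact (a ` sphere 0 1)"
    by (rule compact_continuous_image[OF a]) auto
  then obtain B where "\<And>z. z \<in> sphere 0 1 \<Longrightarrow> norm (a z) \<le> B"
    by (meson bounded_iff compact_imp_bounded imageI)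
  then have "AE z in circle. norm (a z) \<le> B"
    by (intro AE_I2) simp
  then show ?thesis
    using integrable_circle_continuous[OF a] by (intro integrable_mult_bounded[OF f]) auto
qed

lemma integral_mult_poly_eq:
  fixes f :: "complex \<Rightarrow> complex"
  assumes f: "integrable circle f" and g: "continuous_on (sphere 0 1) g"
  shows "(\<integral>z. f z * poly q (g z) \<partial>circle) = (\<Sum>i\<le>degree q. coeff q i * (\<integral>z. f z * g z ^ i \<partial>circle))"
proof -
  have "(\<integral>z. f z * poly q (g z) \<partial>circle) = (\<integral>z. (\<Sum>i\<le>degree q. coeff q i * (f z * g z ^ i)) \<partial>circle)"
    by (simp add: poly_altdef sum_distrib_left algebra_simps)
  also have "\<dots> = (\<Sum>i\<le>degree q. (\<integral>z. coeff q i * (f z * g z ^ i) \<partial>circle))"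
    by (intro Bochner_Integration.integral_sum integrable_mult_right integrable_mult_continuous f continuous_intros g)
  finally show ?thesis by simp
qed

text \<open>\<open>f\<close> is orthogonal to all trigonometric polynomials, hence to their bounded
  pointwise limits, in particular to the unimodular factor that turns \<open>f\<close> into its
  absolute value.\<close>

lemma AE_eq_0_if_fourier_0:
  fixes f :: "complex \<Rightarrow> complex"
  assumes f: "integrable circle f" and 0: "\<And>n. (\<integral>z. f z * z powi n \<partial>circle) = 0"
  shows "AE z in circle. f z = 0"
proof -
  have [measurable]: "f \<in> borel_measurable circle" using f by auto
  have trig0: "(\<integral>z. f z * trig q r z \<partial>circle) = 0" for q r
  proof -
    have c: "continuous_on (sphere 0 1) (\<lambda>z. poly q z)" "continuous_on (sphere 0 1) (\<lambda>z. poly (pCons 0 r) (cnj z))" for q r :: "complex poly"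
      by (intro continuous_intros continuous_on_poly)+
    have "(\<integral>z. f z * poly q z \<partial>circle) = (\<Sum>i\<le>degree q. coeff q i * (\<integral>z. f z * z ^ i \<partial>circle))"
      by (rule integral_mult_poly_eq[OF f continuous_on_id])
    also have "\<dots> = 0"
    proof (intro sum.neutral ballI)
      fix i
      show "coeff q i * (\<integral>z. f z * z ^ i \<partial>circle) = 0"
        using 0[of "int i"] by (simp only: power_int_of_nat mult_zero_right)
    qed
    finally have 1: "(\<integral>z. f z * poly q z \<partial>circle) = 0" .
    have "(\<integral>z. f z * poly (pCons 0 r) (cnj z) \<partial>circle)
        = (\<Sum>i\<le>degree (pCons 0 r). coeff (pCons 0 r) i * (\<integral>z. f z * cnj z ^ i \<partial>circle))"
      by (rule integral_mult_poly_eq[OF f]) (intro continuous_intros)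
    also have "\<dots> = 0"
    proof (intro sum.neutral ballI)
      fix i
      have "(\<integral>z. f z * cnj z ^ i \<partial>circle) = (\<integral>z. f z * z powi (- int i) \<partial>circle)"
        by (rule Bochner_Integration.integral_cong) (auto simp: powi_minus_circle)
      then show "coeff (pCons 0 r) i * (\<integral>z. f z * cnj z ^ i \<partial>circle) = 0"
        using 0[of "- int i"] by simp
    qed
    finally have 2: "(\<integral>z. f z * poly (pCons 0 r) (cnj z) \<partial>circle) = 0" .
    have "(\<integral>z. f z * trig q r z \<partial>circle) = (\<integral>z. f z * poly q z + f z * poly (pCons 0 r) (cnj z) \<partial>circle)"
      by (simp add: trig_def algebra_simps)
    also have "\<dots> = 0"
      using 1 2 by (subst Bochner_Integration.integral_add) (intro integrable_mult_continuous f c | simp)+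
    finally show ?thesis .
  qed
  \<comment> \<open>Division by zero gives \<open>v z = 0\<close> where \<open>f\<close> vanishes,
    so \<open>f z * v z = norm (f z)\<close> holds everywhere.\<close>
  define v where "v z = cnj (f z) / of_real (norm (f z))" for z
  have v1: "norm (v z) \<le> 1" for z by (simp add: v_def norm_divide)
  have "cnj \<in> borel_measurable borel"
    by (intro borel_measurable_continuous_onI continuous_intros)
  then have [measurable]: "(\<lambda>z. cnj (f z)) \<in> borel_measurable circle"
    by (rule measurable_compose[rotated]) simp
  have [measurable]: "v \<in> borel_measurable circle"
    unfolding v_def by measurable
  obtain w where w1: "\<And>n. \<exists>q r. w n = trig q r" and w2: "\<And>n z. norm z = 1 \<Longrightarrow> norm (w n z) \<le> 4 * 1"
    and w3: "AE z in circle. (\<lambda>n. w n z) \<longlonglongrightarrow> v z"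
    using bounded_measurable_trig_approx[of v 1] v1 by auto
  have [measurable]: "w n \<in> borel_measurable circle" for n
    using w1[of n] by (metis borel_measurable_circleI borel_measurable_continuous_onI continuous_on_trig)
  have "(\<lambda>n. \<integral>z. f z * w n z \<partial>circle) \<longlonglongrightarrow> (\<integral>z. f z * v z \<partial>circle)"
  proof (rule integral_dominated_convergence[where w = "\<lambda>z. 4 * norm (f z)"])
    show "AE z in circle. (\<lambda>n. f z * w n z) \<longlonglongrightarrow> f z * v z"
      using w3 by eventually_elim (intro tendsto_intros)
    show "AE z in circle. norm (f z * w n z) \<le> 4 * norm (f z)" for n
      using AE_circle_sphere
    proof eventually_elim
      case (elim z)
      then show ?case
        using mult_left_mono[OF w2[OF elim, of n], of "norm (f z)"] by (simp add: norm_mult mult.commute)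
    qed
  qed (use f in auto)
  moreover have "(\<integral>z. f z * w n z \<partial>circle) = 0" for n
    using w1[of n] trig0 by auto
  ultimately have "(\<integral>z. f z * v z \<partial>circle) = 0"
    by (simp add: LIMSEQ_const_iff)
  moreover have "f z * v z = of_real (norm (f z))" for z
    by (simp add: v_def complex_norm_square[symmetric] power2_eq_square)
  ultimately have "(\<integral>z. norm (f z) \<partial>circle) = 0"
    by simp
  then show ?thesis
    using integral_nonneg_eq_0_iff_AE[OF integrable_norm[OF f]] by simp
qed

text \<open>Integrating \<open>h\<close> against a polynomial sees only its value at 0. The nonempty
  partial sums of the exponential series have value 1 there, and on the circle all of them are
  dominated by \<open>exp B\<close>.\<close>

lemma integral_mult_exp_poly:
  fixes h :: "complex \<Rightarrow> complex"
  assumes h: "integrable circle h" and 0: "\<And>n. 0 < n \<Longrightarrow> (\<integral>z. h z * z ^ n \<partial>circle) = 0"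
    and q: "poly q 0 = 0"
  shows "(\<integral>z. h z * exp (poly q z) \<partial>circle) = (\<integral>z. h z \<partial>circle)"
proof -
  have [measurable]: "h \<in> borel_measurable circle" using h by auto
  have cq: "continuous_on S (poly s)" for s :: "complex poly" and S
    by (intro continuous_intros continuous_on_poly)
  have [measurable]: "poly s \<in> borel_measurable circle" for s :: "complex poly"
    by (intro borel_measurable_circleI borel_measurable_continuous_onI cq)
  have poly: "(\<integral>z. h z * poly s z \<partial>circle) = poly s 0 * (\<integral>z. h z \<partial>circle)" for s
  proof -
    have "(\<integral>z. h z * poly s z \<partial>circle) = (\<Sum>i\<le>degree s. coeff s i * (\<integral>z. h z * z ^ i \<partial>circle))"
      by (rule integral_mult_poly_eq[OF h continuous_on_id])
    also have "\<dots> = (\<Sum>i\<in>{0}. coeff s i * (\<integral>z. h z * z ^ i \<partial>circle))"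
      by (rule sum.mono_neutral_right) (auto simp: 0)
    finally show ?thesis by (simp add: poly_0_coeff_0)
  qed
  define P where "P n = (\<Sum>k<n. smult (1 / fact k) (q ^ k))" for n
  have polyP: "poly (P n) z = (\<Sum>k<n. poly q z ^ k /\<^sub>R fact k)" for n z
    by (simp add: P_def poly_sum scaleR_conv_of_real divide_inverse)
  obtain B where B: "\<And>z. z \<in> sphere 0 1 \<Longrightarrow> norm (poly q z) \<le> B"
    using compact_imp_bounded[OF compact_continuous_image[OF cq[of "sphere 0 1" q] compact_sphere]]
    by (meson bounded_iff imageI)
  have lim: "(\<lambda>n. \<integral>z. h z * poly (P n) z \<partial>circle) \<longlonglongrightarrow> (\<integral>z. h z * exp (poly q z) \<partial>circle)"
  proof (rule integral_dominated_convergence[where w = "\<lambda>z. exp B * norm (h z)"])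
    have "(\<lambda>n. h z * poly (P n) z) \<longlonglongrightarrow> h z * exp (poly q z)" for z
      unfolding polyP using exp_converges[of "poly q z"] by (intro tendsto_intros) (simp add: sums_def)
    then show "AE z in circle. (\<lambda>n. h z * poly (P n) z) \<longlonglongrightarrow> h z * exp (poly q z)"
      by simp
    fix n
    show "AE z in circle. norm (h z * poly (P n) z) \<le> exp B * norm (h z)"
      using AE_circle_sphere
    proof eventually_elim
      case (elim z)
      have "norm (poly (P n) z) \<le> (\<Sum>k<n. norm (poly q z ^ k /\<^sub>R fact k))"
        unfolding polyP by (rule norm_sum)
      also have "\<dots> \<le> (\<Sum>k<n. B ^ k /\<^sub>R fact k)"
        using B[of z] elim by (intro sum_mono) (auto simp: norm_power intro!: divide_right_mono mult_left_mono power_mono)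
      also have "\<dots> \<le> exp B"
      proof -
        have "norm (poly q z) \<le> B" using B[of z] elim by simp
        then have "0 \<le> B" using norm_ge_zero[of "poly q z"] by linarith
        then show ?thesis
          unfolding exp_def by (intro sum_le_suminf summable_exp_generic) auto
      qed
      finally have "norm (poly (P n) z) * norm (h z) \<le> exp B * norm (h z)"
        by (intro mult_right_mono) auto
      then show ?case
        by (simp add: norm_mult mult.commute)
    qed
  qed (use h in auto)
  have "\<forall>\<^sub>F n in sequentially. (\<integral>z. h z * poly (P n) z \<partial>circle) = (\<integral>z. h z \<partial>circle)"
    using eventually_gt_at_top[of 0]
  proof eventually_elim
    case (elim n)
    have "poly (P n) 0 = (\<Sum>k<n. 0 ^ k /\<^sub>R fact k)"
      unfolding polyP q ..
    also have "\<dots> = (\<Sum>k\<in>{0}. 0 ^ k /\<^sub>R fact k)"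
      using elim by (intro sum.mono_neutral_right) auto
    finally show ?case by (simp add: poly)
  qed
  from LIMSEQ_unique[OF lim tendsto_eventually[OF this]] show ?thesis .
qed

text \<open>Multiplying \<open>h\<close> by \<open>exp (N * (u + \<i> * u'))\<close>, where \<open>u + \<i> * u'\<close> is an analytic polynomial
  that vanishes at \<open>0\<close> and \<open>u\<close> is close to the indicator function of the zero set of \<open>h\<close> minus
  the measure \<open>m\<close> of that set, does not change the mean of \<open>h\<close>, but makes the function smaller
  than \<open>exp (- N * m) * norm h\<close>.\<close>

lemma mean_eq_0_if_vanishes_on_set:
  fixes h :: "complex \<Rightarrow> complex"
  assumes h: "integrable circle h" and 0: "\<And>n. 0 < n \<Longrightarrow> (\<integral>z. h z * z ^ n \<partial>circle) = 0"
    and nz: "\<not> (AE z in circle. h z \<noteq> 0)"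
  shows "(\<integral>z. h z \<partial>circle) = 0"
proof -
  have [measurable]: "h \<in> borel_measurable circle" using h by auto
  have cq: "continuous_on S (poly s)" for s :: "complex poly" and S
    by (intro continuous_intros continuous_on_poly)
  have [measurable]: "poly s \<in> borel_measurable circle" for s :: "complex poly"
    by (intro borel_measurable_circleI borel_measurable_continuous_onI cq)
  define v :: "complex \<Rightarrow> real" where "v z = (if h z = 0 then 1 else 0)" for z
  have [measurable]: "v \<in> borel_measurable circle"
    unfolding v_def by measurable
  have v1: "\<bar>v z\<bar> \<le> 1" for z by (simp add: v_def)
  have int_v: "integrable circle v"
    by (rule circle.integrable_const_bound[of _ 1]) (auto simp: v_def)
  define m where "m = (\<integral>z. v z \<partial>circle)"
  have "0 \<le> m" unfolding m_def by (rule integral_nonneg_AE) (simp add: v_def)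
  moreover have "m \<noteq> 0"
  proof
    assume "m = 0"
    moreover have "m = 0 \<longleftrightarrow> (AE z in circle. v z = 0)"
      unfolding m_def by (rule integral_nonneg_eq_0_iff_AE[OF int_v]) (simp add: v_def)
    ultimately have "AE z in circle. v z = 0"
      by simp
    then have "AE z in circle. h z \<noteq> 0"
      by eventually_elim (simp add: v_def split: if_splits)
    with nz show False by simp
  qed
  ultimately have m: "0 < m" by simp
  obtain s where s1: "\<And>n z. norm z = 1 \<Longrightarrow> \<bar>Re (poly (s n) z)\<bar> \<le> 2"
    and s2: "AE z in circle. (\<lambda>n. Re (poly (s n) z)) \<longlonglongrightarrow> v z"
    by (rule bounded_measurable_circle_approx[of v, OF _ v1]) auto
  have Re0: "Re (poly (s n) 0) = (\<integral>z. Re (poly (s n) z) \<partial>circle)" for n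
  proof -
    have "integral\<^sup>L circle (poly (s n)) = poly (s n) 0"
      by (rule integral_circle_mean_value) (intro cq holomorphic_intros)+
    moreover have "integrable circle (poly (s n))"
      by (intro integrable_circle_continuous cq)
    ultimately show ?thesis by (metis integral_Re)
  qed
  have mlim: "(\<lambda>n. Re (poly (s n) 0)) \<longlonglongrightarrow> m"
    unfolding Re0 m_def
  proof (rule integral_dominated_convergence[where w = "\<lambda>_. 2"])
    show "AE z in circle. norm (Re (poly (s n) z)) \<le> 2" for n
      using AE_circle_sphere by eventually_elim (simp add: s1)
  qed (use s2 in auto)
  have m2: "\<bar>Re (poly (s n) 0)\<bar> \<le> 2" for n
  proof -
    have "\<bar>Re (poly (s n) 0)\<bar> \<le> (\<integral>z. \<bar>Re (poly (s n) z)\<bar> \<partial>circle)"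
      unfolding Re0 by (rule integral_abs_bound)
    also have "\<dots> \<le> (\<integral>z. 2 \<partial>circle)"
      using s1 by (intro integral_mono integrable_circle_continuous continuous_intros cq) auto
    finally show ?thesis using measure_circle_space by simp
  qed
  have bound: "norm (\<integral>z. h z \<partial>circle) \<le> exp (- real N * m) * (\<integral>z. norm (h z) \<partial>circle)" for N
  proof -
    \<comment> \<open>Vanishes at 0, as \<open>integral_mult_exp_poly\<close> requires. For fixed
      \<open>N\<close> the real part tends to \<open>N * (v - m)\<close>; only after this limit does
      \<open>N\<close> go to infinity.\<close>
    define q where "q n = smult (of_nat N) (s n - [:poly (s n) 0:])" for n
    have Req: "Re (poly (q n) z) = real N * (Re (poly (s n) z) - Re (poly (s n) 0))" for n z
      by (simp add: q_def)
    have le: "norm (\<integral>z. h z \<partial>circle) \<le> (\<integral>z. norm (h z) * exp (Re (poly (q n) z)) \<partial>circle)" for n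
    proof -
      have "(\<integral>z. h z \<partial>circle) = (\<integral>z. h z * exp (poly (q n) z) \<partial>circle)"
        by (rule integral_mult_exp_poly[OF h 0, symmetric]) (auto simp: q_def)
      also have "norm \<dots> \<le> (\<integral>z. norm (h z * exp (poly (q n) z)) \<partial>circle)"
        by (rule integral_norm_bound)
      finally show ?thesis by (simp add: norm_mult)
    qed
    have "(\<lambda>n. \<integral>z. norm (h z) * exp (Re (poly (q n) z)) \<partial>circle) \<longlonglongrightarrow> (\<integral>z. norm (h z) * exp (real N * (v z - m)) \<partial>circle)"
    proof (rule integral_dominated_convergence[where w = "\<lambda>z. norm (h z) * exp (real N * 4)"])
      show "AE z in circle. (\<lambda>n. norm (h z) * exp (Re (poly (q n) z))) \<longlonglongrightarrow> norm (h z) * exp (real N * (v z - m))"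
        using s2 by eventually_elim (unfold Req, intro tendsto_intros mlim)
      show "AE z in circle. norm (norm (h z) * exp (Re (poly (q n) z))) \<le> norm (h z) * exp (real N * 4)" for n
        using AE_circle_sphere
      proof eventually_elim
        case (elim z)
        have "Re (poly (q n) z) \<le> real N * 4"
          unfolding Req using s1[OF elim, of n] m2[of n] by (intro mult_left_mono) auto
        then show ?case by (auto intro!: mult_left_mono)
      qed
    qed (use h in auto)
    then have "norm (\<integral>z. h z \<partial>circle) \<le> (\<integral>z. norm (h z) * exp (real N * (v z - m)) \<partial>circle)"
      by (rule LIMSEQ_le_const) (use le in auto)
    \<comment> \<open>Where \<open>v\<close> is 1, and the exponential is large, \<open>h\<close> is
      0.\<close>
    also have "(\<lambda>z. norm (h z) * exp (real N * (v z - m))) = (\<lambda>z. exp (- real N * m) * norm (h z))"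
      by (auto simp: v_def)
    finally show ?thesis by simp
  qed
  have "(\<lambda>N. exp (- real N * m) * (\<integral>z. norm (h z) \<partial>circle)) \<longlonglongrightarrow> 0 * (\<integral>z. norm (h z) \<partial>circle)"
  proof (intro tendsto_intros)
    have "filterlim (\<lambda>N. real N * m) at_top sequentially"
      using filterlim_at_top_mult_tendsto_pos[OF tendsto_const m filterlim_real_sequentially] .
    then have "filterlim (\<lambda>N. - real N * m) at_bot sequentially"
      by (simp add: filterlim_uminus_at_bot)
    then show "(\<lambda>N. exp (- real N * m)) \<longlonglongrightarrow> 0"
      by (rule filterlim_compose[OF exp_at_bot])
  qed
  then have "norm (\<integral>z. h z \<partial>circle) \<le> 0 * (\<integral>z. norm (h z) \<partial>circle)"
    by (rule LIMSEQ_le_const) (use bound in blast)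
  then show ?thesis by simp
qed

text \<open>If \<open>h\<close> vanished on a set of positive measure, so would every
  \<open>h z * z powi n\<close>. Going down from \<open>n = 0\<close>, the positive moments of this
  product are zero by hypothesis or by induction, so its mean is zero too. Then all Fourier
  coefficients of \<open>h\<close> vanish, which contradicts \<open>nz\<close>.\<close>

lemma analytic_AE_nonzero:
  fixes h :: "complex \<Rightarrow> complex"
  assumes h: "integrable circle h" and 0: "\<And>n. 0 < n \<Longrightarrow> (\<integral>z. h z * z powi n \<partial>circle) = 0"
    and nz: "\<not> (AE z in circle. h z = 0)"
  shows "AE z in circle. h z \<noteq> 0"
proof (rule ccontr)
  assume z: "\<not> (AE z in circle. h z \<noteq> 0)"
  have "(\<integral>z. h z * z powi n \<partial>circle) = 0" if "n \<le> 0" for n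
    using that
  proof (induction "nat (- n)" arbitrary: n rule: less_induct)
    case less
    let ?h = "\<lambda>z. h z * z powi n"
    have "(\<integral>z. ?h z \<partial>circle) = 0"
    proof (rule mean_eq_0_if_vanishes_on_set)
      show "integrable circle ?h"
        by (rule integrable_mult_continuous[OF h]) (intro continuous_intros, auto)
      show "(\<integral>z. ?h z * z ^ k \<partial>circle) = 0" if "0 < k" for k :: nat
      proof -
        have "(\<integral>z. ?h z * z ^ k \<partial>circle) = (\<integral>z. h z * z powi (n + int k) \<partial>circle)"
        proof (rule Bochner_Integration.integral_cong)
          fix z assume "z \<in> space circle"
          then have "z \<noteq> 0" by auto
          then show "?h z * z ^ k = h z * z powi (n + int k)" by (simp add: power_int_add)
        qed simp
        also have "\<dots> = 0"
        proof (cases "n + int k \<le> 0")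
          case True
          with that less.prems show ?thesis by (intro less.hyps) auto
        next
          case False
          then show ?thesis by (intro 0) simp
        qed
        finally show ?thesis .
      qed
      show "\<not> (AE z in circle. ?h z \<noteq> 0)"
      proof
        assume "AE z in circle. ?h z \<noteq> 0"
        then have "AE z in circle. h z \<noteq> 0" by eventually_elim auto
        with z show False by simp
      qed
    qed
    then show ?case .
  qed
  then have "(\<integral>z. h z * z powi n \<partial>circle) = 0" for n
    using 0[of n] by (cases "n \<le> 0") auto
  with AE_eq_0_if_fourier_0[OF h] nz show False by blast
qed

section \<open>The spaces \<open>L\<^sup>p\<close> and \<open>H\<^sup>p\<close>\<close>

lemma measurable_rep_circle_fun [measurable]: "rep_circle_fun x \<in> borel_measurable circle"
  using Quotient3_rep_reflp[OF Quotient3_circle_fun] by auto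

lemma abs_rep_circle_fun: "abs_circle_fun (rep_circle_fun x) = x"
  by (rule Quotient3_abs_rep[OF Quotient3_circle_fun])

lemma abs_circle_fun_eq_iff:
  assumes "f \<in> borel_measurable circle" "g \<in> borel_measurable circle"
  shows "abs_circle_fun f = abs_circle_fun g \<longleftrightarrow> (AE z in circle. f z = g z)"
  using Quotient3_rel[OF Quotient3_circle_fun, of f g] assms by auto

lemma rep_abs_circle_fun:
  assumes "f \<in> borel_measurable circle"
  shows "AE z in circle. rep_circle_fun (abs_circle_fun f) z = f z"
  using abs_circle_fun_eq_iff[OF measurable_rep_circle_fun assms, of "abs_circle_fun f"]
  by (simp add: abs_rep_circle_fun)

lemma circle_fun_eqI:
  assumes "AE z in circle. rep_circle_fun x z = rep_circle_fun y z"
  shows "x = y"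
  using abs_circle_fun_eq_iff[OF measurable_rep_circle_fun measurable_rep_circle_fun, of x y] assms
  by (simp add: abs_rep_circle_fun)

lemma rep_zero: "AE z in circle. rep_circle_fun 0 z = 0"
  unfolding zero_circle_fun_def by (rule rep_abs_circle_fun) simp

lemma abs_plus:
  assumes "f \<in> borel_measurable circle" "g \<in> borel_measurable circle"
  shows "abs_circle_fun f + abs_circle_fun g = abs_circle_fun (\<lambda>z. f z + g z)"
  by (rule plus_circle_fun.abs_eq) (use assms in auto)

lemma abs_minus:
  assumes "f \<in> borel_measurable circle" "g \<in> borel_measurable circle"
  shows "abs_circle_fun f - abs_circle_fun g = abs_circle_fun (\<lambda>z. f z - g z)"
  by (rule minus_circle_fun.abs_eq) (use assms in auto)

lemma abs_times:
  assumes "f \<in> borel_measurable circle" "g \<in> borel_measurable circle"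
  shows "abs_circle_fun f * abs_circle_fun g = abs_circle_fun (\<lambda>z. f z * g z)"
  by (rule times_circle_fun.abs_eq) (use assms in auto)

lemma abs_scaleC:
  assumes "f \<in> borel_measurable circle"
  shows "c *\<^sub>C abs_circle_fun f = abs_circle_fun (\<lambda>z. c * f z)"
  by (rule scaleC.abs_eq) (use assms in auto)

lemma abs_flip:
  assumes "f \<in> borel_measurable circle"
  shows "flip (abs_circle_fun f) = abs_circle_fun (\<lambda>z. cnj z * f (cnj z))"
  by (rule flip.abs_eq) (use assms in auto)

lemma monomial_abs: "monomial n = abs_circle_fun (\<lambda>z. z powi n)"
  by (simp add: monomial_def)

lemma rep_plus: "AE z in circle. rep_circle_fun (x + y) z = rep_circle_fun x z + rep_circle_fun y z"
  using rep_abs_circle_fun[of "\<lambda>z. rep_circle_fun x z + rep_circle_fun y z"]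
  by (simp add: abs_plus[symmetric] abs_rep_circle_fun)

lemma rep_minus: "AE z in circle. rep_circle_fun (x - y) z = rep_circle_fun x z - rep_circle_fun y z"
  using rep_abs_circle_fun[of "\<lambda>z. rep_circle_fun x z - rep_circle_fun y z"]
  by (simp add: abs_minus[symmetric] abs_rep_circle_fun)

lemma rep_times: "AE z in circle. rep_circle_fun (x * y) z = rep_circle_fun x z * rep_circle_fun y z"
  using rep_abs_circle_fun[of "\<lambda>z. rep_circle_fun x z * rep_circle_fun y z"]
  by (simp add: abs_times[symmetric] abs_rep_circle_fun)

lemma rep_scaleC: "AE z in circle. rep_circle_fun (c *\<^sub>C x) z = c * rep_circle_fun x z"
  using rep_abs_circle_fun[of "\<lambda>z. c * rep_circle_fun x z"]
  by (simp add: abs_scaleC[symmetric] abs_rep_circle_fun)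

lemma rep_monomial: "AE z in circle. rep_circle_fun (monomial n) z = z powi n"
  unfolding monomial_abs by (rule rep_abs_circle_fun) simp

lemma borel_measurable_cnj_circle [measurable]: "cnj \<in> borel_measurable circle"
  by (intro borel_measurable_circleI borel_measurable_continuous_onI continuous_intros)

lemma measurable_flip_circle:
  assumes "f \<in> borel_measurable circle"
  shows "(\<lambda>z. cnj z * f (cnj z)) \<in> borel_measurable circle"
  by (intro borel_measurable_times measurable_compose[OF cnj_measurable_circle assms]) simp

lemma rep_flip: "AE z in circle. rep_circle_fun (flip x) z = cnj z * rep_circle_fun x (cnj z)"
  using rep_abs_circle_fun[OF measurable_flip_circle[OF measurable_rep_circle_fun], of x]
  by (simp add: abs_flip[symmetric] abs_rep_circle_fun)

lemma integral_circle_cnj: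
  fixes f :: "complex \<Rightarrow> complex"
  assumes "f \<in> borel_measurable circle"
  shows "(\<integral>z. f (cnj z) \<partial>circle) = (\<integral>z. f z \<partial>circle)"
  using integral_distr[OF cnj_measurable_circle assms] by (simp add: distr_circle_cnj)

lemma flip_flip: "flip (flip x) = x"
proof (rule circle_fun_eqI)
  show "AE z in circle. rep_circle_fun (flip (flip x)) z = rep_circle_fun x z"
    using rep_flip[of "flip x"] AE_circle_cnj[OF rep_flip[of x]] AE_circle_sphere
  proof eventually_elim
    case (elim z)
    then show ?case
      using cnj_mult_self[of z] by simp
  qed
qed

lemma flip_add: "flip (x + y) = flip x + flip y"
proof (rule circle_fun_eqI)
  show "AE z in circle. rep_circle_fun (flip (x + y)) z = rep_circle_fun (flip x + flip y) z"
    using rep_flip[of "x + y"] AE_circle_cnj[OF rep_plus[of x y]] rep_plus[of "flip x" "flip y"]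
      rep_flip[of x] rep_flip[of y]
    by eventually_elim (simp add: algebra_simps)
qed

lemma flip_mult_monomial: "flip (x * monomial n) = flip x * monomial (- n)"
proof (rule circle_fun_eqI)
  show "AE z in circle. rep_circle_fun (flip (x * monomial n)) z = rep_circle_fun (flip x * monomial (- n)) z"
    using rep_flip[of "x * monomial n"] AE_circle_cnj[OF rep_times[of x "monomial n"]]
      rep_times[of "flip x" "monomial (- n)"] rep_flip[of x] AE_circle_cnj[OF rep_monomial[of n]]
      rep_monomial[of "- n"] AE_circle_sphere
  proof eventually_elim
    case (elim z)
    have "cnj z = inverse z"
      using inverse_unique[of z "cnj z"] cnj_mult_self[of z] elim by (simp add: mult.commute)
    with elim show ?case by (simp add: power_int_minus power_int_inverse)
  qed
qed

lemma monomial_mult: "monomial m * monomial n = monomial (m + n)"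
proof -
  have "monomial m * monomial n = abs_circle_fun (\<lambda>z. z powi m * z powi n)"
    unfolding monomial_abs by (rule abs_times) simp_all
  also have "\<dots> = monomial (m + n)"
    unfolding monomial_abs
  proof (subst abs_circle_fun_eq_iff)
    show "AE z in circle. z powi m * z powi n = z powi (m + n)"
      using AE_circle_sphere
    proof eventually_elim
      case (elim z)
      then have "z \<noteq> 0" by auto
      then show ?case by (simp add: power_int_add)
    qed
  qed simp_all
  finally show ?thesis .
qed

lemma monomial_0: "monomial 0 = 1"
  by (simp add: monomial_abs one_circle_fun_def)

lemma Lp_iff: "x \<in> Lp p \<longleftrightarrow> rep_circle_fun x \<in> Lp_fun p"
proof -
  have "abs_powr_integrable p (abs_circle_fun (rep_circle_fun x)) \<longleftrightarrow>
      integrable circle (\<lambda>z. norm (rep_circle_fun x z) powr p)"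
    by (rule abs_powr_integrable.abs_eq) simp
  then show ?thesis
    by (simp add: Lp_def Lp_fun_def abs_rep_circle_fun)
qed

lemma Lp_norm_eq: "Lp_norm p x = power_integral p (rep_circle_fun x) powr (1 / p)"
proof -
  have "Lp_norm p (abs_circle_fun (rep_circle_fun x)) = (\<integral>z. norm (rep_circle_fun x z) powr p \<partial>circle) powr (1 / p)"
    by (rule Lp_norm.abs_eq) simp
  then show ?thesis
    by (simp add: power_integral_def abs_rep_circle_fun)
qed

lemma Lp_fun_cong_AE:
  assumes "f \<in> Lp_fun p" "g \<in> borel_measurable circle" "AE z in circle. f z = g z"
  shows "g \<in> Lp_fun p"
  by (rule Lp_fun_dominated[OF assms(2) Lp_fun_integrable_powr[OF assms(1)]])
    (use assms(3) in \<open>eventually_elim, simp\<close>)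

lemma power_integral_cong_AE:
  assumes "f \<in> borel_measurable circle" "g \<in> borel_measurable circle" "AE z in circle. f z = g z"
  shows "power_integral p f = power_integral p g"
  unfolding power_integral_def by (rule integral_cong_AE) (use assms in auto)

lemma Lp_abs:
  assumes "f \<in> Lp_fun p"
  shows "abs_circle_fun f \<in> Lp p"
proof -
  have "f \<in> borel_measurable circle" using assms by (rule Lp_funD)
  from rep_abs_circle_fun[OF this] have "AE z in circle. f z = rep_circle_fun (abs_circle_fun f) z"
    by eventually_elim simp
  then show ?thesis
    unfolding Lp_iff by (rule Lp_fun_cong_AE[OF assms measurable_rep_circle_fun])
qed

lemma fourier_coeff_eq:
  "fourier_coeff x n = (\<integral>z. rep_circle_fun x z * z powi (- n) \<partial>circle)"
proof -
  have "circle_integral (abs_circle_fun (rep_circle_fun (x * monomial (- n)))) = integral\<^sup>L circle (rep_circle_fun (x * monomial (- n)))"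
    by (rule circle_integral.abs_eq) simp
  then have "fourier_coeff x n = integral\<^sup>L circle (rep_circle_fun (x * monomial (- n)))"
    by (simp add: fourier_coeff_def abs_rep_circle_fun)
  also have "\<dots> = (\<integral>z. rep_circle_fun x z * z powi (- n) \<partial>circle)"
  proof (rule integral_cong_AE)
    show "AE z in circle. rep_circle_fun (x * monomial (- n)) z = rep_circle_fun x z * z powi (- n)"
      using rep_times[of x "monomial (- n)"] rep_monomial[of "- n"] by eventually_elim simp
  qed measurable
  finally show ?thesis .
qed

lemma fourier_coeff_monomial_mult: "fourier_coeff (x * monomial k) n = fourier_coeff x (n - k)"
  by (simp add: fourier_coeff_def mult.assoc monomial_mult)

text \<open>Conjugating the argument reverses the frequencies, and the factor \<open>cnj t\<close>
  in \<open>flip\<close> shifts them by -1. So \<open>flip\<close> exchanges nonnegative and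
  negative frequencies with no fixed frequency.\<close>

lemma fourier_coeff_flip: "fourier_coeff (flip x) n = fourier_coeff x (- n - 1)"
proof -
  have "fourier_coeff (flip x) n = (\<integral>z. rep_circle_fun (flip x) z * z powi (- n) \<partial>circle)"
    by (rule fourier_coeff_eq)
  also have "\<dots> = (\<integral>z. rep_circle_fun x (cnj z) * cnj z powi (n + 1) \<partial>circle)"
  proof (rule integral_cong_AE)
    show "AE z in circle. rep_circle_fun (flip x) z * z powi (- n) = rep_circle_fun x (cnj z) * cnj z powi (n + 1)"
      using rep_flip[of x] AE_circle_sphere
    proof eventually_elim
      case (elim z)
      have "cnj z = inverse z" "z \<noteq> 0"
        using inverse_unique[of z "cnj z"] cnj_mult_self[of z] elim by (auto simp: mult.commute)
      with elim show ?case by (simp add: power_int_minus power_int_inverse power_int_add)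
    qed
    show "(\<lambda>z. rep_circle_fun x (cnj z) * cnj z powi (n + 1)) \<in> borel_measurable circle"
      by (rule measurable_compose[OF cnj_measurable_circle, of "\<lambda>z. rep_circle_fun x z * z powi (n + 1)"]) measurable
  qed measurable
  also have "\<dots> = (\<integral>z. rep_circle_fun x z * z powi (n + 1) \<partial>circle)"
    by (rule integral_circle_cnj[of "\<lambda>z. rep_circle_fun x z * z powi (n + 1)"]) measurable
  finally show ?thesis
    by (simp add: fourier_coeff_eq algebra_simps)
qed

lemma Lp_add: "x \<in> Lp p \<Longrightarrow> y \<in> Lp p \<Longrightarrow> 1 < p \<Longrightarrow> x + y \<in> Lp p"
  unfolding Lp_iff
  by (rule Lp_fun_cong_AE[OF Lp_fun_add[of "rep_circle_fun x" p "rep_circle_fun y"]], assumption, assumption, simp,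
      rule measurable_rep_circle_fun, use rep_plus[of x y] in \<open>eventually_elim, simp\<close>)

lemma Lp_diff: "x \<in> Lp p \<Longrightarrow> y \<in> Lp p \<Longrightarrow> 1 < p \<Longrightarrow> x - y \<in> Lp p"
  unfolding Lp_iff
  by (rule Lp_fun_cong_AE[OF Lp_fun_diff[of "rep_circle_fun x" p "rep_circle_fun y"]], assumption, assumption, simp,
      rule measurable_rep_circle_fun, use rep_minus[of x y] in \<open>eventually_elim, simp\<close>)

lemma Lp_zero: "0 \<in> Lp p"
proof -
  have "(\<lambda>_. 0) \<in> Lp_fun p" by (simp add: Lp_fun_def)
  then show ?thesis unfolding zero_circle_fun_def by (rule Lp_abs)
qed

lemma Linf_iff: "a \<in> Linf \<longleftrightarrow> (\<exists>B. AE z in circle. norm (rep_circle_fun a z) \<le> B)"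
proof -
  have "essentially_bounded (abs_circle_fun (rep_circle_fun a)) \<longleftrightarrow> (\<exists>B. AE z in circle. norm (rep_circle_fun a z) \<le> B)"
    by (rule essentially_bounded.abs_eq) simp
  then show ?thesis by (simp add: Linf_def abs_rep_circle_fun)
qed

lemma Lp_mult:
  assumes "a \<in> Linf" "x \<in> Lp p" "1 < p"
  shows "a * x \<in> Lp p"
proof -
  obtain B where "AE z in circle. norm (rep_circle_fun a z) \<le> B"
    using assms(1) Linf_iff by blast
  then have "(\<lambda>z. rep_circle_fun a z * rep_circle_fun x z) \<in> Lp_fun p"
    using assms by (intro Lp_fun_mult_bounded) (auto simp: Lp_iff)
  moreover have "AE z in circle. rep_circle_fun a z * rep_circle_fun x z = rep_circle_fun (a * x) z"
    using rep_times[of a x] by eventually_elim simp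
  ultimately show ?thesis
    unfolding Lp_iff by (rule Lp_fun_cong_AE[OF _ measurable_rep_circle_fun])
qed

lemma monomial_Linf: "monomial n \<in> Linf"
  unfolding Linf_iff
proof
  show "AE z in circle. norm (rep_circle_fun (monomial n) z) \<le> 1"
    using rep_monomial[of n] AE_circle_sphere by eventually_elim (simp add: norm_power_int_circle)
qed

lemma scaleC_mult: "c *\<^sub>C x * y = c *\<^sub>C (x * y)"
  by transfer (auto simp: mult.assoc)

lemma scaleC_add: "c *\<^sub>C (x + y) = c *\<^sub>C x + c *\<^sub>C y"
  by transfer (auto simp: distrib_left)

lemma scaleC_zero: "0 *\<^sub>C x = 0"
  by transfer auto

lemma Lp_scaleC:
  assumes "x \<in> Lp p" "1 < p"
  shows "c *\<^sub>C x \<in> Lp p"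
proof -
  have "c *\<^sub>C 1 \<in> Linf"
    unfolding Linf_iff
  proof
    show "AE z in circle. norm (rep_circle_fun (c *\<^sub>C 1) z) \<le> norm c"
      using rep_scaleC[of c 1] rep_monomial[of 0] by eventually_elim (simp add: monomial_0)
  qed
  from Lp_mult[OF this assms] show ?thesis by (simp add: scaleC_mult)
qed

lemma Lp_flip:
  assumes "x \<in> Lp p"
  shows "flip x \<in> Lp p"
proof -
  have x: "rep_circle_fun x \<in> Lp_fun p" using assms by (simp add: Lp_iff)
  have "integrable (distr circle circle cnj) (\<lambda>z. norm (rep_circle_fun x z) powr p)"
    using Lp_fun_integrable_powr[OF x] by (simp add: distr_circle_cnj)
  then have "integrable circle (\<lambda>z. norm (rep_circle_fun x (cnj z)) powr p)"
    by (subst (asm) integrable_distr_eq) (auto simp: cnj_measurable_circle)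
  then show ?thesis
    unfolding Lp_iff
  proof (rule Lp_fun_dominated[rotated])
    show "AE z in circle. norm (rep_circle_fun (flip x) z) powr p \<le> norm (rep_circle_fun x (cnj z)) powr p"
      using rep_flip[of x] AE_circle_sphere by eventually_elim (simp add: norm_mult)
  qed measurable
qed

section \<open>Fourier coefficients and the Riesz projection for a fixed exponent\<close>

context
  fixes p :: real
  assumes p: "1 < p"
begin

lemma Lp_integrable: "x \<in> Lp p \<Longrightarrow> integrable circle (rep_circle_fun x)"
  using p by (intro Lp_fun_integrable[of _ p]) (auto simp: Lp_iff)

lemma Lp_integrable_fourier: "x \<in> Lp p \<Longrightarrow> integrable circle (\<lambda>z. rep_circle_fun x z * z powi n)"
  by (rule integrable_mult_continuous[OF Lp_integrable]) (auto intro!: continuous_intros)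

lemma fourier_coeff_add:
  assumes "x \<in> Lp p" "y \<in> Lp p"
  shows "fourier_coeff (x + y) n = fourier_coeff x n + fourier_coeff y n"
proof -
  have "fourier_coeff (x + y) n = (\<integral>z. rep_circle_fun x z * z powi (- n) + rep_circle_fun y z * z powi (- n) \<partial>circle)"
    unfolding fourier_coeff_eq
    by (rule integral_cong_AE, simp, simp, use rep_plus[of x y] in \<open>eventually_elim, simp add: algebra_simps\<close>)
  also have "\<dots> = fourier_coeff x n + fourier_coeff y n"
    unfolding fourier_coeff_eq using assms by (intro Bochner_Integration.integral_add Lp_integrable_fourier)
  finally show ?thesis .
qed

lemma fourier_coeff_scaleC:
  assumes "x \<in> Lp p"
  shows "fourier_coeff (c *\<^sub>C x) n = c * fourier_coeff x n"
proof -
  have "fourier_coeff (c *\<^sub>C x) n = (\<integral>z. c * (rep_circle_fun x z * z powi (- n)) \<partial>circle)"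
    unfolding fourier_coeff_eq
    by (rule integral_cong_AE, simp, simp, use rep_scaleC[of c x] in \<open>eventually_elim, simp\<close>)
  then show ?thesis
    by (simp add: fourier_coeff_eq)
qed

lemma fourier_coeff_zero: "fourier_coeff 0 n = 0"
  using fourier_coeff_add[OF Lp_zero Lp_zero, of n] by simp

lemma fourier_coeff_diff:
  assumes "x \<in> Lp p" "y \<in> Lp p"
  shows "fourier_coeff (x - y) n = fourier_coeff x n - fourier_coeff y n"
  using fourier_coeff_add[OF Lp_diff[OF assms p] assms(2), of n] by simp

lemma Lp_eq_0I:
  assumes "x \<in> Lp p" "\<And>n. fourier_coeff x n = 0"
  shows "x = 0"
proof (rule circle_fun_eqI)
  have "AE z in circle. rep_circle_fun x z = 0"
  proof (rule AE_eq_0_if_fourier_0[OF Lp_integrable[OF assms(1)]])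
    show "(\<integral>z. rep_circle_fun x z * z powi n \<partial>circle) = 0" for n
      using assms(2)[of "- n"] by (simp add: fourier_coeff_eq)
  qed
  then show "AE z in circle. rep_circle_fun x z = rep_circle_fun 0 z"
    using rep_zero by eventually_elim simp
qed

lemma Lp_eqI:
  assumes "x \<in> Lp p" "y \<in> Lp p" "\<And>n. fourier_coeff x n = fourier_coeff y n"
  shows "x = y"
  using Lp_eq_0I[OF Lp_diff[OF assms(1,2) p]] fourier_coeff_diff[OF assms(1,2)] assms(3) by simp

lemma HpD: "x \<in> Hp p \<Longrightarrow> x \<in> Lp p" "x \<in> Hp p \<Longrightarrow> n < 0 \<Longrightarrow> fourier_coeff x n = 0"
  by (auto simp: Hp_def)

text \<open>Provides the existence behind the definite description in \<open>riesz_proj\<close>,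
  together with the norm bound.\<close>

lemma riesz_proj_bounded:
  "\<exists>C>0. \<forall>x\<in>Lp p. \<exists>g\<in>Hp p. (\<forall>n\<ge>0. fourier_coeff g n = fourier_coeff x n) \<and>
     power_integral p (rep_circle_fun g) \<le> C * power_integral p (rep_circle_fun x)"
proof -
  obtain C where C: "0 < C" and riesz: "\<And>f. f \<in> Lp_fun p \<Longrightarrow> \<exists>g\<in>Lp_fun p. power_integral p g \<le> C * power_integral p f \<and>
      (\<forall>n\<ge>0. (\<integral>z. g z * z powi (- n) \<partial>circle) = (\<integral>z. f z * z powi (- n) \<partial>circle)) \<and>
      (\<forall>n<0. (\<integral>z. g z * z powi (- n) \<partial>circle) = 0)"
    using riesz_Lp_fun[OF p] by blast
  have "\<exists>g\<in>Hp p. (\<forall>n\<ge>0. fourier_coeff g n = fourier_coeff x n) \<and>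
     power_integral p (rep_circle_fun g) \<le> C * power_integral p (rep_circle_fun x)" if x: "x \<in> Lp p" for x
  proof -
    obtain g where g: "g \<in> Lp_fun p" and le: "power_integral p g \<le> C * power_integral p (rep_circle_fun x)"
      and pos: "\<And>n. 0 \<le> n \<Longrightarrow> (\<integral>z. g z * z powi (- n) \<partial>circle) = (\<integral>z. rep_circle_fun x z * z powi (- n) \<partial>circle)"
      and neg: "\<And>n. n < 0 \<Longrightarrow> (\<integral>z. g z * z powi (- n) \<partial>circle) = 0"
      using riesz[of "rep_circle_fun x"] x by (auto simp: Lp_iff)
    have [measurable]: "g \<in> borel_measurable circle" using g by (rule Lp_funD)
    let ?y = "abs_circle_fun g"
    have eq: "AE z in circle. rep_circle_fun ?y z = g z"
      by (rule rep_abs_circle_fun) measurable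
    have fc: "fourier_coeff ?y n = (\<integral>z. g z * z powi (- n) \<partial>circle)" for n
      unfolding fourier_coeff_eq
      by (rule integral_cong_AE, simp, simp, use eq in \<open>eventually_elim, simp\<close>)
    have "power_integral p (rep_circle_fun ?y) = power_integral p g"
      by (rule power_integral_cong_AE[OF _ _ eq]) measurable
    moreover have "?y \<in> Hp p"
      unfolding Hp_def using Lp_abs[OF g] by (auto simp: fc neg)
    ultimately show ?thesis
      using le by (intro bexI[of _ ?y]) (auto simp: fc fourier_coeff_eq[of x] pos)
  qed
  then show ?thesis using C by blast
qed

text \<open>Provides the uniqueness behind \<open>riesz_proj\<close>.\<close>

lemma Hp_eqI:
  assumes "x \<in> Hp p" "y \<in> Hp p" "\<And>n. 0 \<le> n \<Longrightarrow> fourier_coeff x n = fourier_coeff y n"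
  shows "x = y"
proof (rule Lp_eqI)
  show "fourier_coeff x n = fourier_coeff y n" for n
    using assms HpD(2)[of _ n] by (cases "n < 0") auto
qed (use assms HpD in auto)

lemma riesz_projI:
  assumes "g \<in> Hp p" "\<And>n. 0 \<le> n \<Longrightarrow> fourier_coeff g n = fourier_coeff x n"
  shows "riesz_proj p x = g"
  unfolding riesz_proj_def
  by (rule the_equality) (use assms in \<open>auto intro: Hp_eqI\<close>)

lemma riesz_proj:
  assumes "x \<in> Lp p"
  shows "riesz_proj p x \<in> Hp p" "0 \<le> n \<Longrightarrow> fourier_coeff (riesz_proj p x) n = fourier_coeff x n"
proof -
  obtain g where "g \<in> Hp p" "\<And>n. 0 \<le> n \<Longrightarrow> fourier_coeff g n = fourier_coeff x n"
    using riesz_proj_bounded assms by blast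
  with riesz_projI[of g x] show "riesz_proj p x \<in> Hp p"
    "0 \<le> n \<Longrightarrow> fourier_coeff (riesz_proj p x) n = fourier_coeff x n" by auto
qed

lemma power_integral_riesz_proj_le:
  obtains C where "0 < C" "\<And>x. x \<in> Lp p \<Longrightarrow> power_integral p (rep_circle_fun (riesz_proj p x)) \<le> C * power_integral p (rep_circle_fun x)"
proof -
  obtain C where C: "0 < C" and *: "\<And>x. x \<in> Lp p \<Longrightarrow> \<exists>g\<in>Hp p. (\<forall>n\<ge>0. fourier_coeff g n = fourier_coeff x n) \<and>
     power_integral p (rep_circle_fun g) \<le> C * power_integral p (rep_circle_fun x)"
    using riesz_proj_bounded by blast
  show ?thesis
    by (rule that[OF C]) (use * riesz_projI in metis)
qed

lemma Hp_zero: "0 \<in> Hp p"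
  by (simp add: Hp_def Lp_zero fourier_coeff_zero)

lemma Hp_add: "x \<in> Hp p \<Longrightarrow> y \<in> Hp p \<Longrightarrow> x + y \<in> Hp p"
  using p by (auto simp: Hp_def Lp_add fourier_coeff_add)

lemma Hp_diff: "x \<in> Hp p \<Longrightarrow> y \<in> Hp p \<Longrightarrow> x - y \<in> Hp p"
  using p by (auto simp: Hp_def Lp_diff fourier_coeff_diff)

lemma Hp_scaleC: "x \<in> Hp p \<Longrightarrow> c *\<^sub>C x \<in> Hp p"
  using p by (auto simp: Hp_def Lp_scaleC fourier_coeff_scaleC)

lemma riesz_proj_add:
  "x \<in> Lp p \<Longrightarrow> y \<in> Lp p \<Longrightarrow> riesz_proj p (x + y) = riesz_proj p x + riesz_proj p y"
  by (rule riesz_projI) (auto simp: fourier_coeff_add HpD riesz_proj intro!: Hp_add)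

lemma riesz_proj_diff:
  "x \<in> Lp p \<Longrightarrow> y \<in> Lp p \<Longrightarrow> riesz_proj p (x - y) = riesz_proj p x - riesz_proj p y"
  by (rule riesz_projI) (auto simp: fourier_coeff_diff HpD riesz_proj intro!: Hp_diff)

lemma riesz_proj_scaleC:
  "x \<in> Lp p \<Longrightarrow> riesz_proj p (c *\<^sub>C x) = c *\<^sub>C riesz_proj p x"
  by (rule riesz_projI) (auto simp: fourier_coeff_scaleC HpD riesz_proj intro!: Hp_scaleC)

lemma riesz_proj_Hp: "x \<in> Hp p \<Longrightarrow> riesz_proj p x = x"
  by (rule riesz_projI) auto

lemma riesz_proj_eq_0:
  assumes "\<And>n. 0 \<le> n \<Longrightarrow> fourier_coeff x n = 0"
  shows "riesz_proj p x = 0"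
  by (rule riesz_projI) (auto simp: Hp_zero fourier_coeff_zero assms)

lemma riesz_proj_flip: "x \<in> Hp p \<Longrightarrow> riesz_proj p (flip x) = 0"
  by (rule riesz_proj_eq_0) (auto simp: fourier_coeff_flip HpD)

lemma Hp_AE_nonzero:
  assumes x: "x \<in> Hp p" and "x \<noteq> 0"
  shows "AE z in circle. rep_circle_fun x z \<noteq> 0"
proof (rule analytic_AE_nonzero)
  show "integrable circle (rep_circle_fun x)"
    by (rule Lp_integrable[OF HpD(1)[OF x]])
  show "(\<integral>z. rep_circle_fun x z * z powi n \<partial>circle) = 0" if "0 < n" for n
    using HpD(2)[OF x, of "- n"] that by (simp add: fourier_coeff_eq)
  show "\<not> (AE z in circle. rep_circle_fun x z = 0)"
  proof
    assume "AE z in circle. rep_circle_fun x z = 0"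
    then have "AE z in circle. rep_circle_fun x z = rep_circle_fun 0 z"
      using rep_zero by eventually_elim simp
    from circle_fun_eqI[OF this] assms show False by simp
  qed
qed

end

section \<open>Toeplitz plus Hankel operators\<close>

lemma scaleC_scaleC: "b *\<^sub>C c *\<^sub>C x = (b * c) *\<^sub>C x"
  by transfer (auto simp: mult.assoc)

lemma scaleC_one: "1 *\<^sub>C x = x"
  by transfer auto

lemma scaleC_minus_one: "(- 1) *\<^sub>C x = - x"
  by transfer auto

lemma mult_scaleC_right: "x * c *\<^sub>C y = c *\<^sub>C (x * y)"
  by (metis mult.commute scaleC_mult)

lemma flip_scaleC: "flip (c *\<^sub>C x) = c *\<^sub>C flip x"
proof (rule circle_fun_eqI)
  show "AE z in circle. rep_circle_fun (flip (c *\<^sub>C x)) z = rep_circle_fun (c *\<^sub>C flip x) z"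
    using rep_flip[of "c *\<^sub>C x"] AE_circle_cnj[OF rep_scaleC[of c x]] rep_scaleC[of c "flip x"] rep_flip[of x]
    by eventually_elim simp
qed

lemma flip_monomial: "flip (monomial n) = monomial (- n - 1)"
proof (rule circle_fun_eqI)
  show "AE z in circle. rep_circle_fun (flip (monomial n)) z = rep_circle_fun (monomial (- n - 1)) z"
    using rep_flip[of "monomial n"] AE_circle_cnj[OF rep_monomial[of n]] rep_monomial[of "- n - 1"] AE_circle_sphere
  proof eventually_elim
    case (elim z)
    have "cnj z = inverse z" "z \<noteq> 0"
      using inverse_unique[of z "cnj z"] cnj_mult_self[of z] elim by (auto simp: mult.commute)
    then have "cnj z * cnj z powi n = inverse z powi (n + 1)"
      by (simp add: power_int_add)
    then show ?case
      using elim by (simp add: power_int_inverse flip: power_int_minus)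
  qed
qed

lemma fourier_coeff_monomial: "fourier_coeff (monomial m) n = (if m = n then 1 else 0)"
proof -
  have eq: "fourier_coeff (monomial m) n = (\<integral>z. z powi (m - n) \<partial>circle)"
    unfolding fourier_coeff_eq
  proof (rule integral_cong_AE)
    show "AE z in circle. rep_circle_fun (monomial m) z * z powi (- n) = z powi (m - n)"
      using rep_monomial[of m] AE_circle_sphere
    proof eventually_elim
      case (elim z)
      then have "z \<noteq> 0" by auto
      then show ?case using elim by (simp add: power_int_diff power_int_minus field_simps)
    qed
  qed measurable
  consider "m = n" | "n < m" | "m < n" by linarith
  then show ?thesis
  proof cases
    case 1
    then show ?thesis using eq measure_circle_space by simp
  next
    case 2
    then show ?thesis using eq integral_poly_powi_0[of "n - m" 1] by simp
  next
    case 3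
    have "(\<integral>z. z powi (m - n) \<partial>circle) = (\<integral>z. cnj z * poly 1 (cnj z) * z powi (- (n - m - 1)) \<partial>circle)"
    proof (rule Bochner_Integration.integral_cong)
      fix z assume "z \<in> space circle"
      then have "cnj z = inverse z" "z \<noteq> 0"
        using inverse_unique[of z "cnj z"] cnj_mult_self[of z] by (auto simp: mult.commute)
      then show "z powi (m - n) = cnj z * poly 1 (cnj z) * z powi (- (n - m - 1))"
        using power_int_add[of z "-1" "m - n + 1"] by (simp add: algebra_simps)
    qed simp
    then show ?thesis using 3 eq integral_antipoly_powi_0[of "n - m - 1" 1] by simp
  qed
qed

text \<open>An induction principle: a linear property of classes that holds for all monomials holds
  for trigonometric polynomials.\<close>

lemma trig_in_span_monomials:
  assumes mono: "\<And>n. monomial n \<in> S" and add: "\<And>x y. x \<in> S \<Longrightarrow> y \<in> S \<Longrightarrow> x + y \<in> S"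
    and scale: "\<And>c x. x \<in> S \<Longrightarrow> c *\<^sub>C x \<in> S"
  shows "abs_circle_fun (trig q r) \<in> S"
proof -
  have [measurable]: "poly q \<in> borel_measurable circle" "(\<lambda>z. poly q (cnj z)) \<in> borel_measurable circle"
    for q :: "complex poly"
    by (intro borel_measurable_circleI borel_measurable_continuous_onI continuous_intros continuous_on_poly)+
  have [measurable]: "trig q r \<in> borel_measurable circle"
    by (intro borel_measurable_circleI borel_measurable_continuous_onI continuous_on_trig)
  have "0 \<in> S"
    using scale[OF mono, of 0 0] by (simp add: scaleC_zero)
  have const: "c *\<^sub>C 1 = abs_circle_fun (\<lambda>_. c)" for c
    unfolding one_circle_fun_def by (subst abs_scaleC) simp_all
  \<comment> \<open>\<open>S\<close> is closed only under linear combinations, so the factor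
    \<open>monomial n\<close>, with \<open>n\<close> arbitrary, takes up the shift of each induction
    step.\<close>
  have 1: "monomial n * abs_circle_fun (poly q) \<in> S" for n q
  proof (induction q arbitrary: n)
    case 0
    then show ?case using \<open>0 \<in> S\<close> by (simp flip: zero_circle_fun_def)
  next
    case (pCons a q)
    have "abs_circle_fun (poly (pCons a q)) = a *\<^sub>C 1 + monomial 1 * abs_circle_fun (poly q)"
      unfolding const monomial_abs
      by (subst abs_times, simp, simp, subst abs_plus, simp, simp, rule arg_cong[of _ _ abs_circle_fun])
        (simp add: fun_eq_iff)
    then have "monomial n * abs_circle_fun (poly (pCons a q)) = a *\<^sub>C monomial n + monomial (n + 1) * abs_circle_fun (poly q)"
      by (simp add: distrib_left mult_scaleC_right monomial_mult flip: mult.assoc)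
    then show ?case using pCons.IH by (simp only: add scale mono)
  qed
  have 2: "monomial n * abs_circle_fun (\<lambda>z. poly q (cnj z)) \<in> S" for n q
  proof (induction q arbitrary: n)
    case 0
    then show ?case using \<open>0 \<in> S\<close> by (simp flip: zero_circle_fun_def)
  next
    case (pCons a q)
    have "abs_circle_fun (\<lambda>z. poly (pCons a q) (cnj z)) = a *\<^sub>C 1 + monomial (- 1) * abs_circle_fun (\<lambda>z. poly q (cnj z))"
      unfolding const monomial_abs
      by (subst abs_times, simp, simp, subst abs_plus, simp, simp, subst abs_circle_fun_eq_iff, simp, simp)
        (use AE_circle_sphere in \<open>eventually_elim, use powi_minus_circle[of _ 1] in simp\<close>)
    then have "monomial n * abs_circle_fun (\<lambda>z. poly (pCons a q) (cnj z))
        = a *\<^sub>C monomial n + monomial (n + - 1) * abs_circle_fun (\<lambda>z. poly q (cnj z))"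
      by (simp add: distrib_left mult_scaleC_right monomial_mult flip: mult.assoc)
    then show ?case using pCons.IH by (simp only: add scale mono)
  qed
  have "abs_circle_fun (trig q r) = monomial 0 * abs_circle_fun (poly q) + monomial (- 1) * abs_circle_fun (\<lambda>z. poly r (cnj z))"
    unfolding monomial_0 mult_1 unfolding monomial_abs
    by (subst abs_times, simp, simp, subst abs_plus, simp, simp, subst abs_circle_fun_eq_iff, simp, simp)
      (use AE_circle_sphere in \<open>eventually_elim, use powi_minus_circle[of _ 1] in \<open>simp add: trig_def\<close>\<close>)
  then show ?thesis using 1 2 by (auto intro: add)
qed

text \<open>For \<open>g = f + V f\<close> one has \<open>V (g * t\<^sup>n) = g * t\<^sup>-\<^sup>n\<close>. Hence \<open>\<phi>\<close> kills
  \<open>P (h * t\<^sup>n) + P (h * t\<^sup>-\<^sup>n)\<close>, and one of the two summands is zero since \<open>h = a * g\<close> has only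
  negative frequencies.\<close>

lemma coburn_simonenko_involution:
  fixes V A :: "circle_fun \<Rightarrow> circle_fun"
  assumes p: "1 < p" and a: "a \<in> GLinf"
    and A: "\<And>f. f \<in> Hp p \<Longrightarrow> A f = riesz_proj p (a * (f + V f))"
    and V_Lp: "\<And>x. x \<in> Lp p \<Longrightarrow> V x \<in> Lp p"
    and V_add: "\<And>x y. V (x + y) = V x + V y"
    and V_V: "\<And>x. V (V x) = x"
    and V_monomial: "\<And>x n. V (x * monomial n) = V x * monomial (- n)"
    and inj: "\<And>f. f \<in> Hp p \<Longrightarrow> f + V f = 0 \<Longrightarrow> f = 0"
    and symm: "\<And>x. x \<in> Lp p \<Longrightarrow> \<exists>w\<in>Hp p. x + V x = w + V w"
  shows "Hp_kernel p A = {0} \<or> Hp_coker p A = {zero_functional p}"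
proof (rule disjCI)
  obtain b where aL: "a \<in> Linf" and b: "a * b = 1"
    using a by (auto simp: GLinf_def)
  have aLp: "a * x \<in> Lp p" if "x \<in> Lp p" for x
    by (rule Lp_mult[OF aL that p])
  have "V 0 = 0" using V_add[of 0 0] by simp
  have A0: "A 0 = 0"
    using A[OF Hp_zero[OF p]] riesz_proj_Hp[OF p Hp_zero[OF p]] by (simp add: \<open>V 0 = 0\<close>)
  have A_Hp: "A f \<in> Hp p" if f: "f \<in> Hp p" for f
    unfolding A[OF f] by (intro riesz_proj[OF p] aLp Lp_add[OF _ _ p] V_Lp HpD(1)[OF p f])
  have zero_coker: "zero_functional p \<in> Hp_coker p A"
    unfolding Hp_coker_def Hp_dual_def zero_functional_def Hp_adjoint_def
    by (auto simp: Hp_add[OF p] Hp_scaleC[OF p] A_Hp intro!: exI[of _ 0] restrict_ext)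
  assume "Hp_coker p A \<noteq> {zero_functional p}"
  with zero_coker obtain \<phi> where \<phi>: "\<phi> \<in> Hp_coker p A" "\<phi> \<noteq> zero_functional p"
    by blast
  have \<phi>_add: "\<phi> (x + y) = \<phi> x + \<phi> y" if "x \<in> Hp p" "y \<in> Hp p" for x y
    using \<phi>(1) that by (auto simp: Hp_coker_def Hp_dual_def)
  have \<phi>_scaleC: "\<phi> (c *\<^sub>C x) = c * \<phi> x" if "x \<in> Hp p" for x c
    using \<phi>(1) that by (auto simp: Hp_coker_def Hp_dual_def)
  have "\<exists>C. \<forall>x\<in>Hp p. norm (\<phi> x) \<le> C * Lp_norm p x"
    using \<phi>(1) by (simp add: Hp_coker_def Hp_dual_def)
  then obtain C0 where C0: "\<And>x. x \<in> Hp p \<Longrightarrow> norm (\<phi> x) \<le> C0 * Lp_norm p x"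
    by blast
  have \<phi>_A: "\<phi> (A f) = 0" if "f \<in> Hp p" for f
  proof -
    have "Hp_adjoint p A \<phi> f = zero_functional p f"
      using \<phi>(1) by (simp add: Hp_coker_def)
    with that show ?thesis by (simp add: Hp_adjoint_def zero_functional_def)
  qed
  have \<phi>_ext: "\<phi> \<in> extensional (Hp p)"
    using \<phi>(1) by (auto simp: Hp_coker_def Hp_dual_def)
  \<comment> \<open>Extends \<open>\<phi>\<close> from \<open>Hp p\<close> to \<open>Lp p\<close>,
    where multiplication by monomials is possible.\<close>
  define \<Phi> where "\<Phi> x = \<phi> (riesz_proj p x)" for x
  have \<Phi>_add: "\<Phi> (x + y) = \<Phi> x + \<Phi> y" if "x \<in> Lp p" "y \<in> Lp p" for x y
    using that by (simp add: \<Phi>_def riesz_proj_add[OF p] \<phi>_add riesz_proj[OF p])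
  have \<Phi>_scaleC: "\<Phi> (c *\<^sub>C x) = c * \<Phi> x" if "x \<in> Lp p" for x c
    using that by (simp add: \<Phi>_def riesz_proj_scaleC[OF p] \<phi>_scaleC riesz_proj[OF p])
  have \<phi>_0: "\<phi> 0 = 0"
    using \<phi>_scaleC[OF Hp_zero[OF p], of 0] by (simp add: scaleC_zero)
  \<comment> \<open>The assumption \<open>symm\<close> replaces \<open>x\<close> by an analytic
    \<open>w\<close> with the same symmetrisation, and on such \<open>w\<close> the functional
    vanishes because it is in the cokernel.\<close>
  have \<Phi>_range: "\<Phi> (a * (x + V x)) = 0" if x: "x \<in> Lp p" for x
  proof -
    obtain w where "w \<in> Hp p" "x + V x = w + V w"
      using symm[OF x] by blast
    with \<phi>_A[of w] show ?thesis by (simp add: \<Phi>_def A)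
  qed
  have "f = 0" if f: "f \<in> Hp_kernel p A" for f
  proof (rule ccontr)
    assume "f \<noteq> 0"
    have fH: "f \<in> Hp p" and "A f = 0"
      using f by (auto simp: Hp_kernel_def)
    define g where "g = f + V f"
    have g: "g \<in> Lp p" unfolding g_def by (intro Lp_add[OF _ _ p] V_Lp HpD(1)[OF p fH])
    have Vg: "V g = g" by (simp add: g_def V_add V_V add.commute)
    define h where "h = a * g"
    have h: "h \<in> Lp p" unfolding h_def by (rule aLp[OF g])
    have hm: "h * monomial n \<in> Lp p" for n
      using Lp_mult[OF monomial_Linf h p, of n] by (simp add: mult.commute)
    have "riesz_proj p h = 0"
      using A[OF fH] \<open>A f = 0\<close> by (simp add: h_def g_def)
    then have h_neg: "fourier_coeff h n = 0" if "0 \<le> n" for n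
      using riesz_proj(2)[OF p h that] by (simp add: fourier_coeff_zero[OF p])
    have "h \<noteq> 0"
    proof
      assume "h = 0"
      then have "b * (a * g) = 0" by (simp add: h_def)
      then have "g = 0" using b by (simp add: mult.commute flip: mult.assoc)
      with inj[OF fH] \<open>f \<noteq> 0\<close> show False by (simp add: g_def)
    qed
    \<comment> \<open>\<open>h\<close> itself has only negative frequencies; the nonvanishing
      theorem is applied to \<open>flip h\<close> and carried back by conjugation.\<close>
    have flip_h: "flip h \<in> Hp p"
      by (auto simp: Hp_def Lp_flip[OF h] fourier_coeff_flip h_neg)
    moreover have "flip h \<noteq> 0"
    proof
      assume "flip h = 0"
      then have "h = flip 0" using flip_flip[of h] by simp
      then show False using \<open>h \<noteq> 0\<close> flip_add[of 0 0] by simp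
    qed
    ultimately have "AE z in circle. rep_circle_fun (flip h) z \<noteq> 0"
      by (rule Hp_AE_nonzero[OF p])
    then have "AE z in circle. rep_circle_fun h (cnj z) \<noteq> 0"
      using rep_flip[of h] by eventually_elim auto
    from AE_circle_cnj[OF this] have h_nz: "AE z in circle. rep_circle_fun h z \<noteq> 0"
      by simp
    have \<Phi>_neg: "\<Phi> (h * monomial n) = 0" if "n \<le> 0" for n
    proof -
      have "riesz_proj p (h * monomial n) = 0"
        by (rule riesz_proj_eq_0[OF p]) (use that in \<open>auto simp: fourier_coeff_monomial_mult h_neg\<close>)
      then show ?thesis by (simp add: \<Phi>_def \<phi>_0)
    qed
    have \<Phi>_monomial: "\<Phi> (h * monomial n) = 0" for n
    proof (cases "n \<le> 0")
      case False
      have "g * monomial n \<in> Lp p"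
        using Lp_mult[OF monomial_Linf g p, of n] by (simp add: mult.commute)
      from \<Phi>_range[OF this] have "\<Phi> (h * monomial n + h * monomial (- n)) = 0"
        by (simp add: V_monomial Vg h_def algebra_simps)
      then show ?thesis
        using False \<Phi>_neg[of "- n"] by (simp add: \<Phi>_add[OF hm hm])
    qed (rule \<Phi>_neg)
    have \<Phi>_trig: "h * abs_circle_fun (trig q r) \<in> Lp p \<and> \<Phi> (h * abs_circle_fun (trig q r)) = 0" for q r
    proof -
      have "abs_circle_fun (trig q r) \<in> {w. h * w \<in> Lp p \<and> \<Phi> (h * w) = 0}"
        by (rule trig_in_span_monomials)
          (auto simp: hm \<Phi>_monomial distrib_left Lp_add[OF _ _ p] \<Phi>_add mult_scaleC_right Lp_scaleC[OF _ p] \<Phi>_scaleC)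
      then show ?thesis by simp
    qed
    obtain C where C: "0 < C" and P_le: "\<And>x. x \<in> Lp p \<Longrightarrow> power_integral p (rep_circle_fun (riesz_proj p x)) \<le> C * power_integral p (rep_circle_fun x)"
      using power_integral_riesz_proj_le[OF p] by blast
    have "\<phi> x = 0" if x: "x \<in> Hp p" for x
    proof -
      have le: "norm (\<phi> x) \<le> \<bar>C0\<bar> * e" if e: "0 < e" for e
      proof -
        have xL: "x \<in> Lp p" by (rule HpD(1)[OF p x])
        \<comment> \<open>After the projection, which costs the factor \<open>C\<close>, and the
          p-th root, this leaves exactly the distance \<open>e\<close>.\<close>
        have e': "0 < e powr p / C" using e C by simp
        obtain q r where qr: "power_integral p (\<lambda>z. rep_circle_fun x z - rep_circle_fun h z * trig q r z) < e powr p / C"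
          using dense_multiples_trig[OF p _ _ h_nz e', of "rep_circle_fun x"] xL h by (auto simp: Lp_iff)
        let ?w = "abs_circle_fun (trig q r)"
        have [measurable]: "trig q r \<in> borel_measurable circle"
          by (intro borel_measurable_circleI borel_measurable_continuous_onI continuous_on_trig)
        have d: "x - h * ?w \<in> Lp p"
          by (rule Lp_diff[OF xL _ p]) (use \<Phi>_trig in simp)
        have "\<Phi> x = \<Phi> ((x - h * ?w) + h * ?w)" by simp
        also have "\<dots> = \<Phi> (x - h * ?w)"
          using \<Phi>_trig by (subst \<Phi>_add[OF d]) auto
        finally have "\<phi> x = \<phi> (riesz_proj p (x - h * ?w))"
          by (simp add: \<Phi>_def riesz_proj_Hp[OF p x])
        also have "norm \<dots> \<le> C0 * Lp_norm p (riesz_proj p (x - h * ?w))"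
          by (intro C0 riesz_proj[OF p d])
        also have "\<dots> \<le> \<bar>C0\<bar> * Lp_norm p (riesz_proj p (x - h * ?w))"
          by (intro mult_right_mono) (auto simp: Lp_norm_eq)
        also have "Lp_norm p (riesz_proj p (x - h * ?w)) \<le> e"
        proof -
          have "power_integral p (rep_circle_fun (x - h * ?w)) = power_integral p (\<lambda>z. rep_circle_fun x z - rep_circle_fun h z * trig q r z)"
          proof (rule power_integral_cong_AE)
            show "AE z in circle. rep_circle_fun (x - h * ?w) z = rep_circle_fun x z - rep_circle_fun h z * trig q r z"
              using rep_minus[of x "h * ?w"] rep_times[of h ?w] rep_abs_circle_fun[OF \<open>trig q r \<in> _\<close>]
              by eventually_elim simp
          qed measurable
          then have "power_integral p (rep_circle_fun (riesz_proj p (x - h * ?w))) \<le> C * (e powr p / C)"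
            using P_le[OF d] qr C by (smt (verit) mult_left_mono)
          also have "\<dots> = e powr p" using C by simp
          finally have "Lp_norm p (riesz_proj p (x - h * ?w)) \<le> (e powr p) powr (1 / p)"
            unfolding Lp_norm_eq using p by (intro powr_mono2) (auto simp: power_integral_nonneg)
          then show ?thesis using e p by (simp add: powr_powr)
        qed
        finally show ?thesis by (simp add: mult_left_mono)
      qed
      have "norm (\<phi> x) \<le> 0"
      proof (rule field_le_epsilon)
        fix e :: real assume "0 < e"
        \<comment> \<open>\<open>C0\<close> may be 0, hence the added 1 in the denominator.\<close>
        then have "norm (\<phi> x) \<le> \<bar>C0\<bar> * (e / (\<bar>C0\<bar> + 1))"
          by (intro le) simp
        also have "\<dots> \<le> e" using \<open>0 < e\<close> by (simp add: field_simps)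
        finally show "norm (\<phi> x) \<le> 0 + e" by simp
      qed
      then show ?thesis by simp
    qed
    then have "\<phi> = zero_functional p"
      using \<phi>_ext by (auto simp: zero_functional_def fun_eq_iff extensional_def)
    with \<phi>(2) show False by simp
  qed
  moreover have "0 \<in> Hp_kernel p A"
    using A0 Hp_zero[OF p] by (simp add: Hp_kernel_def)
  ultimately show "Hp_kernel p A = {0}" by blast
qed

text \<open>Reflects the Fourier coefficients about \<open>(k - 1) / 2\<close> and multiplies them
  by \<open>\<epsilon>\<close>.\<close>

definition twisted_flip :: "complex \<Rightarrow> int \<Rightarrow> circle_fun \<Rightarrow> circle_fun" where
  "twisted_flip \<epsilon> k x = \<epsilon> *\<^sub>C (flip x * monomial k)"

lemma twisted_flip_Lp: "x \<in> Lp p \<Longrightarrow> 1 < p \<Longrightarrow> twisted_flip \<epsilon> k x \<in> Lp p"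
  unfolding twisted_flip_def using Lp_mult[OF monomial_Linf Lp_flip, of x p k]
  by (intro Lp_scaleC) (simp_all add: mult.commute)

lemma fourier_coeff_twisted_flip:
  assumes "x \<in> Lp p" "1 < p"
  shows "fourier_coeff (twisted_flip \<epsilon> k x) n = \<epsilon> * fourier_coeff x (k - n - 1)"
proof -
  have "flip x * monomial k \<in> Lp p"
    using Lp_mult[OF monomial_Linf Lp_flip, of x p k] assms by (simp add: mult.commute)
  then show ?thesis
    unfolding twisted_flip_def using assms(2)
    by (simp add: fourier_coeff_scaleC fourier_coeff_monomial_mult fourier_coeff_flip)
qed

lemma twisted_flip_add: "twisted_flip \<epsilon> k (x + y) = twisted_flip \<epsilon> k x + twisted_flip \<epsilon> k y"
  by (simp add: twisted_flip_def flip_add distrib_right scaleC_add)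

lemma twisted_flip_monomial_mult:
  "twisted_flip \<epsilon> k (x * monomial n) = twisted_flip \<epsilon> k x * monomial (- n)"
  by (simp add: twisted_flip_def flip_mult_monomial scaleC_mult mult.assoc monomial_mult add.commute)

lemma twisted_flip_twisted_flip:
  assumes "\<epsilon> * \<epsilon> = 1"
  shows "twisted_flip \<epsilon> k (twisted_flip \<epsilon> k x) = x"
  by (simp add: twisted_flip_def flip_scaleC flip_mult_monomial flip_flip scaleC_mult scaleC_scaleC
      assms scaleC_one mult.assoc monomial_mult monomial_0)

lemma coburn_simonenko_twisted_flip:
  assumes p: "1 < p" and a: "a \<in> GLinf"
    and k: "(\<epsilon>, k) \<in> {(-1, -1), (1, 1), (1, 0), (-1, 0)}"
    and A: "\<And>f. f \<in> Hp p \<Longrightarrow> A f = riesz_proj p (a * (f + twisted_flip \<epsilon> k f))"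
  shows "Hp_kernel p A = {0} \<or> Hp_coker p A = {zero_functional p}"
proof (rule coburn_simonenko_involution[OF p a A])
  let ?V = "twisted_flip \<epsilon> k"
  show "?V (?V x) = x" for x
    using k by (intro twisted_flip_twisted_flip) auto
  show "f = 0" if f: "f \<in> Hp p" and eq: "f + ?V f = 0" for f
  proof (rule Lp_eq_0I[OF p])
    show fL: "f \<in> Lp p" by (rule HpD(1)[OF p f])
    fix n
    have sum0: "fourier_coeff f n + \<epsilon> * fourier_coeff f (k - n - 1) = 0"
      using eq fourier_coeff_add[OF p fL twisted_flip_Lp[OF fL p], of \<epsilon> k n]
      by (simp add: fourier_coeff_twisted_flip[OF fL p] fourier_coeff_zero[OF p])
    \<comment> \<open>Either \<open>n\<close> or its mirror image is negative, where
      \<open>f\<close> has coefficient 0, or \<open>n\<close> is the fixed frequency 0, where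
      \<open>sum0\<close> doubles the coefficient.\<close>
    consider "n < 0" | "k - n - 1 < 0" | "n = 0" "\<epsilon> = 1" "k = 1"
      using k by force
    then show "fourier_coeff f n = 0"
    proof cases
      case 1
      then show ?thesis by (rule HpD(2)[OF p f])
    next
      case 2
      from HpD(2)[OF p f this] sum0 show ?thesis by simp
    next
      case 3
      with sum0 show ?thesis by simp
    qed
  qed
  show "\<exists>w\<in>Hp p. x + ?V x = w + ?V w" if x: "x \<in> Lp p" for x
  proof -
    define y where "y = x - riesz_proj p x"
    have Px: "riesz_proj p x \<in> Hp p" "riesz_proj p x \<in> Lp p"
      using riesz_proj(1)[OF p x] HpD(1)[OF p] by auto
    have y: "y \<in> Lp p" unfolding y_def by (rule Lp_diff[OF x Px(2) p])
    have fy: "fourier_coeff y n = 0" if "0 \<le> n" for n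
      using that by (simp add: y_def fourier_coeff_diff[OF p x Px(2)] riesz_proj(2)[OF p x])
    \<comment> \<open>\<open>?V\<close> maps frequencies below \<open>k\<close> to nonnegative ones.
      The correction \<open>e\<close> removes from \<open>y\<close> what lies at \<open>k\<close> or
      above without changing \<open>y + ?V y\<close>; it is nontrivial only for
      \<open>k = -1\<close>, at the fixed frequency -1.\<close>
    obtain e where e: "e \<in> Lp p" "e + ?V e = 0" "\<And>n. k \<le> n \<Longrightarrow> fourier_coeff (y - e) n = 0"
    proof (cases "k = -1")
      case False
      then have "0 \<le> k" using k by auto
      then show ?thesis
        using fy twisted_flip_add[of \<epsilon> k 0 0] by (intro that[of 0]) (auto simp: Lp_zero)
    next
      case True
      then have \<epsilon>: "\<epsilon> = -1" using k by auto
      let ?e = "fourier_coeff y (-1) *\<^sub>C monomial (-1)"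
      have m: "monomial (-1) \<in> Lp p"
        using Lp_mult[OF monomial_Linf, of 1 p "-1"] p Lp_abs[OF Lp_fun_continuous[of "\<lambda>_. 1" p]]
        by (simp flip: one_circle_fun_def)
      show ?thesis
      proof (rule that)
        show e: "?e \<in> Lp p" by (rule Lp_scaleC[OF m p])
        show "?e + ?V ?e = 0"
          by (simp add: twisted_flip_def \<epsilon> True flip_scaleC flip_monomial scaleC_mult monomial_mult scaleC_minus_one)
        fix n assume "k \<le> n"
        then consider "n = -1" | "0 \<le> n" using True by linarith
        then show "fourier_coeff (y - ?e) n = 0"
          by cases (auto simp: fourier_coeff_diff[OF p y e] fourier_coeff_scaleC[OF p m] fourier_coeff_monomial fy)
      qed
    qed
    have ye: "y - e \<in> Lp p" by (rule Lp_diff[OF y e(1) p])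
    have "?V (y - e) \<in> Hp p"
      by (auto simp: Hp_def twisted_flip_Lp[OF ye p] fourier_coeff_twisted_flip[OF ye p] e(3))
    \<comment> \<open>The witness: each negative frequency of \<open>y - e\<close> is replaced by
      its mirror image, and \<open>?V\<close> brings it back.\<close>
    with Px have w: "riesz_proj p x + ?V (y - e) \<in> Hp p"
      by (intro Hp_add[OF p])
    have "x = riesz_proj p x + (y - e) + e" by (simp add: y_def)
    then have "x + ?V x = (riesz_proj p x + (y - e) + e) + ?V (riesz_proj p x + (y - e) + e)"
      by metis
    also have "\<dots> = (riesz_proj p x + (y - e) + ?V (riesz_proj p x) + ?V (y - e)) + (e + ?V e)"
      by (simp only: twisted_flip_add add_ac)
    also have "\<dots> = (riesz_proj p x + ?V (y - e)) + ?V (riesz_proj p x + ?V (y - e))"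
      unfolding e(2) using k by (subst twisted_flip_add[of _ _ "riesz_proj p x"], subst twisted_flip_twisted_flip) (auto simp: add_ac)
    finally show ?thesis using w by blast
  qed
qed (use p in \<open>simp_all add: twisted_flip_Lp twisted_flip_add twisted_flip_monomial_mult\<close>)

text \<open>For analytic \<open>f\<close> the class \<open>flip f\<close> has only negative
  frequencies, so the complementary projection in \<open>hankel\<close> fixes it and both operators
  share the outer projection and the symbol \<open>a\<close>.\<close>

lemma toeplitz_hankel_eq:
  assumes p: "1 < p" and a: "a \<in> Linf" and f: "f \<in> Hp p"
  shows "toeplitz p a f + hankel p (a * monomial k) f = riesz_proj p (a * (f + twisted_flip 1 k f))"
    and "toeplitz p a f - hankel p (a * monomial k) f = riesz_proj p (a * (f + twisted_flip (- 1) k f))"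
proof -
  have fL: "f \<in> Lp p" by (rule HpD(1)[OF p f])
  have Lp: "a * f \<in> Lp p" "a * monomial k * flip f \<in> Lp p"
    using Lp_mult[OF a fL p] Lp_mult[OF a Lp_mult[OF monomial_Linf Lp_flip[OF fL] p] p, of k]
    by (simp_all add: mult.assoc)
  have hankel: "hankel p (a * monomial k) f = riesz_proj p (a * monomial k * flip f)"
    by (simp add: hankel_def riesz_coproj_def riesz_proj_flip[OF p f])
  show "toeplitz p a f + hankel p (a * monomial k) f = riesz_proj p (a * (f + twisted_flip 1 k f))"
    unfolding hankel toeplitz_def riesz_proj_add[OF p Lp, symmetric]
    by (simp add: twisted_flip_def scaleC_one algebra_simps)
  show "toeplitz p a f - hankel p (a * monomial k) f = riesz_proj p (a * (f + twisted_flip (- 1) k f))"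
    unfolding hankel toeplitz_def riesz_proj_diff[OF p Lp, symmetric]
    by (simp add: twisted_flip_def scaleC_minus_one algebra_simps)
qed

theorem theorem4p1:
  fixes p :: real and a1 a2 a3 a4 :: circle_fun and A :: "circle_fun \<Rightarrow> circle_fun"
  assumes "1 < p"
    and "a1 \<in> GLinf" and "a2 \<in> GLinf" and "a3 \<in> GLinf" and "a4 \<in> GLinf"
    and "A \<in> {(\<lambda>f. toeplitz p a1 f - hankel p (a1 * monomial (-1)) f),
              (\<lambda>f. toeplitz p a2 f + hankel p (a2 * monomial 1) f),
              (\<lambda>f. toeplitz p a3 f + hankel p a3 f),
              (\<lambda>f. toeplitz p a4 f - hankel p a4 f)}"
  shows "Hp_kernel p A = {0} \<or> Hp_coker p A = {zero_functional p}"
proof -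
  have Linf: "a \<in> Linf" if "a \<in> GLinf" for a
    using that by (auto simp: GLinf_def)
  note eq = toeplitz_hankel_eq[OF \<open>1 < p\<close> Linf]
  \<comment> \<open>In the last two operators the Hankel symbol is \<open>a\<close> itself, the case
    \<open>k = 0\<close> with \<open>monomial 0 = 1\<close>.\<close>
  note eq0 = eq[of _ _ 0, unfolded monomial_0 mult_1_right]
  from assms(6) consider "A = (\<lambda>f. toeplitz p a1 f - hankel p (a1 * monomial (-1)) f)"
    | "A = (\<lambda>f. toeplitz p a2 f + hankel p (a2 * monomial 1) f)"
    | "A = (\<lambda>f. toeplitz p a3 f + hankel p a3 f)"
    | "A = (\<lambda>f. toeplitz p a4 f - hankel p a4 f)"
    by blast
  then show ?thesis
  proof cases
    case 1
    then show ?thesis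
      using assms by (intro coburn_simonenko_twisted_flip[of p a1 "-1" "-1"]) (auto simp: eq)
  next
    case 2
    then show ?thesis
      using assms by (intro coburn_simonenko_twisted_flip[of p a2 1 1]) (auto simp: eq)
  next
    case 3
    then show ?thesis
      using assms by (intro coburn_simonenko_twisted_flip[of p a3 1 0]) (auto simp: eq0)
  next
    case 4
    then show ?thesis
      using assms by (intro coburn_simonenko_twisted_flip[of p a4 "-1" 0]) (auto simp: eq0)
  qed
qed

end
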